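(* If $\mathscr{J}$ is a Jacobi matrix with $\mathscr{J}\in\mathrm{EC}(\infty)$, then there exists a self-adjoint operator $Q_{\mathscr{J}}$ on $\ell^2(\mathbb{Z})$ such that $$\operatorname*{s-lim}_{t\to\infty}\frac1t X_{\mathscr{J}}(t)=Q_{\mathscr{J}},$$ that is, $\lim_{t\to\infty}\left\|\frac1t X_{\mathscr{J}}(t)\varphi-Q_{\mathscr{J}}\varphi\right\|=0$ for every $\varphi\in D(X)$, and $\ker(Q_{\mathscr{J}})\cap \ell^1(\mathbb{Z})=\{0\}$. In particular, $\beta^+_\varphi(p)=\beta^-_\varphi(p)=1$ for all nonzero $\varphi\in\mathcal{S}(\mathbb{Z})$ and all $p>0$.
   Context: A Jacobi matrix is a bounded self-adjoint operator $\mathscr{J}=\mathscr{J}_{a,b}:\ell^2(\mathbb{Z})\to\ell^2(\mathbb{Z})$ given by $(\mathscr{J}\varphi)_n=a_{n-1}\varphi_{n-1}+b_n\varphi_n+a_n\varphi_{n+1}$, where $a,b\in\ell^\infty(\mathbb{Z},\mathbb{R})$ and $\inf_n a_n>0$. It is $q$-periodic ($q$ a positive integer) if $a_{n+q}=a_n$ and $b_{n+q}=b_n$ for all $n\in\mathbb{Z}$. It is limit-periodic if it is an operator-norm limit of a sequence of periodic Jacobi matrices. For $\eta>0$, a limit-periodic Jacobi matrix $\mathscr{J}$ is of exponential class $\eta$, written $\mathscr{J}\in\mathrm{EC}(\eta)$, if there exist positive integers $q_n$ ($n\ge1$) and $q_n$-periodic Jacobi matrices $\mathscr{J}_n$ such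 that $\lim_{n\to\infty}e^{\eta q_{n+1}}\|\mathscr{J}-\mathscr{J}_n\|=0$, and $q_n\mid q_{n+1}$ and $q_n\ne q_{n+1}$ for all $n$. One writes $\mathscr{J}\in\mathrm{EC}(\infty)$ if $\mathscr{J}\in\mathrm{EC}(\eta)$ for all $\eta>0$. The position operator $X$ is the self-adjoint operator $(X\varphi)_n=n\varphi_n$ with domain $D(X)=\{\varphi\in\ell^2(\mathbb{Z}):\sum_n|n\varphi_n|^2<\infty\}$, and $X_{\mathscr{J}}(t)=e^{it\mathscr{J}}Xe^{-it\mathscr{J}}$ for $t\in\mathbb{R}$; it is known that the domain of $X_{\mathscr{J}}(t)$ is $D(X)$ for all $t$. $\mathcal{S}(\mathbb{Z})=\{\varphi\in\ell^2(\mathbb{Z}):\sum_n|n|^p|\varphi_n|<\infty\text{ for all }p>0\}$. For $p>0$ and $\varphi\in\ell^2(\mathbb{Z})$ put $|X|^p_\varphi(t)=\sum_{n\in\mathbb{Z}}(|n|^p+1)\,|\langle\delta_n,e^{-it\mathscr{J}}\varphi\rangle|^2$, and for $\varphi\in\mathcal{S}(\mathbb{Z})$ $$\beta^+_\varphi(p)=\limsup_{t\to\infty}\frac{\log|X|^p_\varphi(t)}{p\log t},\qquad \beta^-_\varphi(p)=\liminf_{t\to\infty}\frac{\log|X|^p_\varphi(t)}{p\log t}.$$ *)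

theory Defs
  imports "HOL-Analysis.Analysis"
begin

section \<open>The Hilbert space of square-summable sequences on the integers\<close>

typedef ell2 = "{f :: int \<Rightarrow> complex. (\<lambda>n. (cmod (f n))\<^sup>2) summable_on UNIV}"
  morphisms coord Abs_ell2
  by (rule exI[of _ "\<lambda>_. 0"]) simp

setup_lifting type_definition_ell2

lemma ell2_eqI: "(\<And>n. coord x n = coord y n) \<Longrightarrow> x = y"
  by (metis coord_inject ext)

lemma summable_coord: "(\<lambda>n. (cmod (coord x n))\<^sup>2) summable_on UNIV"
  using coord[of x] by simp

lemma summable_sq_scale:
  fixes f :: "'i \<Rightarrow> complex"
  assumes "(\<lambda>n. (cmod (f n))\<^sup>2) summable_on UNIV"
  shows "(\<lambda>n. (cmod (c * f n))\<^sup>2) summable_on UNIV"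
  unfolding norm_mult power_mult_distrib
  by (rule summable_on_cmult_right[OF assms])

lemma summable_sq_add:
  fixes f g :: "'i \<Rightarrow> complex"
  assumes "(\<lambda>n. (cmod (f n))\<^sup>2) summable_on UNIV" "(\<lambda>n. (cmod (g n))\<^sup>2) summable_on UNIV"
  shows "(\<lambda>n. (cmod (f n + g n))\<^sup>2) summable_on UNIV"
proof (rule summable_on_comparison_test)
  show "(\<lambda>n. 2 * ((cmod (f n))\<^sup>2 + (cmod (g n))\<^sup>2)) summable_on UNIV"
    by (intro summable_on_cmult_right summable_on_add assms)
  fix n
  have "(cmod (f n + g n))\<^sup>2 \<le> (cmod (f n) + cmod (g n))\<^sup>2"
    by (intro power_mono norm_triangle_ineq norm_ge_zero)
  also have "\<dots> \<le> 2 * ((cmod (f n))\<^sup>2 + (cmod (g n))\<^sup>2)"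
    using sum_squares_bound[of "cmod (f n)" "cmod (g n)"] by (simp add: power2_sum)
  finally show "(cmod (f n + g n))\<^sup>2 \<le> 2 * ((cmod (f n))\<^sup>2 + (cmod (g n))\<^sup>2)" .
qed simp

lift_definition scaleC :: "complex \<Rightarrow> ell2 \<Rightarrow> ell2" (infixr "*\<^sub>C" 75)
  is "\<lambda>c f n. c * f n"
  by (rule summable_sq_scale)

instantiation ell2 :: real_vector
begin

lift_definition zero_ell2 :: ell2 is "\<lambda>_. 0" by simp
lift_definition plus_ell2 :: "ell2 \<Rightarrow> ell2 \<Rightarrow> ell2" is "\<lambda>f g n. f n + g n"
  by (rule summable_sq_add)
lift_definition uminus_ell2 :: "ell2 \<Rightarrow> ell2" is "\<lambda>f n. - f n"
  by simp
lift_definition minus_ell2 :: "ell2 \<Rightarrow> ell2 \<Rightarrow> ell2" is "\<lambda>f g n. f n - g n"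
proof -
  fix f g :: "int \<Rightarrow> complex"
  assume "(\<lambda>n. (cmod (f n))\<^sup>2) summable_on UNIV" "(\<lambda>n. (cmod (g n))\<^sup>2) summable_on UNIV"
  then show "(\<lambda>n. (cmod (f n - g n))\<^sup>2) summable_on UNIV"
    using summable_sq_add[of f "\<lambda>n. - g n"] by simp
qed
lift_definition scaleR_ell2 :: "real \<Rightarrow> ell2 \<Rightarrow> ell2" is "\<lambda>c f n. complex_of_real c * f n"
  by (rule summable_sq_scale)

instance
  by (standard; transfer; simp add: algebra_simps)

end

lemma coord_simps [simp]:
  "coord 0 n = 0"
  "coord (x + y) n = coord x n + coord y n"
  "coord (- x) n = - coord x n"
  "coord (x - y) n = coord x n - coord y n"
  "coord (r *\<^sub>R x) n = r *\<^sub>R coord x n"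
  "coord (c *\<^sub>C x) n = c * coord x n"
  by (transfer; simp add: scaleR_conv_of_real)+

text \<open>The inner product is linear in the second argument.\<close>

definition cinner :: "ell2 \<Rightarrow> ell2 \<Rightarrow> complex" where
  "cinner x y = (\<Sum>\<^sub>\<infinity>n. cnj (coord x n) * coord y n)"

lemma summable_cinner_norm: "(\<lambda>n. cmod (cnj (coord x n) * coord y n)) summable_on UNIV"
proof (rule summable_on_comparison_test)
  show "(\<lambda>n. (cmod (coord x n))\<^sup>2 + (cmod (coord y n))\<^sup>2) summable_on UNIV"
    by (intro summable_on_add summable_coord)
  fix n
  have "cmod (coord x n) * cmod (coord y n) \<le> (cmod (coord x n))\<^sup>2 + (cmod (coord y n))\<^sup>2"
    using sum_squares_bound[of "cmod (coord x n)" "cmod (coord y n)"]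
      mult_nonneg_nonneg[of "cmod (coord x n)" "cmod (coord y n)", OF norm_ge_zero norm_ge_zero]
    by linarith
  then show "cmod (cnj (coord x n) * coord y n) \<le> (cmod (coord x n))\<^sup>2 + (cmod (coord y n))\<^sup>2"
    by (simp add: norm_mult)
qed simp

lemma summable_cinner: "(\<lambda>n. cnj (coord x n) * coord y n) summable_on UNIV"
  by (rule abs_summable_summable) (rule summable_cinner_norm)

lemma cinner_commute: "cinner x y = cnj (cinner y x)"
  unfolding cinner_def infsum_cnj[symmetric] by (simp add: mult.commute)

lemma cinner_add_right: "cinner x (y + z) = cinner x y + cinner x z"
  unfolding cinner_def by (simp add: distrib_left infsum_add summable_cinner)

lemma cinner_scaleC_right: "cinner x (c *\<^sub>C y) = c * cinner x y"
  unfolding cinner_def by (simp add: mult.left_commute infsum_cmult_right')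

lemma cinner_scaleR_right: "cinner x (r *\<^sub>R y) = r *\<^sub>R cinner x y"
  unfolding cinner_def by (simp add: scaleR_conv_of_real mult.left_commute infsum_cmult_right')

lemma cinner_self: "cinner x x = of_real (\<Sum>\<^sub>\<infinity>n. (cmod (coord x n))\<^sup>2)"
proof -
  have "cinner x x = (\<Sum>\<^sub>\<infinity>n. complex_of_real ((cmod (coord x n))\<^sup>2))"
    unfolding cinner_def
    by (rule infsum_cong) (simp only: complex_norm_square mult.commute)
  also have "\<dots> = of_real (\<Sum>\<^sub>\<infinity>n. (cmod (coord x n))\<^sup>2)"
    using has_sum_of_real[OF has_sum_infsum[OF summable_coord[of x]]] by (rule infsumI)
  finally show ?thesis .
qed

lemma sq_infsum_eq_0_iff: "(\<Sum>\<^sub>\<infinity>n. (cmod (coord x n))\<^sup>2) = 0 \<longleftrightarrow> x = 0"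
proof
  assume *: "(\<Sum>\<^sub>\<infinity>n. (cmod (coord x n))\<^sup>2) = 0"
  have "(cmod (coord x n))\<^sup>2 = 0" for n
    by (rule nonneg_infsum_le_0D[of "\<lambda>n. (cmod (coord x n))\<^sup>2" UNIV])
      (use * summable_coord in auto)
  then show "x = 0" by (intro ell2_eqI) simp
qed simp

instantiation ell2 :: real_inner
begin

definition inner_ell2 :: "ell2 \<Rightarrow> ell2 \<Rightarrow> real" where
  "inner_ell2 x y = Re (cinner x y)"
definition norm_ell2 :: "ell2 \<Rightarrow> real" where
  "norm_ell2 x = sqrt (\<Sum>\<^sub>\<infinity>n. (cmod (coord x n))\<^sup>2)"
definition sgn_ell2 :: "ell2 \<Rightarrow> ell2" where
  "sgn_ell2 x = x /\<^sub>R norm x"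
definition dist_ell2 :: "ell2 \<Rightarrow> ell2 \<Rightarrow> real" where
  "dist_ell2 x y = norm (x - y)"
definition uniformity_ell2 :: "(ell2 \<times> ell2) filter" where
  "uniformity_ell2 = (INF e\<in>{0<..}. principal {(x, y). dist x y < e})"
definition open_ell2 :: "ell2 set \<Rightarrow> bool" where
  "open_ell2 U = (\<forall>x\<in>U. eventually (\<lambda>(x', y). x' = x \<longrightarrow> y \<in> U) uniformity)"

instance
proof
  fix x y z :: ell2 and r :: real and U :: "ell2 set"
  show com: "inner x y = inner y x" for x y :: ell2
    using cinner_commute[of x y] by (simp add: inner_ell2_def)
  have "inner z (x + y) = inner z x + inner z y"
    by (simp add: inner_ell2_def cinner_add_right)
  then show "inner (x + y) z = inner x z + inner y z"
    unfolding com[of z "x + y"] com[of z x] com[of z y] .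
  have "inner y (r *\<^sub>R x) = r * inner y x"
    by (simp add: inner_ell2_def cinner_scaleR_right)
  then show "inner (r *\<^sub>R x) y = r * inner x y"
    unfolding com[of y "r *\<^sub>R x"] com[of y x] .
  show "0 \<le> inner x x"
    by (simp add: inner_ell2_def cinner_self infsum_nonneg)
  show "inner x x = 0 \<longleftrightarrow> x = 0"
    by (simp add: inner_ell2_def cinner_self sq_infsum_eq_0_iff)
  show "norm x = sqrt (inner x x)"
    by (simp add: inner_ell2_def cinner_self norm_ell2_def)
qed (simp_all add: sgn_ell2_def dist_ell2_def uniformity_ell2_def open_ell2_def)

end

lemma norm_ell2_sq: "(norm x)\<^sup>2 = (\<Sum>\<^sub>\<infinity>n. (cmod (coord x n))\<^sup>2)"
  unfolding norm_ell2_def by (simp add: infsum_nonneg)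

lemma sum_coord_le_norm:
  assumes "finite F"
  shows "(\<Sum>n\<in>F. (cmod (coord x n))\<^sup>2) \<le> (norm x)\<^sup>2"
  unfolding norm_ell2_sq using assms by (intro finite_sum_le_infsum summable_coord) auto

lemma coord_le_norm: "cmod (coord x n) \<le> norm x"
  by (rule power2_le_imp_le) (use sum_coord_le_norm[of "{n}" x] in auto)

lemma ell2_bounded_sums:
  fixes f :: "int \<Rightarrow> complex"
  assumes "0 \<le> C" "\<And>F. finite F \<Longrightarrow> (\<Sum>n\<in>F. (cmod (f n))\<^sup>2) \<le> C\<^sup>2"
  obtains x where "coord x = f" "norm x \<le> C"
proof -
  have s: "(\<lambda>n. (cmod (f n))\<^sup>2) summable_on UNIV"
    by (rule nonneg_bdd_above_summable_on) (use assms(2) in \<open>auto simp: bdd_above_def\<close>)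
  then have c: "coord (Abs_ell2 f) = f"
    by (simp add: Abs_ell2_inverse)
  have "(norm (Abs_ell2 f))\<^sup>2 \<le> C\<^sup>2"
    unfolding norm_ell2_sq c by (rule infsum_le_finite_sums[OF s]) (rule assms(2))
  then have "norm (Abs_ell2 f) \<le> C"
    using assms(1) by (rule power2_le_imp_le)
  with c show ?thesis by (rule that)
qed

instance ell2 :: banach
proof
  fix X :: "nat \<Rightarrow> ell2"
  assume X: "Cauchy X"
  have "Cauchy (\<lambda>k. coord (X k) n)" for n
  proof (rule CauchyI)
    fix e :: real assume "0 < e"
    then obtain M where M: "\<And>i j. i \<ge> M \<Longrightarrow> j \<ge> M \<Longrightarrow> norm (X i - X j) < e"
      using CauchyD[OF X] by blast
    show "\<exists>M. \<forall>i\<ge>M. \<forall>j\<ge>M. norm (coord (X i) n - coord (X j) n) < e"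
    proof (intro exI[of _ M] allI impI)
      fix i j assume "i \<ge> M" "j \<ge> M"
      then show "norm (coord (X i) n - coord (X j) n) < e"
        using M[of i j] coord_le_norm[of "X i - X j" n] by simp
    qed
  qed
  then have "\<exists>l. (\<lambda>k. coord (X k) n) \<longlonglongrightarrow> l" for n
    by (simp add: Cauchy_convergent_iff convergent_def)
  then obtain f where f: "\<And>n. (\<lambda>k. coord (X k) n) \<longlonglongrightarrow> f n" by metis
  have key: "\<exists>M. \<forall>i\<ge>M. \<exists>y. coord y = (\<lambda>n. coord (X i) n - f n) \<and> norm y \<le> e"
    if e: "0 < e" for e
  proof -
    obtain M where M: "\<And>i j. i \<ge> M \<Longrightarrow> j \<ge> M \<Longrightarrow> norm (X i - X j) < e"
      using CauchyD[OF X e] by blast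
    have bd: "(\<Sum>n\<in>F. (cmod (coord (X i) n - f n))\<^sup>2) \<le> e\<^sup>2" if "finite F" "i \<ge> M" for F i
    proof (rule LIMSEQ_le_const2)
      show "(\<lambda>j. \<Sum>n\<in>F. (cmod (coord (X i) n - coord (X j) n))\<^sup>2)
              \<longlonglongrightarrow> (\<Sum>n\<in>F. (cmod (coord (X i) n - f n))\<^sup>2)"
        by (intro tendsto_intros f)
      have "(\<Sum>n\<in>F. (cmod (coord (X i) n - coord (X j) n))\<^sup>2) \<le> e\<^sup>2" if "j \<ge> M" for j
      proof -
        have "(norm (X i - X j))\<^sup>2 \<le> e\<^sup>2"
          using M[OF \<open>i \<ge> M\<close> that] by (intro power_mono) auto
        then show ?thesis
          using sum_coord_le_norm[OF \<open>finite F\<close>, of "X i - X j"] by simp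
      qed
      then show "\<exists>N. \<forall>j\<ge>N. (\<Sum>n\<in>F. (cmod (coord (X i) n - coord (X j) n))\<^sup>2) \<le> e\<^sup>2"
        by blast
    qed
    have "\<exists>y. coord y = (\<lambda>n. coord (X i) n - f n) \<and> norm y \<le> e" if "i \<ge> M" for i
      by (rule ell2_bounded_sums[of e "\<lambda>n. coord (X i) n - f n"]) (use bd e that in auto)
    then show ?thesis by blast
  qed
  obtain M y where "coord y = (\<lambda>n. coord (X M) n - f n)"
    using key[OF zero_less_one] by blast
  then have L: "coord (X M - y) n = f n" for n by simp
  have "X \<longlonglongrightarrow> X M - y"
  proof (rule LIMSEQ_I)
    fix r :: real assume "0 < r"
    then obtain N where N:
        "\<And>i. i \<ge> N \<Longrightarrow> \<exists>z. coord z = (\<lambda>n. coord (X i) n - f n) \<and> norm z \<le> r / 2"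
      using key[OF half_gt_zero] by blast
    have "norm (X i - (X M - y)) < r" if i: "i \<ge> N" for i
    proof -
      obtain z where z: "coord z = (\<lambda>n. coord (X i) n - f n)" "norm z \<le> r / 2"
        using N[OF i] by blast
      have "coord (X i - (X M - y)) n = coord z n" for n
        by (simp only: coord_simps(4)[of "X i"] L z(1))
      then have "X i - (X M - y) = z"
        by (rule ell2_eqI)
      then show ?thesis using z(2) \<open>0 < r\<close> by simp
    qed
    then show "\<exists>N. \<forall>i\<ge>N. norm (X i - (X M - y)) < r" by blast
  qed
  then show "convergent X" by (auto simp: convergent_def)
qed

lift_definition delta :: "int \<Rightarrow> ell2" is "\<lambda>n m. if m = n then 1 else 0"
proof -
  fix n :: int
  have "(\<lambda>m. (cmod (if m = n then 1 else 0))\<^sup>2) summable_on {n}"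
    by simp
  also have "?this \<longleftrightarrow> (\<lambda>m. (cmod (if m = n then 1 else 0))\<^sup>2) summable_on UNIV"
    by (rule summable_on_cong_neutral) auto
  finally show "(\<lambda>m. (cmod (if m = n then 1 else 0))\<^sup>2) summable_on UNIV" .
qed

lemma cinner_delta [simp]: "cinner (delta n) x = coord x n"
proof -
  have "cinner (delta n) x = (\<Sum>\<^sub>\<infinity>m\<in>{n}. coord x m)"
    unfolding cinner_def by (rule infsum_cong_neutral) (auto simp: delta.rep_eq)
  then show ?thesis by simp
qed


section \<open>Self-adjoint operators and exponentials of bounded operators\<close>

text \<open>
  An operator is given by its domain \<open>D\<close> and a function whose values outside \<open>D\<close> are irrelevant.
  The last conjunct states that the graph of the operator equals the graph of its adjoint:
  \<open>\<psi>\<close> lies in the domain of the adjoint, with image \<open>\<omega>\<close>, iff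
  \<open>\<langle>A \<phi>, \<psi>\<rangle> = \<langle>\<phi>, \<omega>\<rangle>\<close> for all \<open>\<phi> \<in> D\<close>.
\<close>

definition self_adjoint_on :: "ell2 set \<Rightarrow> (ell2 \<Rightarrow> ell2) \<Rightarrow> bool" where
  "self_adjoint_on D A \<longleftrightarrow>
     0 \<in> D \<and> (\<forall>\<phi>\<in>D. \<forall>\<psi>\<in>D. \<phi> + \<psi> \<in> D \<and> A (\<phi> + \<psi>) = A \<phi> + A \<psi>) \<and>
     (\<forall>c. \<forall>\<phi>\<in>D. c *\<^sub>C \<phi> \<in> D \<and> A (c *\<^sub>C \<phi>) = c *\<^sub>C A \<phi>) \<and>
     closure D = UNIV \<and>
     (\<forall>\<psi> \<omega>. (\<psi> \<in> D \<and> A \<psi> = \<omega>) \<longleftrightarrow> (\<forall>\<phi>\<in>D. cinner (A \<phi>) \<psi> = cinner \<phi> \<omega>))"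

definition exp_op :: "complex \<Rightarrow> (ell2 \<Rightarrow>\<^sub>L ell2) \<Rightarrow> ell2 \<Rightarrow> ell2" where
  "exp_op z A \<phi> = (\<Sum>k. (z ^ k / fact k) *\<^sub>C ((blinfun_apply A ^^ k) \<phi>))"

lemma norm_scaleC: "norm (c *\<^sub>C x) = cmod c * norm x"
proof -
  have "(norm (c *\<^sub>C x))\<^sup>2 = (cmod c * norm x)\<^sup>2"
    by (simp add: norm_ell2_sq power_mult_distrib norm_mult infsum_cmult_right')
  then show ?thesis by simp
qed

lemma summable_exp_op:
  fixes A :: "ell2 \<Rightarrow>\<^sub>L ell2"
  shows "summable (\<lambda>k. (z ^ k / fact k) *\<^sub>C ((blinfun_apply A ^^ k) \<phi>))"
proof (rule summable_comparison_test')
  show "summable (\<lambda>k. (cmod z * norm A) ^ k / fact k * norm \<phi>)"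
    using summable_exp[of "cmod z * norm A"]
    by (intro summable_mult2) (simp only: divide_inverse mult.commute)
  have p: "norm ((blinfun_apply A ^^ k) \<phi>) \<le> norm A ^ k * norm \<phi>" for k
  proof (induction k)
    case (Suc k)
    have "norm ((blinfun_apply A ^^ Suc k) \<phi>) \<le> norm A * norm ((blinfun_apply A ^^ k) \<phi>)"
      using norm_blinfun[of A "(blinfun_apply A ^^ k) \<phi>"] by simp
    also have "\<dots> \<le> norm A * (norm A ^ k * norm \<phi>)"
      by (rule mult_left_mono[OF Suc.IH norm_ge_zero])
    finally show ?case by (simp only: power_Suc mult.assoc)
  qed simp
  fix k :: nat assume "0 \<le> k"
  show "norm ((z ^ k / fact k) *\<^sub>C ((blinfun_apply A ^^ k) \<phi>))
          \<le> (cmod z * norm A) ^ k / fact k * norm \<phi>"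
  proof -
    have "norm ((z ^ k / fact k) *\<^sub>C ((blinfun_apply A ^^ k) \<phi>))
            = cmod z ^ k / fact k * norm ((blinfun_apply A ^^ k) \<phi>)"
      by (simp only: norm_scaleC norm_divide norm_power norm_fact)
    also have "\<dots> \<le> cmod z ^ k / fact k * (norm A ^ k * norm \<phi>)"
      by (intro mult_left_mono p) simp
    also have "\<dots> = (cmod z * norm A) ^ k / fact k * norm \<phi>"
      by (simp only: power_mult_distrib times_divide_eq_left mult.assoc)
    finally show ?thesis .
  qed
qed


section \<open>Jacobi matrices\<close>

definition jacobi_with ::
  "(int \<Rightarrow> real) \<Rightarrow> (int \<Rightarrow> real) \<Rightarrow> (ell2 \<Rightarrow>\<^sub>L ell2) \<Rightarrow> bool" where
  "jacobi_with a b J \<longleftrightarrow>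
     bounded (range a) \<and> bounded (range b) \<and> (INF n. a n) > 0 \<and>
     (\<forall>\<phi> n. coord (J \<phi>) n =
        of_real (a (n - 1)) * coord \<phi> (n - 1) + of_real (b n) * coord \<phi> n
        + of_real (a n) * coord \<phi> (n + 1))"

definition jacobi_matrix :: "(ell2 \<Rightarrow>\<^sub>L ell2) \<Rightarrow> bool" where
  "jacobi_matrix J \<longleftrightarrow> (\<exists>a b. jacobi_with a b J)"

definition periodic_jacobi :: "nat \<Rightarrow> (ell2 \<Rightarrow>\<^sub>L ell2) \<Rightarrow> bool" where
  "periodic_jacobi q J \<longleftrightarrow> q > 0 \<and>
     (\<exists>a b. jacobi_with a b J \<and> (\<forall>n. a (n + int q) = a n \<and> b (n + int q) = b n))"

definition limit_periodic :: "(ell2 \<Rightarrow>\<^sub>L ell2) \<Rightarrow> bool" where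
  "limit_periodic J \<longleftrightarrow> (\<exists>P. (\<forall>n. \<exists>q. periodic_jacobi q (P n)) \<and> P \<longlonglongrightarrow> J)"

definition exp_class :: "real \<Rightarrow> (ell2 \<Rightarrow>\<^sub>L ell2) \<Rightarrow> bool" where
  "exp_class \<eta> J \<longleftrightarrow> jacobi_matrix J \<and> limit_periodic J \<and>
     (\<exists>(q :: nat \<Rightarrow> nat) P.
        (\<forall>n. periodic_jacobi (q n) (P n)) \<and>
        (\<lambda>n. exp (\<eta> * q (Suc n)) * norm (J - P n)) \<longlonglongrightarrow> 0 \<and>
        (\<forall>n. q n dvd q (Suc n) \<and> q n \<noteq> q (Suc n)))"

definition exp_class_infinity :: "(ell2 \<Rightarrow>\<^sub>L ell2) \<Rightarrow> bool" where
  "exp_class_infinity J \<longleftrightarrow> (\<forall>\<eta>>0. exp_class \<eta> J)"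

lemma jacobi_with_exists:
  assumes a: "bounded (range a)" and b: "bounded (range b)" and pos: "(INF n. a n) > 0"
  obtains J where "jacobi_with a b J"
proof -
  obtain A where A: "\<And>n. \<bar>a n\<bar> \<le> A" using a by (auto simp: bounded_iff)
  obtain B where B: "\<And>n. \<bar>b n\<bar> \<le> B" using b by (auto simp: bounded_iff)
  have nonneg: "0 \<le> A" "0 \<le> B" using A[of 0] B[of 0] by auto
  define T where "T f n = of_real (a (n - 1)) * f (n - 1) + of_real (b n) * f n + of_real (a n) * f (n + 1)"
    for f :: "int \<Rightarrow> complex" and n
  have L2: "L2_set (\<lambda>n. cmod (coord x (n + k))) F \<le> norm x" if "finite F" for F x and k :: int
  proof -
    have "(\<Sum>n\<in>F. (cmod (coord x (n + k)))\<^sup>2) = (\<Sum>n\<in>(\<lambda>n. n + k) ` F. (cmod (coord x n))\<^sup>2)"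
      by (subst sum.reindex) (auto simp: inj_on_def)
    also have "\<dots> \<le> (norm x)\<^sup>2" using that by (intro sum_coord_le_norm) auto
    finally show ?thesis by (simp add: L2_set_def real_le_lsqrt)
  qed
  have ex: "\<exists>y. coord y = T (coord x) \<and> norm y \<le> norm x * (2 * A + B)" for x
  proof -
    have "(\<Sum>n\<in>F. (cmod (T (coord x) n))\<^sup>2) \<le> (norm x * (2 * A + B))\<^sup>2" if F: "finite F" for F
    proof -
      let ?g = "\<lambda>k n. cmod (coord x (n + k))"
      have pt: "cmod (T (coord x) n) \<le> A * ?g (- 1) n + B * ?g 0 n + A * ?g 1 n" for n
      proof -
        have "cmod (T (coord x) n) \<le> \<bar>a (n - 1)\<bar> * ?g (- 1) n + \<bar>b n\<bar> * ?g 0 n + \<bar>a n\<bar> * ?g 1 n"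
          unfolding T_def
          by (rule order_trans[OF norm_triangle_ineq order_trans[OF add_right_mono[OF norm_triangle_ineq]]])
            (simp add: norm_mult)
        also have "\<dots> \<le> A * ?g (- 1) n + B * ?g 0 n + A * ?g 1 n"
          by (intro add_mono mult_right_mono A B norm_ge_zero)
        finally show ?thesis .
      qed
      have "L2_set (\<lambda>n. cmod (T (coord x) n)) F
              \<le> L2_set (\<lambda>n. A * ?g (- 1) n + B * ?g 0 n + A * ?g 1 n) F"
        by (intro L2_set_mono pt norm_ge_zero)
      also have "\<dots> \<le> L2_set (\<lambda>n. A * ?g (- 1) n) F + L2_set (\<lambda>n. B * ?g 0 n) F
                       + L2_set (\<lambda>n. A * ?g 1 n) F"
        by (rule order_trans[OF L2_set_triangle_ineq add_right_mono[OF L2_set_triangle_ineq]])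
      also have "\<dots> = A * L2_set (?g (- 1)) F + B * L2_set (?g 0) F + A * L2_set (?g 1) F"
        using nonneg by (simp only: L2_set_right_distrib)
      also have "\<dots> \<le> A * norm x + B * norm x + A * norm x"
        using F nonneg by (intro add_mono mult_left_mono L2)
      finally have "sqrt (\<Sum>n\<in>F. (cmod (T (coord x) n))\<^sup>2) \<le> norm x * (2 * A + B)"
        by (simp add: L2_set_def algebra_simps)
      then have "(sqrt (\<Sum>n\<in>F. (cmod (T (coord x) n))\<^sup>2))\<^sup>2 \<le> (norm x * (2 * A + B))\<^sup>2"
        by (intro power_mono) (auto intro: sum_nonneg)
      then show ?thesis by (simp add: sum_nonneg)
    qed
    moreover have "0 \<le> norm x * (2 * A + B)"
      using nonneg by simp
    ultimately obtain y where "coord y = T (coord x)" "norm y \<le> norm x * (2 * A + B)"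
      using ell2_bounded_sums[of "norm x * (2 * A + B)" "T (coord x)"] by blast
    then show ?thesis by blast
  qed
  define S where "S x = (SOME y. coord y = T (coord x) \<and> norm y \<le> norm x * (2 * A + B))" for x
  have S: "coord (S x) = T (coord x)" "norm (S x) \<le> norm x * (2 * A + B)" for x
    using someI_ex[OF ex[of x]] unfolding S_def by blast+
  have "bounded_linear S"
  proof (rule bounded_linear_intro[OF _ _ S(2)])
    show "S (x + y) = S x + S y" for x y
      by (rule ell2_eqI) (simp add: S(1) T_def algebra_simps)
    show "S (r *\<^sub>R x) = r *\<^sub>R S x" for r x
      by (rule ell2_eqI) (simp add: S(1) T_def scaleR_conv_of_real algebra_simps)
  qed
  then have "jacobi_with a b (Blinfun S)"
    using a b pos by (simp add: jacobi_with_def bounded_linear_Blinfun_apply S(1) T_def)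
  then show ?thesis by (rule that)
qed


section \<open>The position operator and its Heisenberg evolution\<close>

definition dom_X :: "ell2 set" where
  "dom_X = {\<phi>. (\<lambda>n. (cmod (of_int n * coord \<phi> n))\<^sup>2) summable_on UNIV}"

text \<open>Meaningful on \<^const>\<open>dom_X\<close> only.\<close>

definition position_op :: "ell2 \<Rightarrow> ell2" where
  "position_op \<phi> = Abs_ell2 (\<lambda>n. of_int n * coord \<phi> n)"

lemma coord_position_op: "\<phi> \<in> dom_X \<Longrightarrow> coord (position_op \<phi>) n = of_int n * coord \<phi> n"
  by (simp add: dom_X_def position_op_def Abs_ell2_inverse)

text \<open>For a Jacobi matrix \<open>J\<close>, the unitary group generated by \<open>J\<close> leaves \<^const>\<open>dom_X\<close> invariant,
  so that this is meaningful on \<^const>\<open>dom_X\<close> for every \<open>t\<close>.\<close>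

definition position_at :: "(ell2 \<Rightarrow>\<^sub>L ell2) \<Rightarrow> real \<Rightarrow> ell2 \<Rightarrow> ell2" where
  "position_at J t \<phi> = exp_op (\<i> * t) J (position_op (exp_op (- \<i> * t) J \<phi>))"

definition ell1 :: "ell2 set" where
  "ell1 = {\<phi>. (\<lambda>n. cmod (coord \<phi> n)) summable_on UNIV}"

definition schwartz :: "ell2 set" where
  "schwartz = {\<phi>. \<forall>p::real. p > 0 \<longrightarrow>
                 (\<lambda>n. \<bar>real_of_int n\<bar> powr p * cmod (coord \<phi> n)) summable_on UNIV}"

text \<open>For \<open>\<phi>\<close> in \<^const>\<open>schwartz\<close> and \<open>J\<close> a Jacobi matrix the sum below is finite;
  a divergent sum would get the value 0.\<close>

definition moment :: "(ell2 \<Rightarrow>\<^sub>L ell2) \<Rightarrow> real \<Rightarrow> ell2 \<Rightarrow> real \<Rightarrow> real" where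
  "moment J p \<phi> t =
     (\<Sum>\<^sub>\<infinity>n. (\<bar>real_of_int n\<bar> powr p + 1) * (cmod (cinner (delta n) (exp_op (- \<i> * t) J \<phi>)))\<^sup>2)"

definition beta_plus :: "(ell2 \<Rightarrow>\<^sub>L ell2) \<Rightarrow> ell2 \<Rightarrow> real \<Rightarrow> ereal" where
  "beta_plus J \<phi> p = Limsup at_top (\<lambda>t::real. ereal (ln (moment J p \<phi> t) / (p * ln t)))"

definition beta_minus :: "(ell2 \<Rightarrow>\<^sub>L ell2) \<Rightarrow> ell2 \<Rightarrow> real \<Rightarrow> ereal" where
  "beta_minus J \<phi> p = Liminf at_top (\<lambda>t::real. ereal (ln (moment J p \<phi> t) / (p * ln t)))"

end

theory Submission
  imports Defs
begin

text \<open>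
  Let \<open>A = i[J, X]\<close> be the velocity operator and
  \<open>M\<^sub>t = 1/t \<integral>\<^sub>0\<^sup>t e\<^bsup>isJ\<^esup> A e\<^bsup>-isJ\<^esup> ds\<close> the mean velocity, so that
  \<open>X\<^sub>J(t) = X + t M\<^sub>t\<close>. If \<open>J\<close> is \<open>q\<close>-periodic and \<open>S\<close> is the shift, the
  discriminant polynomial satisfies \<open>\<Delta>(J) = S\<^sup>q + S\<^bsup>-q\<^esup>\<close>. Modulo commutators with \<open>J\<close>,
  whose time averages are \<open>O(1/t)\<close>, the commutator \<open>i[\<Delta>(J), X]\<close> is both \<open>\<Delta>'(J) A\<close> and
  \<open>A \<Delta>'(J)\<close>. It is also equal to \<open>D = iq (S\<^bsup>-q\<^esup> - S\<^sup>q)\<close>, which commutes with \<open>J\<close>. Hence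
  \<open>\<Delta>'(J) M\<^sub>t\<close> and \<open>M\<^sub>t \<Delta>'(J)\<close> converge to \<open>D\<close> in norm with error \<open>K\<^sup>q/t\<close>, and so
  \<open>M\<^sub>t D \<approx> M\<^sub>t \<Delta>'(J) M\<^sub>s \<approx> D M\<^sub>s\<close>. An \<open>\<ell>\<^sup>1\<close> vector differs from the range of
  \<open>D\<close> by a mean of \<open>N\<close> of its shifts, of norm \<open>O(N\<^bsup>-1/2\<^esup>)\<close>; this gives a rate of convergence of
  \<open>M\<^sub>t\<close> on \<open>\<ell>\<^sup>1\<close> without any information on spectral gaps.

  For \<open>J\<close> in the exponential class, \<open>J\<close> may be replaced by its \<open>q\<^sub>n\<close>-periodic approximant for
  times between \<open>\<mu>\<^bsup>4q\<^sub>n\<^esup>\<close> and \<open>\<mu>\<^bsup>4q\<^sub>n\<^sub>+\<^sub>1\<^esup>\<close>, where \<open>\<mu> \<ge> 2K\<close> is an integer, and the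
  errors \<open>\<mu>\<^bsup>-q\<^sub>n\<^esup>\<close> are summable. If the limit of \<open>M\<^sub>t \<phi>\<close> is 0, they also bound
  \<open>M\<^sub>t \<phi>\<close> at \<open>t = \<mu>\<^bsup>4q\<^sub>n\<^esup>\<close>, so \<open>\<parallel>D \<phi>\<parallel> \<le> C K\<^sup>q \<parallel>M\<^sub>t \<phi>\<parallel> + o(1)\<close> tends to 0 along
  the approximants; this is impossible for \<open>\<phi> \<noteq> 0\<close>, since \<open>S\<^bsup>2q\<^esup> \<phi>\<close> tends weakly to 0.
\<close>

section \<open>The Banach algebra of bounded operators\<close>

text \<open>A copy of the endomorphism type, because the function space type itself cannot be an instance of
  \<^class>\<open>real_normed_algebra_1\<close>, which the exponential function requires. Its elements are only real-linear;
  multiplication by the imaginary unit is itself an operator, \<open>iop\<close> below.\<close>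

typedef bop = "UNIV :: (ell2 \<Rightarrow>\<^sub>L ell2) set"
  morphisms blin Bop by simp

setup_lifting type_definition_bop

text \<open>Equality needs a nonzero vector, here \<open>delta 0\<close>. It supplies the axiom
  \<open>norm 1 = 1\<close> of a unital normed algebra.\<close>

lemma norm_blinfun_id_ell2: "norm (id_blinfun :: ell2 \<Rightarrow>\<^sub>L ell2) = 1"
proof (rule antisym)
  show "norm (id_blinfun :: ell2 \<Rightarrow>\<^sub>L ell2) \<le> 1"
    by (rule norm_blinfun_bound) auto
  have "delta 0 \<noteq> 0"
    by (metis coord_simps(1) delta.rep_eq zero_neq_one)
  then have "norm (delta 0) > 0" by simp
  moreover have "norm (delta 0) \<le> norm (id_blinfun :: ell2 \<Rightarrow>\<^sub>L ell2) * norm (delta 0)"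
    using norm_blinfun[of "id_blinfun :: ell2 \<Rightarrow>\<^sub>L ell2" "delta 0"] by simp
  ultimately show "1 \<le> norm (id_blinfun :: ell2 \<Rightarrow>\<^sub>L ell2)" by simp
qed

instantiation bop :: "{real_algebra_1}"
begin

lift_definition zero_bop :: bop is "0" .
lift_definition one_bop :: bop is "id_blinfun" .
lift_definition plus_bop :: "bop \<Rightarrow> bop \<Rightarrow> bop" is "(+)" .
lift_definition uminus_bop :: "bop \<Rightarrow> bop" is "uminus" .
lift_definition minus_bop :: "bop \<Rightarrow> bop \<Rightarrow> bop" is "(-)" .
lift_definition times_bop :: "bop \<Rightarrow> bop \<Rightarrow> bop" is "blinfun_compose" .
lift_definition scaleR_bop :: "real \<Rightarrow> bop \<Rightarrow> bop" is "scaleR" .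

instance
proof
  fix x y z :: bop and r s :: real
  show "x + y + z = x + (y + z)" by transfer (simp add: algebra_simps)
  show "x + y = y + x" by transfer (simp add: algebra_simps)
  show "0 + x = x" by transfer simp
  show "- x + x = 0" by transfer simp
  show "x - y = x + - y" by transfer simp
  show "r *\<^sub>R (x + y) = r *\<^sub>R x + r *\<^sub>R y" by transfer (simp add: algebra_simps)
  show "(r + s) *\<^sub>R x = r *\<^sub>R x + s *\<^sub>R x" by transfer (simp add: algebra_simps)
  show "r *\<^sub>R s *\<^sub>R x = (r * s) *\<^sub>R x" by transfer simp
  show "1 *\<^sub>R x = x" by transfer simp
  show "x * y * z = x * (y * z)" by transfer (rule blinfun_eqI, simp)
  show "1 * x = x" by transfer (rule blinfun_eqI, simp)
  show "x * 1 = x" by transfer (rule blinfun_eqI, simp)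
  show "(x + y) * z = x * z + y * z"
    by transfer (rule blinfun_eqI, simp add: blinfun.bilinear_simps)
  show "x * (y + z) = x * y + x * z"
    by transfer (rule blinfun_eqI, simp add: blinfun.bilinear_simps)
  show "r *\<^sub>R x * y = r *\<^sub>R (x * y)"
    by transfer (rule blinfun_eqI, simp add: blinfun.bilinear_simps)
  show "x * r *\<^sub>R y = r *\<^sub>R (x * y)"
    by transfer (rule blinfun_eqI, simp add: blinfun.bilinear_simps)
  show "(0::bop) \<noteq> 1"
    by transfer (metis norm_blinfun_id_ell2 norm_zero zero_neq_one)
qed

end

instantiation bop :: real_normed_algebra_1
begin

lift_definition norm_bop :: "bop \<Rightarrow> real" is "norm" .
definition sgn_bop :: "bop \<Rightarrow> bop" where
  "sgn_bop x = x /\<^sub>R norm x"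
definition dist_bop :: "bop \<Rightarrow> bop \<Rightarrow> real" where
  "dist_bop x y = norm (x - y)"
definition uniformity_bop :: "(bop \<times> bop) filter" where
  "uniformity_bop = (INF e\<in>{0<..}. principal {(x, y). dist x y < e})"
definition open_bop :: "bop set \<Rightarrow> bool" where
  "open_bop U = (\<forall>x\<in>U. eventually (\<lambda>(x', y). x' = x \<longrightarrow> y \<in> U) uniformity)"

instance
proof
  fix x y :: bop and r :: real
  show "norm (x * y) \<le> norm x * norm y"
    by transfer (rule norm_blinfun_compose)
  show "norm (1::bop) = 1" by transfer (rule norm_blinfun_id_ell2)
  show "norm x = 0 \<longleftrightarrow> x = 0" by transfer simp
  show "norm (x + y) \<le> norm x + norm y" by transfer (rule norm_triangle_ineq)
  show "norm (r *\<^sub>R x) = \<bar>r\<bar> * norm x" by transfer simp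
qed (simp_all add: sgn_bop_def dist_bop_def uniformity_bop_def open_bop_def)

end

text \<open>Completeness is transported along the isometry \<open>blin\<close>; it makes the
  exponential series converge.\<close>

instance bop :: banach
proof
  fix X :: "nat \<Rightarrow> bop"
  assume X: "Cauchy X"
  have d: "dist (blin x) (blin y) = dist x y" for x y
    by (simp add: dist_norm norm_bop.rep_eq minus_bop.rep_eq)
  have "Cauchy (\<lambda>n. blin (X n))"
    using X unfolding Cauchy_def d .
  then obtain l where l: "(\<lambda>n. blin (X n)) \<longlonglongrightarrow> l"
    using Cauchy_convergent convergent_def by blast
  have "X \<longlonglongrightarrow> Bop l"
    using l unfolding lim_sequentially
    by (simp add: d[symmetric] Bop_inverse)
  then show "convergent X" by (auto simp: convergent_def)
qed

section \<open>Action of the algebra on vectors and construction of operators\<close>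

definition app :: "bop \<Rightarrow> ell2 \<Rightarrow> ell2" where
  "app T = blinfun_apply (blin T)"

lemma app_simps [simp]:
  "app 0 x = 0"
  "app 1 x = x"
  "app (S + T) x = app S x + app T x"
  "app (S - T) x = app S x - app T x"
  "app (- T) x = - app T x"
  "app (S * T) x = app S (app T x)"
  "app (r *\<^sub>R T) x = r *\<^sub>R app T x"
  "app T 0 = 0"
  "app T (x + y) = app T x + app T y"
  "app T (x - y) = app T x - app T y"
  "app T (- x) = - app T x"
  "app T (r *\<^sub>R x) = r *\<^sub>R app T x"
  unfolding app_def
  by (simp_all add: zero_bop.rep_eq one_bop.rep_eq plus_bop.rep_eq minus_bop.rep_eq
      uminus_bop.rep_eq times_bop.rep_eq scaleR_bop.rep_eq blinfun.bilinear_simps)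

lemma bop_eqI: "(\<And>x. app S x = app T x) \<Longrightarrow> S = T"
  by (metis app_def blin_inject blinfun_eqI)

lemma norm_app: "norm (app T x) \<le> norm T * norm x"
  unfolding app_def norm_bop.rep_eq by (rule norm_blinfun)

lemma norm_app_le: "norm T \<le> c \<Longrightarrow> norm (app T x) \<le> c * norm x"
  by (meson mult_right_mono norm_app norm_ge_zero order_trans)

lemma norm_bop_le: "0 \<le> c \<Longrightarrow> (\<And>x. norm (app T x) \<le> c * norm x) \<Longrightarrow> norm T \<le> c"
  unfolding app_def norm_bop.rep_eq by (rule norm_blinfun_bound)

lemma app_Bop: "app (Bop T) = blinfun_apply T"
  by (simp add: app_def Bop_inverse)

lemma norm_Bop: "norm (Bop T) = norm T"
  by (simp add: norm_bop.rep_eq Bop_inverse)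

lemma bounded_bilinear_app: "bounded_bilinear app"
proof
  show "\<exists>K. \<forall>a b. norm (app a b) \<le> norm a * norm b * K"
    by (rule exI[of _ 1]) (simp add: norm_app)
qed simp_all

lemma bounded_linear_app: "bounded_linear (app T)"
  by (rule bounded_bilinear.bounded_linear_right[OF bounded_bilinear_app])

lemma bounded_linear_app_left: "bounded_linear (\<lambda>T. app T x)"
  by (rule bounded_bilinear.bounded_linear_left[OF bounded_bilinear_app])

lemma coord_sum: "coord (sum f F) n = (\<Sum>k\<in>F. coord (f k) n)"
  by (induction F rule: infinite_finite_induct) auto

lemma bounded_linear_coord: "bounded_linear (\<lambda>x. coord x n)"
  by (rule bounded_linear_intro[of _ 1]) (auto simp: coord_le_norm)

text \<open>Bounds on finite partial sums give square summability of the image and the norm estimate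
  at once.\<close>

lemma bop_exists:
  fixes f :: "ell2 \<Rightarrow> int \<Rightarrow> complex"
  assumes "0 \<le> c" "\<And>x F. finite F \<Longrightarrow> (\<Sum>n\<in>F. (cmod (f x n))\<^sup>2) \<le> (c * norm x)\<^sup>2"
    and add: "\<And>x y n. f (x + y) n = f x n + f y n"
    and scale: "\<And>r x n. f (r *\<^sub>R x) n = r *\<^sub>R f x n"
  obtains T where "\<And>x n. coord (app T x) n = f x n" "norm T \<le> c"
proof -
  have "\<exists>y. coord y = f x \<and> norm y \<le> c * norm x" for x
    using assms(1) ell2_bounded_sums[OF _ assms(2), of x] by (metis mult_nonneg_nonneg norm_ge_zero)
  then obtain S where S: "\<And>x. coord (S x) = f x" "\<And>x. norm (S x) \<le> c * norm x"
    by metis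
  have bl: "bounded_linear S"
    by (rule bounded_linear_intro[of _ c])
      (auto simp: S add scale intro!: ell2_eqI order_trans[OF S(2)] simp: mult.commute)
  show ?thesis
  proof (rule that[of "Bop (Blinfun S)"])
    show "coord (app (Bop (Blinfun S)) x) n = f x n" for x n
      by (simp add: app_Bop bounded_linear_Blinfun_apply[OF bl] S)
    show "norm (Bop (Blinfun S)) \<le> c"
      by (rule norm_bop_le[OF assms(1)])
        (simp add: app_Bop bounded_linear_Blinfun_apply[OF bl] S)
  qed
qed

section \<open>Multiplication by the imaginary unit, translations and diagonal operators\<close>

definition iop :: bop where
  "iop = (SOME T. (\<forall>x n. coord (app T x) n = \<i> * coord x n) \<and> norm T \<le> 1)"

lemma iop_spec: "(\<forall>x n. coord (app iop x) n = \<i> * coord x n) \<and> norm iop \<le> 1"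
  unfolding iop_def
proof (rule someI_ex)
  obtain T where "\<And>x n. coord (app T x) n = \<i> * coord x n" "norm T \<le> 1"
    by (rule bop_exists[of 1 "\<lambda>x n. \<i> * coord x n"])
      (auto simp: algebra_simps norm_mult sum_coord_le_norm)
  then show "\<exists>T. (\<forall>x n. coord (app T x) n = \<i> * coord x n) \<and> norm T \<le> 1" by blast
qed

lemma coord_iop [simp]: "coord (app iop x) n = \<i> * coord x n"
  and norm_iop: "norm iop \<le> 1"
  using iop_spec by auto

lemma iop_iop: "iop * iop = - 1"
  by (intro bop_eqI ell2_eqI) simp

lemma app_iop: "app iop x = \<i> *\<^sub>C x"
  by (rule ell2_eqI) simp

lemma norm_app_iop [simp]: "norm (app iop x) = norm x"
  by (simp add: app_iop norm_scaleC)

definition shift :: "int \<Rightarrow> bop" where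
  "shift k = (SOME T. (\<forall>x n. coord (app T x) n = coord x (n - k)) \<and> norm T \<le> 1)"

lemma shift_spec: "(\<forall>x n. coord (app (shift k) x) n = coord x (n - k)) \<and> norm (shift k) \<le> 1"
  unfolding shift_def
proof (rule someI_ex)
  have "(\<Sum>n\<in>F. (cmod (coord x (n - k)))\<^sup>2) \<le> (1 * norm x)\<^sup>2" if "finite F" for F x
  proof -
    have "(\<Sum>n\<in>F. (cmod (coord x (n - k)))\<^sup>2) = (\<Sum>n\<in>(\<lambda>n. n - k) ` F. (cmod (coord x n))\<^sup>2)"
      by (subst sum.reindex) (auto simp: inj_on_def)
    also have "\<dots> \<le> (norm x)\<^sup>2" using that by (intro sum_coord_le_norm) auto
    finally show ?thesis by simp
  qed
  then obtain T where "\<And>x n. coord (app T x) n = coord x (n - k)" "norm T \<le> 1"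
    by (rule bop_exists[of 1 "\<lambda>x n. coord x (n - k)", rotated 1]) auto
  then show "\<exists>T. (\<forall>x n. coord (app T x) n = coord x (n - k)) \<and> norm T \<le> 1" by blast
qed

lemma coord_shift [simp]: "coord (app (shift k) x) n = coord x (n - k)"
  and norm_shift: "norm (shift k) \<le> 1"
  using shift_spec by auto

lemma shift_add: "shift k * shift l = shift (k + l)"
  by (intro bop_eqI ell2_eqI) (simp add: algebra_simps)

lemma shift_0 [simp]: "shift 0 = 1"
  by (intro bop_eqI ell2_eqI) simp

lemma shift_delta [simp]: "app (shift k) (delta n) = delta (n + k)"
  by (rule ell2_eqI) (auto simp: delta.rep_eq)

text \<open>Both \<open>shift k\<close> and its inverse \<open>shift (- k)\<close> are contractions,
  which forces an isometry.\<close>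

lemma norm_app_shift [simp]: "norm (app (shift k) x) = norm x"
proof (rule antisym)
  show "norm (app (shift k) x) \<le> norm x" for k x
    using norm_app_le[OF norm_shift, of k x] by simp
  then have "norm (app (shift (- k)) (app (shift k) x)) \<le> norm (app (shift k) x)" .
  moreover have "app (shift (- k)) (app (shift k) x) = app (shift (- k) * shift k) x" by simp
  ultimately show "norm x \<le> norm (app (shift k) x)" by (simp add: shift_add del: app_simps(6))
qed

text \<open>The function g(X) of the position operator; the choice is meaningful for bounded
  \<open>g\<close>.\<close>

definition diag :: "(int \<Rightarrow> real) \<Rightarrow> bop" where
  "diag g = (SOME T. (\<forall>x n. coord (app T x) n = of_real (g n) * coord x n) \<and>
      norm T \<le> (SUP n. \<bar>g n\<bar>))"

lemma diag_spec:
  assumes "bounded (range g)"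
  shows "(\<forall>x n. coord (app (diag g) x) n = of_real (g n) * coord x n) \<and> norm (diag g) \<le> (SUP n. \<bar>g n\<bar>)"
  unfolding diag_def
proof (rule someI_ex)
  let ?c = "SUP n. \<bar>g n\<bar>"
  have bdd: "bdd_above (range (\<lambda>n. \<bar>g n\<bar>))"
    using assms by (auto simp: bounded_iff bdd_above_def)
  have c: "\<bar>g n\<bar> \<le> ?c" for n by (rule cSUP_upper[OF _ bdd]) simp
  then have "0 \<le> ?c" using abs_ge_zero order_trans by blast
  moreover have "(\<Sum>n\<in>F. (cmod (of_real (g n) * coord x n))\<^sup>2) \<le> (?c * norm x)\<^sup>2" if "finite F" for F x
  proof -
    have "(\<Sum>n\<in>F. (cmod (of_real (g n) * coord x n))\<^sup>2) \<le> (\<Sum>n\<in>F. ?c\<^sup>2 * (cmod (coord x n))\<^sup>2)"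
    proof (rule sum_mono)
      fix n
      have "cmod (of_real (g n) * coord x n) \<le> ?c * cmod (coord x n)"
        using c[of n] by (simp add: norm_mult mult_right_mono)
      then have "(cmod (of_real (g n) * coord x n))\<^sup>2 \<le> (?c * cmod (coord x n))\<^sup>2"
        by (rule power_mono) simp
      then show "(cmod (of_real (g n) * coord x n))\<^sup>2 \<le> ?c\<^sup>2 * (cmod (coord x n))\<^sup>2"
        by (simp only: power_mult_distrib)
    qed
    also have "\<dots> \<le> ?c\<^sup>2 * (norm x)\<^sup>2"
      unfolding sum_distrib_left[symmetric] by (intro mult_left_mono sum_coord_le_norm that) simp
    finally show ?thesis by (simp add: power_mult_distrib)
  qed
  ultimately obtain T where "\<And>x n. coord (app T x) n = of_real (g n) * coord x n" "norm T \<le> ?c"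
    by (rule bop_exists[of ?c "\<lambda>x n. of_real (g n) * coord x n"])
      (auto simp: algebra_simps scaleR_conv_of_real)
  then show "\<exists>T. (\<forall>x n. coord (app T x) n = of_real (g n) * coord x n) \<and> norm T \<le> ?c" by blast
qed

lemma coord_diag: "bounded (range g) \<Longrightarrow> coord (app (diag g) x) n = of_real (g n) * coord x n"
  using diag_spec by blast

lemma norm_diag_le:
  assumes "\<And>n. \<bar>g n\<bar> \<le> c"
  shows "norm (diag g) \<le> c"
proof -
  have "bounded (range g)" using assms by (auto simp: bounded_iff)
  then have "norm (diag g) \<le> (SUP n. \<bar>g n\<bar>)" using diag_spec by blast
  also have "\<dots> \<le> c" using assms by (intro cSUP_least) auto
  finally show ?thesis .
qed

section \<open>Approximation by finitely supported vectors\<close>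

lemma coord_delta: "coord (delta n) m = (if m = n then 1 else 0)"
  by (simp add: delta.rep_eq)

definition trunc :: "nat \<Rightarrow> ell2 \<Rightarrow> ell2" where
  "trunc N x = (\<Sum>n=-int N..int N. coord x n *\<^sub>C delta n)"

lemma coord_trunc: "coord (trunc N x) n = (if \<bar>n\<bar> \<le> int N then coord x n else 0)"
  unfolding trunc_def coord_sum by (auto simp: coord_delta if_distrib cong: if_cong)

text \<open>The squared error is the tail of the series for the squared norm.\<close>

lemma trunc_tendsto: "(\<lambda>N. trunc N x) \<longlonglongrightarrow> x"
proof (rule LIMSEQ_I)
  fix e :: real assume e: "0 < e"
  have "((\<lambda>n. (cmod (coord x n))\<^sup>2) has_sum (norm x)\<^sup>2) UNIV"
    unfolding norm_ell2_sq by (rule has_sum_infsum[OF summable_coord])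
  then have "eventually (\<lambda>F. dist (\<Sum>n\<in>F. (cmod (coord x n))\<^sup>2) ((norm x)\<^sup>2) < e\<^sup>2) (finite_subsets_at_top UNIV)"
    unfolding has_sum_def tendsto_iff using e by simp
  then obtain G where G: "finite G" "\<And>F. finite F \<Longrightarrow> G \<subseteq> F \<Longrightarrow>
      dist (\<Sum>n\<in>F. (cmod (coord x n))\<^sup>2) ((norm x)\<^sup>2) < e\<^sup>2"
    unfolding eventually_finite_subsets_at_top by auto
  obtain M where M: "\<And>n. n \<in> G \<Longrightarrow> \<bar>n\<bar> \<le> int M"
  proof -
    have "\<bar>n\<bar> \<le> int (nat (Max (abs ` G)))" if "n \<in> G" for n
    proof -
      have "\<bar>n\<bar> \<le> Max (abs ` G)" using that G(1) by (intro Max_ge) auto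
      then show ?thesis by linarith
    qed
    then show ?thesis using that by blast
  qed
  have "norm (trunc N x - x) < e" if N: "N \<ge> M" for N
  proof -
    let ?F = "{-int N..int N}"
    have sub: "G \<subseteq> ?F" using M N by force
    have s: "(norm x)\<^sup>2 - (\<Sum>n\<in>?F. (cmod (coord x n))\<^sup>2) < e\<^sup>2"
      using G(2)[OF _ sub] by (simp add: dist_real_def)
    have "(norm (trunc N x - x))\<^sup>2 \<le> (norm x)\<^sup>2 - (\<Sum>n\<in>?F. (cmod (coord x n))\<^sup>2)"
      unfolding norm_ell2_sq[of "trunc N x - x"]
    proof (rule infsum_le_finite_sums[OF summable_coord])
      fix H :: "int set" assume H: "finite H"
      have "(\<Sum>n\<in>H. (cmod (coord (trunc N x - x) n))\<^sup>2) = (\<Sum>n\<in>H - ?F. (cmod (coord x n))\<^sup>2)"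
        by (rule sum.mono_neutral_cong_right) (auto simp: H coord_trunc)
      also have "\<dots> + (\<Sum>n\<in>?F. (cmod (coord x n))\<^sup>2) = (\<Sum>n\<in>(H - ?F) \<union> ?F. (cmod (coord x n))\<^sup>2)"
        using H by (subst sum.union_disjoint) auto
      also have "\<dots> \<le> (norm x)\<^sup>2" using H by (intro sum_coord_le_norm) auto
      finally show "(\<Sum>n\<in>H. (cmod (coord (trunc N x - x) n))\<^sup>2) \<le> (norm x)\<^sup>2 - (\<Sum>n\<in>?F. (cmod (coord x n))\<^sup>2)"
        by simp
    qed
    with s have "(norm (trunc N x - x))\<^sup>2 < e\<^sup>2" by linarith
    then show ?thesis using e by (simp add: power_less_imp_less_base)
  qed
  then show "\<exists>N0. \<forall>N\<ge>N0. norm (trunc N x - x) < e" by blast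
qed

text \<open>Elements of \<open>bop\<close> are real-linear; commuting with multiplication by the
  imaginary unit amounts to complex linearity.\<close>

definition clinear_op :: "bop \<Rightarrow> bool" where
  "clinear_op T \<longleftrightarrow> iop * T = T * iop"

lemma app_scaleC:
  assumes "clinear_op T"
  shows "app T (c *\<^sub>C x) = c *\<^sub>C app T x"
proof -
  have c: "c *\<^sub>C y = Re c *\<^sub>R y + Im c *\<^sub>R app iop y" for y
    by (rule ell2_eqI) (simp add: scaleR_conv_of_real, subst complex_eq[of c], simp add: algebra_simps)
  have "app T (app iop x) = app iop (app T x)"
    using assms by (metis app_simps(6) clinear_op_def)
  then show ?thesis by (simp add: c)
qed

text \<open>Truncations are finite complex combinations of basis vectors and converge, so the matrix
  columns determine a bounded complex-linear operator.\<close>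

lemma bop_eq_on_delta:
  assumes "clinear_op S" "clinear_op T" "\<And>n. app S (delta n) = app T (delta n)"
  shows "S = T"
proof (rule bop_eqI)
  fix x
  have "app S (trunc N x) = app T (trunc N x)" for N
    unfolding trunc_def
    by (simp add: bounded_linear.linear[OF bounded_linear_app] linear_sum app_scaleC assms)
  then have "(\<lambda>N. app T (trunc N x)) \<longlonglongrightarrow> app S x"
    using bounded_linear.tendsto[OF bounded_linear_app trunc_tendsto, of S x] by simp
  moreover have "(\<lambda>N. app T (trunc N x)) \<longlonglongrightarrow> app T x"
    by (rule bounded_linear.tendsto[OF bounded_linear_app trunc_tendsto])
  ultimately show "app S x = app T x" by (rule LIMSEQ_unique)
qed

lemma clinear_op_mult: "clinear_op S \<Longrightarrow> clinear_op T \<Longrightarrow> clinear_op (S * T)"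
  unfolding clinear_op_def by (metis mult.assoc)

lemma clinear_op_shift: "clinear_op (shift k)"
  unfolding clinear_op_def by (intro bop_eqI ell2_eqI) simp

lemma clinear_op_basic:
  "clinear_op 0" "clinear_op 1" "clinear_op iop"
  "clinear_op S \<Longrightarrow> clinear_op T \<Longrightarrow> clinear_op (S + T)"
  "clinear_op S \<Longrightarrow> clinear_op T \<Longrightarrow> clinear_op (S - T)"
  "clinear_op S \<Longrightarrow> clinear_op (- S)"
  "clinear_op S \<Longrightarrow> clinear_op (r *\<^sub>R S)"
  by (simp_all add: clinear_op_def distrib_left distrib_right left_diff_distrib right_diff_distrib)

lemmas clinear_op_intros = clinear_op_basic clinear_op_mult clinear_op_shift

lemma clinear_op_diag: "bounded (range g) \<Longrightarrow> clinear_op (diag g)"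
  unfolding clinear_op_def by (intro bop_eqI ell2_eqI) (simp add: coord_diag)

section \<open>Unitary evolution and time averages\<close>

lemma inner_iop_left: "inner (app iop x) y = - inner x (app iop y)"
proof -
  have "cinner (\<i> *\<^sub>C x) y = - \<i> * cinner x y"
    by (subst (1 2) cinner_commute) (simp add: cinner_scaleC_right)
  then show ?thesis
    by (simp add: inner_ell2_def app_iop cinner_scaleC_right)
qed

lemma cinner_eq_inner: "cinner x y = Complex (inner x y) (- inner x (app iop y))"
  by (rule complex_eqI) (simp_all add: inner_ell2_def app_iop cinner_scaleC_right)

lemma norm_mult_mono:
  fixes S T :: "'a::real_normed_algebra"
  assumes "norm S \<le> c" "norm T \<le> d"
  shows "norm (S * T) \<le> c * d"
  using assms by (intro order_trans[OF norm_mult_ineq] mult_mono) (auto intro: order_trans[OF norm_ge_zero])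

text \<open>The real inner product is the real part of \<open>cinner\<close>. For complex-linear
  operators this is Hermitian symmetry, since \<open>cinner_eq_inner\<close> recovers the imaginary
  part by inserting \<open>iop\<close>.\<close>

definition symm :: "bop \<Rightarrow> bool" where
  "symm T \<longleftrightarrow> (\<forall>x y. inner (app T x) y = inner x (app T y))"

lemma symmD: "symm T \<Longrightarrow> inner (app T x) y = inner x (app T y)"
  by (simp add: symm_def)

definition evo :: "bop \<Rightarrow> real \<Rightarrow> bop" where
  "evo J t = exp (t *\<^sub>R (iop * J))"

lemma exp_commute:
  fixes x y :: "'a::{real_normed_algebra_1,banach}"
  assumes "x * y = y * x"
  shows "x * exp y = exp y * x"
proof -
  have p: "x * y ^ n = y ^ n * x" for n
    using assms by (metis power_commuting_commutes)
  have "x * exp y = (\<Sum>n. x * (y ^ n /\<^sub>R fact n))"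
    unfolding exp_def by (rule suminf_mult[symmetric]) (rule summable_exp_generic)
  also have "\<dots> = (\<Sum>n. (y ^ n /\<^sub>R fact n) * x)"
    by (simp add: p)
  also have "\<dots> = exp y * x"
    unfolding exp_def by (rule suminf_mult2[symmetric]) (rule summable_exp_generic)
  finally show ?thesis .
qed

lemma evo_0 [simp]: "evo J 0 = 1"
  by (simp add: evo_def)

lemma evo_add: "evo J (s + t) = evo J s * evo J t"
  unfolding evo_def by (simp add: scaleR_left_distrib exp_add_commuting)

lemma evo_minus [simp]: "evo J t * evo J (- t) = 1" "evo J (- t) * evo J t = 1"
  using evo_add[of J t "- t"] evo_add[of J "- t" t] by simp_all

lemma evo_deriv: "(evo J has_vector_derivative evo J t * (iop * J)) (at t within S)"
  unfolding evo_def by (rule exp_scaleR_has_vector_derivative_right)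

text \<open>The generator is \<open>iop * J\<close>, so commuting with \<open>J\<close> has to be
  complemented by complex linearity.\<close>

lemma evo_commute:
  assumes "T * J = J * T" "clinear_op T"
  shows "T * evo J t = evo J t * T"
  unfolding evo_def
proof (rule exp_commute)
  have "T * (iop * J) = iop * J * T"
    using assms unfolding clinear_op_def by (metis mult.assoc)
  then show "T * (t *\<^sub>R (iop * J)) = t *\<^sub>R (iop * J) * T" by simp
qed

lemma evo_deriv': "(evo J has_vector_derivative iop * J * evo J t) (at t within S)"
  using evo_deriv[of J t S] unfolding evo_def by (simp add: exp_times_scaleR_commute)

lemma evo_minus_deriv:
  "((\<lambda>s. evo J (- s)) has_vector_derivative - (iop * J * evo J (- t))) (at t within S)"
proof -
  have "((evo J \<circ> uminus) has_vector_derivative (- 1) *\<^sub>R (iop * J * evo J (- t))) (at t within S)"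
    by (rule vector_diff_chain_within[OF _ evo_deriv']) (auto intro!: derivative_eq_intros)
  then show ?thesis by (simp add: o_def)
qed

lemma continuous_on_evo [continuous_intros]:
  "continuous_on S f \<Longrightarrow> continuous_on S (\<lambda>s. evo J (f s))"
proof (rule continuous_on_compose2[of UNIV "evo J"])
  show "continuous_on UNIV (evo J)"
    by (intro continuous_at_imp_continuous_on ballI has_vector_derivative_continuous[OF evo_deriv])
qed auto

section \<open>Heisenberg evolution and its time averages\<close>

definition heis :: "bop \<Rightarrow> real \<Rightarrow> bop \<Rightarrow> bop" where
  "heis J t T = evo J t * T * evo J (- t)"

lemma continuous_on_heis [continuous_intros]: "continuous_on S (\<lambda>s. heis J s T)"
  unfolding heis_def by (intro continuous_intros)

lemma heis_integrable: "(\<lambda>s. heis J s T) integrable_on {a..b}"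
  by (intro integrable_continuous_interval continuous_intros)

text \<open>The commutator with the generator is the derivative of the Heisenberg evolution, so its
  integral is a boundary term.\<close>

lemma heis_has_integral:
  assumes "0 \<le> t"
  shows "((\<lambda>s. heis J s (iop * J * T - T * (iop * J))) has_integral heis J t T - T) {0..t}"
proof -
  have "((\<lambda>s. heis J s (iop * J * T - T * (iop * J))) has_integral heis J t T - heis J 0 T) {0..t}"
  proof (rule fundamental_theorem_of_calculus[OF assms])
    fix s
    have "((\<lambda>s. evo J s * T * evo J (- s)) has_vector_derivative
        evo J s * T * - (iop * J * evo J (- s)) + (evo J s * (iop * J)) * T * evo J (- s)) (at s within {0..t})"
      by (rule has_vector_derivative_mult[OF has_vector_derivative_mult_left[OF evo_deriv] evo_minus_deriv])
    then show "((\<lambda>s. heis J s T) has_vector_derivative heis J s (iop * J * T - T * (iop * J))) (at s within {0..t})"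
      unfolding heis_def by (simp add: algebra_simps)
  qed
  then show ?thesis by (simp add: heis_def)
qed

lemma heis_linear: "heis J t (S + T) = heis J t S + heis J t T"
  by (simp add: heis_def algebra_simps)

definition avg :: "bop \<Rightarrow> real \<Rightarrow> bop \<Rightarrow> bop" where
  "avg J t T = (1 / t) *\<^sub>R integral {0..t} (\<lambda>s. heis J s T)"

lemma avg_add: "avg J t (S + T) = avg J t S + avg J t T"
  unfolding avg_def heis_linear by (simp add: integral_add heis_integrable scaleR_add_right)

text \<open>A constant of motion passes through the evolution and then, as a fixed bounded factor,
  through the integral.\<close>

lemma avg_mult_left:
  assumes "B * J = J * B" "clinear_op B"
  shows "avg J t (B * T) = B * avg J t T"
proof -
  have "heis J s (B * T) = B * heis J s T" for s
    unfolding heis_def by (metis evo_commute[OF assms] mult.assoc)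
  then show ?thesis
    using integral_linear[OF heis_integrable[of J T 0 t] bounded_linear_mult_right[of B]]
    by (simp add: avg_def o_def)
qed

lemma avg_mult_right:
  assumes "B * J = J * B" "clinear_op B"
  shows "avg J t (T * B) = avg J t T * B"
proof -
  have "heis J s (T * B) = heis J s T * B" for s
    unfolding heis_def by (metis evo_commute[OF assms] mult.assoc)
  then show ?thesis
    using integral_linear[OF heis_integrable[of J T 0 t] bounded_linear_mult_left[of B]]
    by (simp add: avg_def o_def)
qed

lemma avg_1: "0 < t \<Longrightarrow> avg J t 1 = 1"
  by (simp add: avg_def heis_def)

lemma avg_fixed: "0 < t \<Longrightarrow> D * J = J * D \<Longrightarrow> clinear_op D \<Longrightarrow> avg J t D = D"
  using avg_mult_left[of D J t 1] by (simp add: avg_1)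

lemma clinear_op_avg:
  assumes "clinear_op T" "clinear_op J"
  shows "clinear_op (avg J t T)"
proof -
  have "iop * J = J * iop" using assms(2) by (simp add: clinear_op_def)
  note this clinear_op_intros(3)
  from avg_mult_left[OF this, of t T] avg_mult_right[OF this, of t T] assms(1)
  show ?thesis by (simp add: clinear_op_def)
qed

locale hamiltonian =
  fixes J :: bop
  assumes clin: "clinear_op J" and sym: "symm J"
begin

lemma iop_J: "iop * J = J * iop"
  using clin by (simp add: clinear_op_def)

text \<open>\<open>iop * J\<close> is skew-symmetric for the real inner product, so the inner
  product of two evolved vectors has derivative 0.\<close>

lemma inner_evo: "inner (app (evo J t) x) (app (evo J t) y) = inner x y"
proof -
  let ?h = "\<lambda>s. inner (app (evo J s) x) (app (evo J s) y)"
  have d: "((\<lambda>s. app (evo J s) x) has_vector_derivative app iop (app J (app (evo J s) x))) (at s)" for x s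
    using bounded_linear.has_vector_derivative[OF bounded_linear_app_left evo_deriv'[of J s UNIV]] by simp
  have "(?h has_vector_derivative 0) (at s)" for s
  proof -
    let ?u = "app (evo J s) x" and ?v = "app (evo J s) y"
    have "inner ?u (app iop (app J ?v)) + inner (app iop (app J ?u)) ?v = 0"
    proof -
      have "app J (app iop ?v) = app iop (app J ?v)"
        using iop_J by (metis app_simps(6))
      then show ?thesis
        by (simp add: inner_iop_left symmD[OF sym])
    qed
    then show ?thesis
      using bounded_bilinear.has_vector_derivative[OF bounded_bilinear_inner d[of x s] d[of y s]] by simp
  qed
  then have "?h t = ?h 0"
    using has_vector_derivative_zero_constant[of UNIV ?h] by (metis UNIV_I convex_UNIV)
  then show ?thesis by simp
qed

lemma norm_app_evo [simp]: "norm (app (evo J t) x) = norm x"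
  by (simp add: norm_eq_sqrt_inner inner_evo)

lemma inner_evo_left: "inner (app (evo J t) x) y = inner x (app (evo J (- t)) y)"
proof -
  have "app (evo J t) (app (evo J (- t)) y) = y"
    by (metis app_simps(2,6) evo_minus(1))
  then show ?thesis using inner_evo[of t x "app (evo J (- t)) y"] by simp
qed

lemma norm_evo: "norm (evo J t) \<le> 1"
  by (rule norm_bop_le) auto

lemma norm_heis: "norm (heis J t T) \<le> norm T"
proof -
  have "norm (app (heis J t T) x) \<le> norm T * norm x" for x
    unfolding heis_def using norm_app[of T "app (evo J (- t)) x"] by simp
  then show ?thesis by (intro norm_bop_le) auto
qed

lemma norm_avg: 
  assumes "0 < t"
  shows "norm (avg J t T) \<le> norm T"
proof -
  have "norm (integral {0..t} (\<lambda>s. heis J s T)) \<le> norm T * (t - 0)"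
    using assms by (intro integral_bound continuous_intros norm_heis) auto
  then show ?thesis using assms by (simp add: avg_def field_simps)
qed

text \<open>The integral of the evolved i[J, R] is the boundary term \<open>heis J t R - R\<close>,
  bounded uniformly in time; the average divides it by \<open>t\<close>.\<close>

lemma norm_avg_commutator:
  assumes "0 < t" "clinear_op R"
  shows "norm (avg J t (J * R - R * J)) \<le> 2 * norm R / t"
proof -
  have "iop * (J * R - R * J) = iop * J * R - R * (iop * J)"
    using assms(2) unfolding clinear_op_def by (simp add: right_diff_distrib mult.assoc[symmetric])
  then have "avg J t (iop * (J * R - R * J)) = (1 / t) *\<^sub>R (heis J t R - R)"
    unfolding avg_def using integral_unique[OF heis_has_integral[of t J R]] assms(1) by simp
  moreover have "avg J t (iop * (J * R - R * J)) = iop * avg J t (J * R - R * J)"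
    by (rule avg_mult_left) (auto simp: iop_J intro: clinear_op_intros)
  ultimately have e: "iop * avg J t (J * R - R * J) = (1 / t) *\<^sub>R (heis J t R - R)" by simp
  have "norm (app (avg J t (J * R - R * J)) x) \<le> 2 * norm R / t * norm x" for x
  proof -
    \<comment> \<open>\<open>iop\<close> preserves the norm of each vector; the bound
      \<open>norm_iop\<close> alone would give the inequality in the wrong direction.\<close>
    have "norm (app (avg J t (J * R - R * J)) x) = norm (app (iop * avg J t (J * R - R * J)) x)"
      by simp
    also have "\<dots> \<le> norm ((1 / t) *\<^sub>R (heis J t R - R)) * norm x"
      unfolding e by (rule norm_app)
    also have "\<dots> \<le> 2 * norm R / t * norm x"
    proof (rule mult_right_mono)
      have "norm (heis J t R - R) \<le> 2 * norm R"
        using norm_triangle_ineq4[of "heis J t R" R] norm_heis[of t R] by simp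
      then show "norm ((1 / t) *\<^sub>R (heis J t R - R)) \<le> 2 * norm R / t"
        using assms(1) by (simp add: divide_right_mono)
    qed simp
    finally show ?thesis .
  qed
  then show ?thesis using assms(1) by (intro norm_bop_le) auto
qed

lemma symm_avg:
  assumes "symm T"
  shows "symm (avg J t T)"
  unfolding symm_def
proof (intro allI)
  fix x y
  have b: "bounded_linear (\<lambda>S. inner (app S x) y)" "bounded_linear (\<lambda>S. inner x (app S y))"
    by (rule bounded_linear_compose[OF bounded_linear_inner_left bounded_linear_app_left]
        bounded_linear_compose[OF bounded_linear_inner_right bounded_linear_app_left])+
  have "inner (app (heis J s T) x) y = inner x (app (heis J s T) y)" for s
    unfolding heis_def by (simp add: inner_evo_left symmD[OF assms])
  then have "integral {0..t} ((\<lambda>S. inner (app S x) y) \<circ> (\<lambda>s. heis J s T))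
      = integral {0..t} ((\<lambda>S. inner x (app S y)) \<circ> (\<lambda>s. heis J s T))"
    by (simp add: o_def)
  then show "inner (app (avg J t T) x) y = inner x (app (avg J t T) y)"
    unfolding integral_linear[OF heis_integrable b(1)] integral_linear[OF heis_integrable b(2)]
    by (simp add: avg_def)
qed

end

text \<open>Duhamel's formula: the derivative of \<open>evo J s * evo J' (- s)\<close> contains only
  the difference \<open>J - J'\<close>, and both groups are isometric, so they separate at most
  linearly in time.\<close>

lemma norm_evo_diff:
  assumes "hamiltonian J" "hamiltonian J'" "0 \<le> t"
  shows "norm (evo J t - evo J' t) \<le> t * norm (J - J')"
    and "norm (evo J (- t) - evo J' (- t)) \<le> t * norm (J - J')"
proof -
  interpret J: hamiltonian J by fact
  interpret J': hamiltonian J' by fact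
  \<comment> \<open>The sign \<open>c\<close> treats forward and backward times together.\<close>
  have *: "norm (evo J (c * t) - evo J' (c * t)) \<le> t * norm (J - J')" if c: "\<bar>c\<bar> = 1" for c
  proof -
    have d: "((\<lambda>s. evo J (c * s)) has_vector_derivative c *\<^sub>R (evo J (c * s) * (iop * J))) (at s within {0..t})" for s
    proof -
      have "((evo J \<circ> (\<lambda>s. c * s)) has_vector_derivative c *\<^sub>R (evo J (c * s) * (iop * J))) (at s within {0..t})"
        by (rule vector_diff_chain_within[OF _ evo_deriv]) (auto intro!: derivative_eq_intros)
      then show ?thesis by (simp add: o_def)
    qed
    have d': "((\<lambda>s. evo J' (- (c * s))) has_vector_derivative - c *\<^sub>R (iop * J' * evo J' (- (c * s)))) (at s within {0..t})" for s
    proof -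
      have "(((\<lambda>s. evo J' (- s)) \<circ> (\<lambda>s. c * s)) has_vector_derivative c *\<^sub>R - (iop * J' * evo J' (- (c * s)))) (at s within {0..t})"
        by (rule vector_diff_chain_within[OF _ evo_minus_deriv]) (auto intro!: derivative_eq_intros)
      then show ?thesis by (simp add: o_def)
    qed
    let ?f = "\<lambda>s. c *\<^sub>R (evo J (c * s) * iop * (J - J') * evo J' (- (c * s)))"
    have "(?f has_integral evo J (c * t) * evo J' (- (c * t)) - evo J (c * 0) * evo J' (- (c * 0))) {0..t}"
    proof (rule fundamental_theorem_of_calculus[OF \<open>0 \<le> t\<close>])
      fix s
      have "?f s = evo J (c * s) * (- c *\<^sub>R (iop * J' * evo J' (- (c * s)))) + 
          c *\<^sub>R (evo J (c * s) * (iop * J)) * evo J' (- (c * s))"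
        by (simp add: algebra_simps)
      then show "((\<lambda>s. evo J (c * s) * evo J' (- (c * s))) has_vector_derivative ?f s) (at s within {0..t})"
        using has_vector_derivative_mult[OF d d'] by simp
    qed
    then have i: "(?f has_integral evo J (c * t) * evo J' (- (c * t)) - 1) {0..t}" by simp
    have bd: "norm (?f s) \<le> norm (J - J')" for s
    proof -
      have "norm (evo J (c * s) * iop * (J - J') * evo J' (- (c * s))) \<le> 1 * 1 * norm (J - J') * 1"
        by (intro norm_mult_mono J.norm_evo J'.norm_evo norm_iop order_refl)
      then show ?thesis using c by simp
    qed
    have n: "norm (evo J (c * t) * evo J' (- (c * t)) - 1) \<le> t * norm (J - J')"
      using has_integral_bound_real[OF norm_ge_zero finite.emptyI i, of "J - J'"] bd \<open>0 \<le> t\<close> by (simp add: mult.commute)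
    have "evo J (c * t) - evo J' (c * t) = (evo J (c * t) * evo J' (- (c * t)) - 1) * evo J' (c * t)"
      by (simp add: algebra_simps)
    then have "norm (evo J (c * t) - evo J' (c * t)) \<le>
        norm (evo J (c * t) * evo J' (- (c * t)) - 1) * norm (evo J' (c * t))"
      by (metis norm_mult_ineq)
    also have "\<dots> \<le> norm (evo J (c * t) * evo J' (- (c * t)) - 1) * 1"
      by (intro mult_left_mono J'.norm_evo) simp
    finally show ?thesis using n by simp
  qed
  show "norm (evo J t - evo J' t) \<le> t * norm (J - J')" using *[of 1] by simp
  show "norm (evo J (- t) - evo J' (- t)) \<le> t * norm (J - J')" using *[of "-1"] by simp
qed

text \<open>The observable, the left and the right evolution factor are replaced in turn. Each of
  the last two costs a multiple of \<open>s * norm (J - J')\<close>, whence the factor 2 and the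
  growth with \<open>t\<close>.\<close>

lemma norm_avg_diff:
  assumes "hamiltonian J" "hamiltonian J'" "0 < t"
  shows "norm (avg J t T - avg J' t T') \<le> norm (T - T') + 2 * t * norm (J - J') * norm T'"
proof -
  interpret J: hamiltonian J by fact
  interpret J': hamiltonian J' by fact
  let ?C = "norm (T - T') + 2 * t * norm (J - J') * norm T'"
  have h: "norm (heis J s T - heis J' s T') \<le> ?C" if s: "s \<in> {0..t}" for s
  proof -
    have "heis J s T - heis J' s T' = heis J s (T - T') + (evo J s - evo J' s) * (T' * evo J (- s))
        + evo J' s * T' * (evo J (- s) - evo J' (- s))"
      by (simp add: heis_def algebra_simps)
    also have "norm \<dots> \<le> norm (heis J s (T - T')) + norm ((evo J s - evo J' s) * (T' * evo J (- s)))
        + norm (evo J' s * T' * (evo J (- s) - evo J' (- s)))"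
      by (rule order_trans[OF norm_triangle_ineq add_right_mono[OF norm_triangle_ineq]])
    also have "\<dots> \<le> norm (T - T') + s * norm (J - J') * norm T' + norm T' * (s * norm (J - J'))"
    proof (intro add_mono)
      show "norm (heis J s (T - T')) \<le> norm (T - T')" by (rule J.norm_heis)
      have "norm ((evo J s - evo J' s) * (T' * evo J (- s))) \<le> s * norm (J - J') * (norm T' * 1)"
        using s by (intro norm_mult_mono norm_evo_diff assms J.norm_evo order_refl) auto
      then show "norm ((evo J s - evo J' s) * (T' * evo J (- s))) \<le> s * norm (J - J') * norm T'"
        by simp
      have "norm (evo J' s * T' * (evo J (- s) - evo J' (- s))) \<le> 1 * norm T' * (s * norm (J - J'))"
        using s by (intro norm_mult_mono norm_evo_diff assms J'.norm_evo order_refl) auto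
      then show "norm (evo J' s * T' * (evo J (- s) - evo J' (- s))) \<le> norm T' * (s * norm (J - J'))"
        by simp
    qed
    also have "\<dots> = norm (T - T') + s * (2 * norm (J - J') * norm T')" by (simp add: algebra_simps)
    also have "\<dots> \<le> norm (T - T') + t * (2 * norm (J - J') * norm T')"
      using s by (intro add_left_mono mult_right_mono) auto
    finally show ?thesis by (simp add: algebra_simps)
  qed
  have "avg J t T - avg J' t T' = (1 / t) *\<^sub>R integral {0..t} (\<lambda>s. heis J s T - heis J' s T')"
    by (simp add: avg_def integral_diff heis_integrable scaleR_diff_right)
  moreover have "norm (integral {0..t} (\<lambda>s. heis J s T - heis J' s T')) \<le> ?C * (t - 0)"
    using assms(3) by (intro integral_bound continuous_intros h) auto
  ultimately show ?thesis using assms(3) by (simp add: field_simps)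
qed

lemma scaleC_i_power: "(\<i> ^ k) *\<^sub>C x = app (iop ^ k) x"
proof (induction k arbitrary: x)
  case (Suc k)
  have "(\<i> ^ Suc k) *\<^sub>C x = app iop ((\<i> ^ k) *\<^sub>C x)"
    by (rule ell2_eqI) simp
  then show ?case by (simp add: Suc.IH)
qed (auto intro: ell2_eqI)

text \<open>Connects the complex power series of the statement with the exponential of the real
  Banach algebra. The series agree termwise because \<open>iop\<close> commutes with
  \<open>J\<close>, so that powers of \<open>iop * J\<close> split.\<close>

lemma exp_op_eq_evo:
  assumes "clinear_op (Bop J)"
  shows "exp_op (\<i> * complex_of_real t) J x = app (evo (Bop J) t) x"
proof -
  let ?A = "t *\<^sub>R (iop * Bop J)"
  have pw: "(blinfun_apply J ^^ k) y = app (Bop J ^ k) y" for k y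
    by (induction k) (simp_all add: app_Bop)
  have c: "iop * Bop J = Bop J * iop" using assms by (simp add: clinear_op_def)
  have mp: "(iop * Bop J) ^ k = iop ^ k * Bop J ^ k" for k
  proof (induction k)
    case (Suc k)
    have "iop ^ k * Bop J = Bop J * iop ^ k"
      using c by (metis power_commuting_commutes)
    then show ?case by (simp add: Suc.IH mult.assoc) (metis mult.assoc)
  qed simp
  have "((\<i> * complex_of_real t) ^ k / fact k) *\<^sub>C ((blinfun_apply J ^^ k) x) = app (?A ^ k /\<^sub>R fact k) x" for k
  proof -
    have "(\<i> * complex_of_real t) ^ k / fact k = complex_of_real (t ^ k / fact k) * \<i> ^ k"
      by (simp add: power_mult_distrib)
    then have "((\<i> * complex_of_real t) ^ k / fact k) *\<^sub>C app (Bop J ^ k) x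
        = (t ^ k / fact k) *\<^sub>R (\<i> ^ k *\<^sub>C app (Bop J ^ k) x)"
      by (intro ell2_eqI) (simp add: scaleR_conv_of_real)
    then show ?thesis
      unfolding pw scaleR_power mp by (simp add: scaleC_i_power divide_inverse mult.commute)
  qed
  then have "exp_op (\<i> * complex_of_real t) J x = (\<Sum>k. app (?A ^ k /\<^sub>R fact k) x)"
    unfolding exp_op_def by simp
  also have "\<dots> = app (\<Sum>k. ?A ^ k /\<^sub>R fact k) x"
    by (rule bounded_linear.suminf[OF bounded_linear_app_left summable_exp_generic, symmetric])
  finally show ?thesis by (simp add: evo_def exp_def)
qed

section \<open>Jacobi matrices and velocity operators\<close>

definition jac :: "(int \<Rightarrow> real) \<Rightarrow> (int \<Rightarrow> real) \<Rightarrow> bop" where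
  "jac a b = shift 1 * diag a + diag b + diag a * shift (- 1)"

text \<open>For the off-diagonal coefficients of \<open>J\<close> this is the velocity i[J, X]; the
  diagonal part of \<open>J\<close> commutes with X and drops out. The sequence is a parameter
  because i[J, g(X)] has the same shape, with \<open>a n\<close> multiplied by an increment of
  g.\<close>

definition cur :: "(int \<Rightarrow> real) \<Rightarrow> bop" where
  "cur a = iop * (diag a * shift (- 1) - shift 1 * diag a)"

lemma inner_shift_left: "inner (app (shift k) x) y = inner x (app (shift (- k)) y)"
proof -
  have n: "norm (app (shift k) u + app (shift k) v) = norm (u + v)" for u v
    using norm_app_shift[of k "u + v"] by simp
  have "inner (app (shift k) x) (app (shift k) z) = inner x z" for z
    unfolding dot_norm n by simp
  moreover have "app (shift k) (app (shift (- k)) y) = y"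
    by (rule ell2_eqI) simp
  ultimately show ?thesis by metis
qed

lemma inner_diag_left:
  assumes "bounded (range g)"
  shows "inner (app (diag g) x) y = inner x (app (diag g) y)"
  unfolding inner_ell2_def cinner_def
  by (simp add: coord_diag[OF assms] mult.assoc mult.left_commute)

lemma norm_delta [simp]: "norm (delta n) = 1"
  by (simp add: norm_eq_sqrt_inner inner_ell2_def coord_delta)

lemma norm_cur_le:
  assumes "\<And>n. \<bar>c n\<bar> \<le> r"
  shows "norm (cur c) \<le> 2 * r"
proof -
  have d: "norm (diag c) \<le> r" by (rule norm_diag_le) (rule assms)
  have "norm (diag c * shift (- 1) - shift 1 * diag c) \<le> r * 1 + 1 * r"
    by (rule order_trans[OF norm_triangle_ineq4]) (intro add_mono norm_mult_mono d norm_shift)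
  from norm_mult_mono[OF norm_iop this] show ?thesis
    by (simp add: cur_def)
qed

locale jacobi_op =
  fixes a b :: "int \<Rightarrow> real"
  assumes a_bounded: "bounded (range a)" and b_bounded: "bounded (range b)"
begin

abbreviation "J \<equiv> jac a b"
abbreviation "A \<equiv> cur a"

lemmas clinear_a = clinear_op_diag[OF a_bounded] and clinear_b = clinear_op_diag[OF b_bounded]

lemma clinear_J: "clinear_op J"
  unfolding jac_def by (intro clinear_op_intros clinear_a clinear_b)

lemma clinear_A: "clinear_op A"
  unfolding cur_def by (intro clinear_op_intros clinear_a clinear_b)

lemma coord_J: "coord (app J x) n = of_real (a (n - 1)) * coord x (n - 1) + of_real (b n) * coord x n
    + of_real (a n) * coord x (n + 1)"
  by (simp add: jac_def coord_diag a_bounded b_bounded)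

lemma coord_A: "coord (app A x) n = \<i> * (of_real (a n) * coord x (n + 1) - of_real (a (n - 1)) * coord x (n - 1))"
  by (simp add: cur_def coord_diag a_bounded right_diff_distrib)

lemma J_delta: "app J (delta n) = a (n - 1) *\<^sub>R delta (n - 1) + b n *\<^sub>R delta n + a n *\<^sub>R delta (n + 1)"
  by (rule ell2_eqI) (auto simp: coord_J coord_delta scaleR_conv_of_real)

lemma symm_J: "symm J"
  unfolding symm_def jac_def
  by (simp add: inner_add_left inner_add_right inner_shift_left inner_diag_left a_bounded b_bounded)

text \<open>The difference of weighted shifts is skew-symmetric and complex-linear; the imaginary
  unit makes it symmetric.\<close>

lemma symm_A: "symm A"
proof -
  let ?Z = "diag a * shift (- 1) - shift 1 * diag a"
  have "clinear_op ?Z" by (intro clinear_op_intros clinear_a)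
  then have c: "app ?Z (app iop y) = app iop (app ?Z y)" for y
    unfolding clinear_op_def by (metis app_simps(6))
  have s: "inner (app ?Z x) y = - inner x (app ?Z y)" for x y
    by (simp add: inner_diff_left inner_diff_right inner_shift_left inner_diag_left a_bounded)
  show ?thesis unfolding symm_def cur_def app_simps(6) inner_iop_left s c by simp
qed

sublocale hamiltonian J
  by unfold_locales (rule clinear_J symm_J)+

lemma abs_a_le: "\<bar>a n\<bar> \<le> norm J"
proof -
  have "norm (app J (delta (n + 1))) \<le> norm J"
    using norm_app[of J "delta (n + 1)"] by simp
  moreover have "coord (app J (delta (n + 1))) n = of_real (a n)"
    by (simp add: coord_J coord_delta)
  ultimately show ?thesis using coord_le_norm[of "app J (delta (n + 1))" n] by simp
qed


lemma abs_b_le: "\<bar>b n\<bar> \<le> norm J"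
proof -
  have "norm (app J (delta n)) \<le> norm J"
    using norm_app[of J "delta n"] by simp
  moreover have "coord (app J (delta n)) n = of_real (b n)"
    by (simp add: coord_J coord_delta)
  ultimately show ?thesis using coord_le_norm[of "app J (delta n)" n] by simp
qed

lemma norm_A_le: "norm A \<le> 2 * norm J"
  by (rule norm_cur_le) (rule abs_a_le)

end

lemma coeff_diff_le:
  assumes "jacobi_op a b" "jacobi_op a' b'"
  shows "\<bar>a n - a' n\<bar> \<le> norm (jac a b - jac a' b')"
proof -
  interpret j: jacobi_op a b by fact
  interpret j': jacobi_op a' b' by fact
  have "norm (app (jac a b - jac a' b') (delta (n + 1))) \<le> norm (jac a b - jac a' b')"
    using norm_app[of "jac a b - jac a' b'" "delta (n + 1)"] by simp
  moreover have "coord (app (jac a b - jac a' b') (delta (n + 1))) n = of_real (a n - a' n)"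
    by (simp add: j.coord_J j'.coord_J coord_delta)
  ultimately show ?thesis
    using coord_le_norm[of "app (jac a b - jac a' b') (delta (n + 1))" n] by (simp only: norm_of_real)
qed

lemma cur_diff_le:
  assumes "jacobi_op a b" "jacobi_op a' b'"
  shows "norm (cur a - cur a') \<le> 2 * norm (jac a b - jac a' b')"
proof -
  interpret j: jacobi_op a b by fact
  interpret j': jacobi_op a' b' by fact
  let ?d = "\<lambda>n. a n - a' n"
  have "bounded (range ?d)"
    using coeff_diff_le[OF assms] by (auto simp: bounded_iff)
  then have "cur a - cur a' = cur ?d"
    by (intro bop_eqI ell2_eqI) (simp add: cur_def coord_diag j.a_bounded j'.a_bounded algebra_simps)
  then show ?thesis using norm_cur_le[OF coeff_diff_le[OF assms]] by simp
qed

lemma norm_scaleR_add_le: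
  fixes x y :: "'a::real_normed_vector"
  assumes "norm x \<le> c" "norm y \<le> d"
  shows "norm (r *\<^sub>R x + s *\<^sub>R y) \<le> \<bar>r\<bar> * c + \<bar>s\<bar> * d"
proof -
  have "norm (r *\<^sub>R x + s *\<^sub>R y) \<le> \<bar>r\<bar> * norm x + \<bar>s\<bar> * norm y"
    using norm_triangle_ineq[of "r *\<^sub>R x" "s *\<^sub>R y"] by simp
  also have "\<dots> \<le> \<bar>r\<bar> * c + \<bar>s\<bar> * d"
    using assms by (intro add_mono mult_left_mono) auto
  finally show ?thesis .
qed

section \<open>Polynomials in J and their commutators with X\<close>

context jacobi_op
begin

text \<open>\<open>W\<close> is the commutator \<open>i[P, X]\<close> with the position operator, expressed on the basis vectors.
  Modulo commutators \<open>[J, R]\<close>, which vanish in the time average, it is \<open>P' A\<close>, where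
  \<open>P'\<close> plays the role of the derivative of the polynomial \<open>P\<close> in \<open>J\<close>.\<close>

definition jet :: "real \<Rightarrow> bop \<Rightarrow> bop \<Rightarrow> bop \<Rightarrow> bop \<Rightarrow> bop \<Rightarrow> bool" where
  "jet \<rho> P W P' R R' \<longleftrightarrow>
    clinear_op P \<and> clinear_op W \<and> clinear_op P' \<and> clinear_op R \<and> clinear_op R' \<and>
    P * J = J * P \<and> P' * J = J * P' \<and> W * J - J * W = A * P - P * A \<and>
    W = P' * A + (J * R - R * J) \<and> W = A * P' + (J * R' - R' * J) \<and>
    norm P \<le> \<rho> \<and> norm P' \<le> \<rho> \<and> norm R \<le> \<rho> \<and> norm R' \<le> \<rho> \<and>
    (\<forall>n m. coord (app W (delta n)) m = \<i> * of_int (n - m) * coord (app P (delta n)) m)"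

lemma jet_0: "jet 0 0 0 0 0 0"
  by (simp add: jet_def clinear_op_intros)

lemma jet_1: "jet 1 1 0 0 0 0"
  by (simp add: jet_def clinear_op_intros coord_delta)

lemma jet_add:
  assumes "jet \<rho> P W P' R R'" "jet \<sigma> Q V Q' T T'"
  shows "jet (\<bar>r\<bar> * \<rho> + \<bar>s\<bar> * \<sigma>) (r *\<^sub>R P + s *\<^sub>R Q) (r *\<^sub>R W + s *\<^sub>R V) (r *\<^sub>R P' + s *\<^sub>R Q')
      (r *\<^sub>R R + s *\<^sub>R T) (r *\<^sub>R R' + s *\<^sub>R T')"
  unfolding jet_def
proof (intro conjI)
  note p = assms(1)[unfolded jet_def] and q = assms(2)[unfolded jet_def]
  have c: "W * J - J * W = A * P - P * A" "V * J - J * V = A * Q - Q * A" using p q by blast+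
  have e: "W = P' * A + (J * R - R * J)" "V = Q' * A + (J * T - T * J)" using p q by blast+
  have e': "W = A * P' + (J * R' - R' * J)" "V = A * Q' + (J * T' - T' * J)" using p q by blast+
  show "(r *\<^sub>R P + s *\<^sub>R Q) * J = J * (r *\<^sub>R P + s *\<^sub>R Q)" "(r *\<^sub>R P' + s *\<^sub>R Q') * J = J * (r *\<^sub>R P' + s *\<^sub>R Q')"
    using p q by (simp_all add: distrib_left distrib_right)
  have "(r *\<^sub>R W + s *\<^sub>R V) * J - J * (r *\<^sub>R W + s *\<^sub>R V) = r *\<^sub>R (W * J - J * W) + s *\<^sub>R (V * J - J * V)"
    by (simp add: algebra_simps)
  also have "\<dots> = r *\<^sub>R (A * P - P * A) + s *\<^sub>R (A * Q - Q * A)" by (simp only: c)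
  finally show "(r *\<^sub>R W + s *\<^sub>R V) * J - J * (r *\<^sub>R W + s *\<^sub>R V) = A * (r *\<^sub>R P + s *\<^sub>R Q) - (r *\<^sub>R P + s *\<^sub>R Q) * A"
    by (simp add: algebra_simps)
  have "r *\<^sub>R W + s *\<^sub>R V = r *\<^sub>R (P' * A + (J * R - R * J)) + s *\<^sub>R (Q' * A + (J * T - T * J))" by (simp only: e[symmetric])
  then show "r *\<^sub>R W + s *\<^sub>R V = (r *\<^sub>R P' + s *\<^sub>R Q') * A + (J * (r *\<^sub>R R + s *\<^sub>R T) - (r *\<^sub>R R + s *\<^sub>R T) * J)"
    by (simp add: algebra_simps)
  have "r *\<^sub>R W + s *\<^sub>R V = r *\<^sub>R (A * P' + (J * R' - R' * J)) + s *\<^sub>R (A * Q' + (J * T' - T' * J))" by (simp only: e'[symmetric])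
  then show "r *\<^sub>R W + s *\<^sub>R V = A * (r *\<^sub>R P' + s *\<^sub>R Q') + (J * (r *\<^sub>R R' + s *\<^sub>R T') - (r *\<^sub>R R' + s *\<^sub>R T') * J)"
    by (simp add: algebra_simps)
  show "\<forall>n m. coord (app (r *\<^sub>R W + s *\<^sub>R V) (delta n)) m = \<i> * of_int (n - m) * coord (app (r *\<^sub>R P + s *\<^sub>R Q) (delta n)) m"
  proof -
    have "coord (app W (delta n)) m = \<i> * of_int (n - m) * coord (app P (delta n)) m"
      "coord (app V (delta n)) m = \<i> * of_int (n - m) * coord (app Q (delta n)) m" for n m
      using p q by blast+
    then show ?thesis by (simp add: distrib_left)
  qed
qed (use assms[unfolded jet_def] in \<open>auto intro: clinear_op_intros norm_scaleR_add_le\<close>)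

text \<open>Product rule: i[JP, X] = A P + J W, and z P(z) has derivative P + z P'. The clause
  \<open>W * J - J * W = A * P - P * A\<close> of \<open>jet\<close> is the Jacobi identity for P, X
  and J when P commutes with J; it moves the velocity across P and so yields the form with
  \<open>P'\<close> to the left of \<open>A\<close>. The factor \<open>1 + 3 * L\<close> dominates
  all four norms because \<open>norm A\<close> is at most \<open>2 * L\<close>.\<close>

lemma jet_J:
  assumes p: "jet \<rho> P W P' R R'" and L: "norm J \<le> L"
  shows "jet ((1 + 3 * L) * \<rho>) (J * P) (A * P + J * W) (P + J * P') (R * J - P' * A) (A * P' + J * R')"
proof -
  note p = p[unfolded jet_def]
  have PJ: "P * J = J * P" and P'J: "P' * J = J * P'" and WJ: "W * J - J * W = A * P - P * A"
    and W: "W = P' * A + (J * R - R * J)" and W': "W = A * P' + (J * R' - R' * J)"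
    using p by auto
  have \<rho>: "0 \<le> \<rho>" and L0: "0 \<le> L" using p L norm_ge_zero order_trans by blast+
  have A: "norm A \<le> 2 * L" using norm_A_le L by simp
  show ?thesis
    unfolding jet_def
  proof (intro conjI)
    show "J * P * J = J * (J * P)" by (simp add: PJ mult.assoc)
    show "(P + J * P') * J = J * (P + J * P')"
      by (simp add: distrib_left distrib_right PJ P'J mult.assoc)
    have "(A * P + J * W) * J - J * (A * P + J * W) = A * (P * J) - J * A * P + J * (W * J - J * W)"
      by (simp add: algebra_simps)
    also have "\<dots> = A * (J * P) - J * P * A"
      unfolding WJ PJ by (simp add: algebra_simps)
    finally show "(A * P + J * W) * J - J * (A * P + J * W) = A * (J * P) - J * P * A" .
    have "A * P + J * W = W * J + P * A" using WJ by (simp add: algebra_simps)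
    also have "W * J = P' * A * J + (J * R - R * J) * J" by (subst W) (simp add: distrib_right)
    also have "P' * A * J + (J * R - R * J) * J + P * A
        = (P + P' * J) * A + (J * (R * J) - P' * J * A - (R * J - P' * A) * J)"
      by (simp add: algebra_simps)
    finally show "A * P + J * W = (P + J * P') * A + (J * (R * J - P' * A) - (R * J - P' * A) * J)"
      unfolding P'J by (simp add: algebra_simps)
    have "A * P + J * W = A * P + J * (A * P' + (J * R' - R' * J))" using W' by simp
    also have "\<dots> = A * (P + P' * J) + (J * (A * P' + J * R') - (A * P' + J * R') * J)"
      by (simp add: algebra_simps)
    finally show "A * P + J * W = A * (P + J * P') + (J * (A * P' + J * R') - (A * P' + J * R') * J)"
      unfolding P'J .
    have b: "norm P \<le> \<rho>" "norm P' \<le> \<rho>" "norm R \<le> \<rho>" "norm R' \<le> \<rho>" using p by auto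
    have L\<rho>: "0 \<le> L * \<rho>" using L0 \<rho> by simp
    show "norm (J * P) \<le> (1 + 3 * L) * \<rho>"
      using norm_mult_mono[OF L b(1)] L\<rho> \<rho> by (simp add: distrib_right)
    show "norm (P + J * P') \<le> (1 + 3 * L) * \<rho>"
      using norm_mult_mono[OF L b(2)] b(1) norm_triangle_ineq[of P "J * P'"] L\<rho> by (simp add: distrib_right)
    show "norm (R * J - P' * A) \<le> (1 + 3 * L) * \<rho>"
      using norm_mult_mono[OF b(3) L] norm_mult_mono[OF b(2) A] norm_triangle_ineq4[of "R * J" "P' * A"] \<rho>
      by (simp add: algebra_simps)
    show "norm (A * P' + J * R') \<le> (1 + 3 * L) * \<rho>"
      using norm_mult_mono[OF L b(4)] norm_mult_mono[OF A b(2)] norm_triangle_ineq[of "A * P'" "J * R'"] \<rho>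
      by (simp add: algebra_simps)
    have W_delta: "coord (app W (delta n)) m = \<i> * of_int (n - m) * coord (app P (delta n)) m" for n m
      using p by blast
    show "\<forall>n m. coord (app (A * P + J * W) (delta n)) m = \<i> * of_int (n - m) * coord (app (J * P) (delta n)) m"
      by (simp add: coord_A coord_J W_delta) (simp add: algebra_simps)
  qed (use p in \<open>auto intro!: clinear_op_intros clinear_J clinear_A\<close>)
qed

text \<open>The Jacobi eigenvalue recurrence on the sites 0, 1, 2, ..., with the operator
  \<open>J\<close> in place of the spectral parameter. The fundamental solutions \<open>csol\<close>
  and \<open>ssol\<close> are polynomials in \<open>J\<close>.\<close>

fun osol :: "bop \<Rightarrow> bop \<Rightarrow> nat \<Rightarrow> bop" where
  "osol x y 0 = x"
| "osol x y (Suc 0) = y"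
| "osol x y (Suc (Suc n)) = (1 / a (1 + int n)) *\<^sub>R
     ((J - b (1 + int n) *\<^sub>R 1) * osol x y (Suc n) - a (int n) *\<^sub>R osol x y n)"

abbreviation "csol \<equiv> osol 1 0"
abbreviation "ssol \<equiv> osol 0 1"

lemma osol_commute:
  assumes "Z * J = J * Z" "Z * x = x * Z" "Z * y = y * Z"
  shows "Z * osol x y n = osol x y n * Z"
  using assms
proof (induction x y n rule: osol.induct)
  case (3 x y n)
  let ?b = "J - b (1 + int n) *\<^sub>R 1"
  have "Z * ?b = ?b * Z" using 3(3) by (simp add: right_diff_distrib left_diff_distrib)
  then have "Z * (?b * osol x y (Suc n)) = ?b * osol x y (Suc n) * Z"
    using 3(1)[OF 3(3-5)] by (metis mult.assoc)
  then show ?case using 3(2)[OF 3(3-5)] by (simp add: right_diff_distrib left_diff_distrib)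
qed auto

end

section \<open>The discriminant of a periodic Jacobi matrix\<close>

context jacobi_op
begin

text \<open>One step of the recurrence costs \<open>1 + 3 * L\<close> for the factor
  \<open>J\<close>, \<open>L\<close> for each of the two coefficients, and a division by at least
  \<open>\<alpha>\<close>. This is the source of the growth of the estimates with the
  period.\<close>

lemma jet_osol:
  assumes a: "\<And>n. \<alpha> \<le> a n" and "0 < \<alpha>" and L: "norm J \<le> L"
    and K: "1 \<le> K" "(1 + 5 * L) / \<alpha> \<le> K"
    and "jet 1 x W P' R R'" "jet 1 y V Q' T T'"
  shows "\<exists>W P' R R'. jet (K ^ n) (osol x y n) W P' R R'"
  using assms(6,7)
proof (induction x y n rule: osol.induct)
  case (1 x y)
  then show ?case by auto
next
  case (2 x y)
  have mono: "jet \<sigma> P W P' R R'" if "jet \<rho> P W P' R R'" "\<rho> \<le> \<sigma>" for \<rho> \<sigma> P W P' R R'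
    using that unfolding jet_def by force
  show ?case using mono[OF 2(2), of "K ^ Suc 0"] K(1) by auto
next
  case (3 x y n)
  let ?b = "b (1 + int n)" and ?a = "a (1 + int n)" and ?c = "a (int n)"
  have mono: "jet \<sigma> P W P' R R'" if "jet \<rho> P W P' R R'" "\<rho> \<le> \<sigma>" for \<rho> \<sigma> P W P' R R'
    using that unfolding jet_def by force
  obtain W1 P1 R1 R1' where 1: "jet (K ^ Suc n) (osol x y (Suc n)) W1 P1 R1 R1'"
    using 3(1)[OF 3(3,4)] by blast
  obtain W0 P0 R0 R0' where 0: "jet (K ^ n) (osol x y n) W0 P0 R0 R0'"
    using 3(2)[OF 3(3,4)] by blast
  let ?X = "osol x y (Suc n)"
  note j = jet_add[OF jet_add[OF jet_J[OF 1 L] 1, of 1 "- ?b"] 0, of "1 / ?a" "- ?c / ?a"]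
  have eq: "osol x y (Suc (Suc n)) = (1 / ?a) *\<^sub>R (1 *\<^sub>R (J * ?X) + (- ?b) *\<^sub>R ?X) + (- ?c / ?a) *\<^sub>R osol x y n"
  proof -
    have "r *\<^sub>R ((J - \<beta> *\<^sub>R 1) * X - \<gamma> *\<^sub>R Y) = r *\<^sub>R (1 *\<^sub>R (J * X) + (- \<beta>) *\<^sub>R X) + (- \<gamma> * r) *\<^sub>R Y"
      for r \<beta> \<gamma> X Y
      by (simp add: left_diff_distrib scaleR_diff_right mult.commute)
    from this[where r = "1 / ?a" and \<beta> = ?b and \<gamma> = ?c] show ?thesis
      by (simp only: osol.simps times_divide_eq_right mult_1_right)
  qed
  have apos: "0 < ?a" using a[of "1 + int n"] \<open>0 < \<alpha>\<close> by linarith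
  have L0: "0 \<le> L" using L norm_ge_zero order_trans by blast
  have K0: "0 \<le> K ^ n" "K ^ n \<le> K ^ Suc n" "0 \<le> K ^ Suc n" using K(1) by (auto intro: power_increasing)
  have "\<bar>1 / ?a\<bar> * (\<bar>1\<bar> * ((1 + 3 * L) * K ^ Suc n) + \<bar>- ?b\<bar> * K ^ Suc n) + \<bar>- ?c / ?a\<bar> * K ^ n
      = (1 / ?a) * ((1 + 3 * L) * K ^ Suc n + \<bar>?b\<bar> * K ^ Suc n + \<bar>?c\<bar> * K ^ n)"
    using apos by (simp add: add_divide_distrib distrib_left)
  \<comment> \<open>Since \<open>1 \<le> K\<close>, the older term with \<open>K ^ n\<close> is
    absorbed into \<open>K ^ Suc n\<close>.\<close>
  also have "\<dots> \<le> (1 / ?a) * ((1 + 3 * L) * K ^ Suc n + L * K ^ Suc n + L * K ^ Suc n)"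
    using K0 apos L L0 abs_b_le[of "1 + int n"] abs_a_le[of "int n"]
    by (intro mult_left_mono add_mono mult_mono order_refl) auto
  also have "\<dots> = (1 + 5 * L) / ?a * K ^ Suc n"
    by (simp add: field_simps del: power_Suc)
  also have "\<dots> \<le> K * K ^ Suc n"
  proof (intro mult_right_mono K0)
    have "(1 + 5 * L) / ?a \<le> (1 + 5 * L) / \<alpha>"
      using a[of "1 + int n"] \<open>0 < \<alpha>\<close> apos L0 by (intro divide_left_mono) auto
    then show "(1 + 5 * L) / ?a \<le> K" using K(2) by simp
  qed
  finally show ?case unfolding eq
    using mono[OF j, of "K ^ Suc (Suc n)"] by (simp only: power_Suc) blast
qed

context
  assumes nz: "\<And>n. a n \<noteq> 0"
begin

text \<open>By \<open>J_delta\<close> the basis vectors satisfy the recurrence that defines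
  \<open>osol\<close>, with \<open>delta 0\<close> and \<open>delta 1\<close> as initial
  data.\<close>

lemma delta_eq_osol: "app (csol n) (delta 0) + app (ssol n) (delta 1) = delta (int n)"
proof (induction n rule: less_induct)
  case (less n)
  consider "n = 0" | "n = 1" | m where "n = Suc (Suc m)"
    by (metis One_nat_def not0_implies_Suc)
  then show ?case
  proof cases
    case 3
    let ?n = "int m + 1"
    have e: "app (csol (Suc m)) (delta 0) + app (ssol (Suc m)) (delta 1) = delta ?n"
        "app (csol m) (delta 0) + app (ssol m) (delta 1) = delta (int m)"
      using less.IH[of "Suc m"] less.IH[of m] 3 by (simp_all add: add.commute)
    have "app (csol n) (delta 0) + app (ssol n) (delta 1) = 
      (1 / a ?n) *\<^sub>R (app J (app (csol (Suc m)) (delta 0) + app (ssol (Suc m)) (delta 1))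
        - b ?n *\<^sub>R (app (csol (Suc m)) (delta 0) + app (ssol (Suc m)) (delta 1))
        - a (int m) *\<^sub>R (app (csol m) (delta 0) + app (ssol m) (delta 1)))"
      by (simp add: 3 algebra_simps)
    also have "\<dots> = delta (int n)"
      unfolding e J_delta using nz[of ?n] by (simp add: 3 algebra_simps)
    finally show ?thesis .
  qed auto
qed

lemma csol_commute: "Z * J = J * Z \<Longrightarrow> Z * csol n = csol n * Z"
  and ssol_commute: "Z * J = J * Z \<Longrightarrow> Z * ssol n = ssol n * Z"
  by (rule osol_commute; simp)+

text \<open>In one step the terms with the factor \<open>J - b (1 + int n) *\<^sub>R 1\<close>
  cancel, because \<open>csol\<close> commutes with \<open>J\<close>.\<close>

lemma wronskian: "a (int n) *\<^sub>R (csol n * ssol (Suc n) - csol (Suc n) * ssol n) = a 0 *\<^sub>R 1"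
proof (induction n)
  case (Suc n)
  let ?a = "a (1 + int n)" and ?B = "J - b (1 + int n) *\<^sub>R 1" and ?c = "csol (Suc n)" and ?s = "ssol (Suc n)"
  have s: "?a *\<^sub>R ssol (Suc (Suc n)) = ?B * ?s - a (int n) *\<^sub>R ssol n"
    and c: "?a *\<^sub>R csol (Suc (Suc n)) = ?B * ?c - a (int n) *\<^sub>R csol n"
    using nz by (simp_all del: scaleR_right_diff_distrib)
  have Jc: "?c * ?B = ?B * ?c"
    using csol_commute[of J "Suc n"] by (simp add: right_diff_distrib left_diff_distrib)
  have "?a *\<^sub>R (?c * ssol (Suc (Suc n)) - csol (Suc (Suc n)) * ?s)
      = ?c * (?a *\<^sub>R ssol (Suc (Suc n))) - (?a *\<^sub>R csol (Suc (Suc n))) * ?s"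
    by (simp only: scaleR_diff_right mult_scaleR_left mult_scaleR_right)
  also have "\<dots> = (?c * ?B) * ?s - a (int n) *\<^sub>R (?c * ssol n) - ((?B * ?c) * ?s - a (int n) *\<^sub>R (csol n * ?s))"
    unfolding s c by (simp only: right_diff_distrib left_diff_distrib mult_scaleR_left mult_scaleR_right mult.assoc)
  also have "\<dots> = a (int n) *\<^sub>R (csol n * ?s - ?c * ssol n)"
    unfolding Jc by (simp only: scaleR_diff_right) simp
  also have "\<dots> = a 0 *\<^sub>R 1" by (rule Suc.IH)
  finally show ?case by (simp only: of_nat_Suc)
qed simp

text \<open>The kernel of \<open>Z\<close> is invariant under \<open>J\<close>. Since
  \<open>a\<close> never vanishes, \<open>J_delta\<close> generates every basis vector from two
  adjacent ones, in both directions.\<close>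

lemma zero_on_delta:
  assumes Z: "Z * J = J * Z" "app Z (delta 0) = 0" "app Z (delta 1) = 0"
  shows "app Z (delta n) = 0"
proof -
  have ZJ: "app Z (app J x) = app J (app Z x)" for x
    using Z(1) by (metis app_simps(6))
  have r: "a (n - 1) *\<^sub>R app Z (delta (n - 1)) + b n *\<^sub>R app Z (delta n) + a n *\<^sub>R app Z (delta (n + 1)) = app J (app Z (delta n))" for n
    using ZJ[of "delta n"] by (simp add: J_delta)
  have "app Z (delta n) = 0 \<and> app Z (delta (n + 1)) = 0"
  proof (induction n rule: int_induct[where k = 0])
    case (step1 i)
    then show ?case using r[of "i + 1"] nz[of "i + 1"] by (simp add: add.assoc)
  next
    case (step2 i)
    then show ?case using r[of i] nz[of "i - 1"] by simp
  qed (use Z in auto)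
  then show ?thesis by simp
qed

end

end

text \<open>The constants \<open>\<alpha>\<close>, \<open>L\<close> and \<open>K\<close> are
  separate from the period so that a whole sequence of approximants can share them; the estimates
  then vary only through \<open>q\<close>.\<close>

locale periodic_op = jacobi_op +
  fixes q :: nat and \<alpha> L K :: real
  assumes q_pos: "0 < q" and a_per: "\<And>n. a (n + int q) = a n" and b_per: "\<And>n. b (n + int q) = b n"
    and \<alpha>_pos: "0 < \<alpha>" and a_ge: "\<And>n. \<alpha> \<le> a n" and J_le: "norm J \<le> L"
    and K1: "1 \<le> K" and K_ge: "(1 + 5 * L) / \<alpha> \<le> K"
begin

lemma a_nz: "a n \<noteq> 0"
  using a_ge[of n] \<alpha>_pos by auto

lemma shift_J: "shift (int q) * J = J * shift (int q)"
  using a_per[of "_ - int q"] a_per[of "_ - int q - 1"] b_per[of "_ - int q"]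
  by (intro bop_eqI ell2_eqI) (simp add: coord_J algebra_simps)

text \<open>The Cayley--Hamilton theorem for the transfer matrix over one period, whose determinant is 1 because
  the Wronskian is constant. The basis vectors themselves solve the recurrence with spectral
  parameter \<open>J\<close>.\<close>

lemma discriminant: "csol q + ssol (Suc q) = shift (int q) + shift (- int q)"
proof -
  let ?T = "shift (int q)" and ?c = "csol q" and ?s = "ssol q" and ?c' = "csol (Suc q)" and ?s' = "ssol (Suc q)"
  let ?D = "?c + ?s'"
  let ?Z = "?D * ?T - ?T * ?T - 1"
  note comm = csol_commute[OF a_nz] ssol_commute[OF a_nz]
  have J: "J * ?c = ?c * J" "J * ?s' = ?s' * J"
    by (rule comm; simp)+
  have w: "?c * ?s' - ?c' * ?s = 1"
  proof -
    have "a (int q) = a 0" using a_per[of 0] by simp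
    then have "a 0 *\<^sub>R (?c * ?s' - ?c' * ?s) = a 0 *\<^sub>R 1" using wronskian[OF a_nz, of q] by simp
    then show ?thesis using a_nz[of 0] by simp
  qed
  have ccs: "?s' * ?c = ?c * ?s'" "?s * ?c' = ?c' * ?s" "?s' * ?s = ?s * ?s'" "?c * ?c' = ?c' * ?c"
    by (rule comm; rule comm(1)[symmetric] comm(2)[symmetric]; simp)+
  have u: "app ?T (delta 0) = app ?c (delta 0) + app ?s (delta 1)"
    "app ?T (delta 1) = app ?c' (delta 0) + app ?s' (delta 1)"
    using delta_eq_osol[OF a_nz, of q] delta_eq_osol[OF a_nz, of "Suc q"] by (simp_all add: add.commute)
  \<comment> \<open>Translation by a period commutes with \<open>J\<close>, hence with
    \<open>csol\<close> and \<open>ssol\<close>, and may be applied to both relations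
    \<open>u\<close>.\<close>
  have TT: "app ?T (app ?T (delta 0)) = app ?c (app ?T (delta 0)) + app ?s (app ?T (delta 1))"
    "app ?T (app ?T (delta 1)) = app ?c' (app ?T (delta 0)) + app ?s' (app ?T (delta 1))"
  proof -
    have "app ?T (app ?T (delta 0)) = app (?T * ?c) (delta 0) + app (?T * ?s) (delta 1)"
      by (subst u) simp
    then show "app ?T (app ?T (delta 0)) = app ?c (app ?T (delta 0)) + app ?s (app ?T (delta 1))"
      unfolding comm(1)[OF shift_J] comm(2)[OF shift_J] by simp
    have "app ?T (app ?T (delta 1)) = app (?T * ?c') (delta 0) + app (?T * ?s') (delta 1)"
      by (subst u) simp
    then show "app ?T (app ?T (delta 1)) = app ?c' (app ?T (delta 0)) + app ?s' (app ?T (delta 1))"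
      unfolding comm(1)[OF shift_J] comm(2)[OF shift_J] by simp
  qed
  have "app ?Z (delta 0) = app ?s' (app ?T (delta 0)) - app ?s (app ?T (delta 1)) - delta 0"
    unfolding app_simps TT by simp
  also have "\<dots> = app (?s' * ?c - ?s * ?c' - 1) (delta 0) + app (?s' * ?s - ?s * ?s') (delta 1)"
    unfolding u by simp
  also have "\<dots> = 0" unfolding ccs w by simp
  finally have 0: "app ?Z (delta 0) = 0" .
  have "app ?Z (delta 1) = app ?c (app ?T (delta 1)) - app ?c' (app ?T (delta 0)) - delta 1"
    unfolding app_simps TT by simp
  also have "\<dots> = app (?c * ?c' - ?c' * ?c) (delta 0) + app (?c * ?s' - ?c' * ?s - 1) (delta 1)"
    unfolding u by simp
  also have "\<dots> = 0" unfolding ccs w by simp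
  finally have 1: "app ?Z (delta 1) = 0" .
  have DJ: "?D * J = J * ?D" using J by (simp add: distrib_left distrib_right)
  have "?D * ?T * J = J * (?D * ?T)" by (metis DJ shift_J mult.assoc)
  moreover have "?T * ?T * J = J * (?T * ?T)" by (metis shift_J mult.assoc)
  ultimately have "?Z * J = J * ?Z" by (simp add: left_diff_distrib right_diff_distrib)
  from zero_on_delta[OF a_nz this 0 1] have Z0: "app ?Z (delta n) = 0" for n .
  have cl: "clinear_op (csol n)" "clinear_op (ssol n)" for n
    using comm[of iop n] clinear_J by (auto simp: clinear_op_def)
  have "?Z = 0"
    by (rule bop_eq_on_delta) (use Z0 in \<open>auto intro!: clinear_op_intros cl\<close>)
  moreover have "?D * ?T = ?Z + (?T * ?T + 1)" by (simp add: algebra_simps)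
  ultimately have "?D * ?T = ?T * ?T + 1" by simp
  \<comment> \<open>Multiplication by the inverse translation solves the quadratic relation for the
    discriminant.\<close>
  then have "?D * (?T * shift (- int q)) = ?T * (?T * shift (- int q)) + shift (- int q)"
    by (metis distrib_right mult.assoc mult_1_left)
  then show ?thesis by (simp add: shift_add)
qed

definition D :: bop where
  "D = iop * (real q *\<^sub>R (shift (- int q) - shift (int q)))"

lemma clinear_D: "clinear_op D"
  unfolding D_def by (intro clinear_op_intros)

lemma shift_minus_J: "shift (- int q) * J = J * shift (- int q)"
proof -
  have "shift (- int q) * (shift (int q) * J) * shift (- int q) = shift (- int q) * (J * shift (int q)) * shift (- int q)"
    by (simp only: shift_J)
  moreover have "shift (- int q) * (shift (int q) * J) * shift (- int q) = J * shift (- int q)"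
    by (simp add: mult.assoc[symmetric] shift_add)
  moreover have "shift (- int q) * (J * shift (int q)) * shift (- int q) = shift (- int q) * J"
    by (simp add: mult.assoc shift_add)
  ultimately show ?thesis by simp
qed

lemma D_J: "D * J = J * D"
proof -
  have "D * J = iop * (real q *\<^sub>R (J * (shift (- int q) - shift (int q))))"
    by (simp add: D_def mult.assoc left_diff_distrib right_diff_distrib shift_J shift_minus_J)
  also have "\<dots> = J * D"
    by (simp add: D_def mult.assoc[symmetric] iop_J)
  finally show ?thesis .
qed

text \<open>\<open>B\<close> is the derivative of the discriminant evaluated at \<open>J\<close>. As
  \<open>D\<close> commutes with \<open>J\<close>, it is its own average; averaging both expressions
  of \<open>D\<close> through \<open>B\<close> and \<open>A\<close> leaves only averaged
  commutators.\<close>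

lemma mean_velocity:
  "\<exists>B. norm B \<le> 2 * K ^ Suc q \<and> (\<forall>t>0. norm (D - B * avg J t A) \<le> 4 * K ^ Suc q / t \<and>
    norm (D - avg J t A * B) \<le> 4 * K ^ Suc q / t)"
proof -
  \<comment> \<open>The zero jet with bound 1 is one of the two initial values of
    \<open>csol\<close> and \<open>ssol\<close>.\<close>
  have "jet 1 0 0 0 0 0" using jet_0 unfolding jet_def by simp
  note j = jet_osol[OF a_ge \<alpha>_pos J_le K1 K_ge jet_1 this, of q]
    jet_osol[OF a_ge \<alpha>_pos J_le K1 K_ge this jet_1, of "Suc q"]
  obtain W1 P1 R1 R1' W2 P2 R2 R2' where "jet (K ^ q) (csol q) W1 P1 R1 R1'" "jet (K ^ Suc q) (ssol (Suc q)) W2 P2 R2 R2'"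
    using j by blast
  from jet_add[OF this, of 1 1] obtain W B R R' where
    j: "jet (K ^ q + K ^ Suc q) (csol q + ssol (Suc q)) W B R R'" by auto
  have Kq: "K ^ q + K ^ Suc q \<le> 2 * K ^ Suc q" using power_increasing[of q "Suc q" K] K1 by simp
  \<comment> \<open>By \<open>discriminant\<close> the polynomial moves a basis vector by
    \<open>q\<close> in either direction, where the factor \<open>n - m\<close> is
    \<open>- q\<close> or \<open>q\<close>.\<close>
  have W: "W = D"
  proof (rule bop_eq_on_delta)
    fix n
    have "coord (app W (delta n)) m = \<i> * of_int (n - m) * coord (app (shift (int q) + shift (- int q)) (delta n)) m" for m
      using j unfolding jet_def discriminant by blast
    then show "app W (delta n) = app D (delta n)"
      by (intro ell2_eqI) (auto simp: D_def coord_delta scaleR_conv_of_real[where 'a = complex])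
  qed (use j clinear_D in \<open>auto simp: jet_def\<close>)
  have B: "B * J = J * B" "clinear_op B" and R: "clinear_op R" "clinear_op R'"
    and eq: "D = B * A + (J * R - R * J)" and eq': "D = A * B + (J * R' - R' * J)"
    and n: "norm B \<le> 2 * K ^ Suc q" "norm R \<le> 2 * K ^ Suc q" "norm R' \<le> 2 * K ^ Suc q"
    using j Kq unfolding W jet_def by auto
  show ?thesis
  proof (intro exI[of _ B] conjI n(1) allI impI)
    fix t :: real assume t: "0 < t"
    have "D = B * avg J t A + avg J t (J * R - R * J)"
      using avg_fixed[OF t D_J clinear_D] unfolding avg_mult_left[OF B, symmetric] avg_add[symmetric] eq[symmetric] ..
    then have "norm (D - B * avg J t A) = norm (avg J t (J * R - R * J))" by (simp add: algebra_simps)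
    also have "\<dots> \<le> 2 * norm R / t" by (rule norm_avg_commutator[OF t R(1)])
    also have "\<dots> \<le> 4 * K ^ Suc q / t" using n t by (intro divide_right_mono) auto
    finally show "norm (D - B * avg J t A) \<le> 4 * K ^ Suc q / t" .
    have "D = avg J t A * B + avg J t (J * R' - R' * J)"
      using avg_fixed[OF t D_J clinear_D] unfolding avg_mult_right[OF B, symmetric] avg_add[symmetric] eq'[symmetric] ..
    then have "norm (D - avg J t A * B) = norm (avg J t (J * R' - R' * J))" by (simp add: algebra_simps)
    also have "\<dots> \<le> 2 * norm R' / t" by (rule norm_avg_commutator[OF t R(2)])
    also have "\<dots> \<le> 4 * K ^ Suc q / t" using n t by (intro divide_right_mono) auto
    finally show "norm (D - avg J t A * B) \<le> 4 * K ^ Suc q / t" .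
  qed
qed

end

section \<open>Convergence of mean velocities in the periodic case\<close>

definition l1_norm :: "ell2 \<Rightarrow> real" where
  "l1_norm \<phi> = (\<Sum>\<^sub>\<infinity>n. cmod (coord \<phi> n))"

lemma sum_le_l1_norm:
  assumes "\<phi> \<in> ell1" "finite F"
  shows "(\<Sum>n\<in>F. cmod (coord \<phi> n)) \<le> l1_norm \<phi>"
  unfolding l1_norm_def using assms by (intro finite_sum_le_infsum) (auto simp: ell1_def)

lemma l1_norm_nonneg: "0 \<le> l1_norm \<phi>"
  unfolding l1_norm_def by (rule infsum_nonneg) simp

lemma ell2_norm_le:
  assumes "0 \<le> C" "\<And>F. finite F \<Longrightarrow> (\<Sum>n\<in>F. (cmod (coord x n))\<^sup>2) \<le> C\<^sup>2"
  shows "norm x \<le> C"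
proof (rule power2_le_imp_le[OF _ assms(1)])
  show "(norm x)\<^sup>2 \<le> C\<^sup>2"
    unfolding norm_ell2_sq by (rule infsum_le_finite_sums[OF summable_coord assms(2)])
qed

definition shift_mean :: "int \<Rightarrow> nat \<Rightarrow> ell2 \<Rightarrow> ell2" where
  "shift_mean m N \<phi> = (1 / real N) *\<^sub>R (\<Sum>k<N. app (shift (int k * m)) \<phi>)"

text \<open>The shifted copies overlap little: interpolate between the \<open>\<ell>\<^sup>1\<close> and the \<open>\<ell>\<^sup>\<infinity>\<close> norm
  of the mean.\<close>

lemma norm_shift_mean_le:
  assumes \<phi>: "\<phi> \<in> ell1" and "m \<noteq> 0" and N: "0 < N"
  shows "norm (shift_mean m N \<phi>) \<le> l1_norm \<phi> / sqrt N"
proof (rule ell2_norm_le)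
  show "0 \<le> l1_norm \<phi> / sqrt N" by (simp add: l1_norm_nonneg)
  fix F :: "int set" assume F: "finite F"
  let ?l = "l1_norm \<phi>" and ?v = "\<lambda>n. cmod (coord (shift_mean m N \<phi>) n)"
  let ?s = "\<lambda>n. \<Sum>k<N. cmod (coord \<phi> (n - int k * m))"
  have v: "?v n \<le> ?s n / N" for n
    using norm_sum[of "\<lambda>k. coord \<phi> (n - int k * m)" "{..<N}"] N
    by (simp add: shift_mean_def coord_sum divide_right_mono)
  have sup: "?s n \<le> ?l" for n
  proof -
    have "inj_on (\<lambda>k. n - int k * m) {..<N}" using \<open>m \<noteq> 0\<close> by (auto simp: inj_on_def)
    then have "?s n = (\<Sum>j\<in>(\<lambda>k. n - int k * m) ` {..<N}. cmod (coord \<phi> j))"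
      by (simp add: sum.reindex)
    also have "\<dots> \<le> ?l" by (rule sum_le_l1_norm[OF \<phi>]) simp
    finally show ?thesis .
  qed
  have "(\<Sum>n\<in>F. ?s n) = (\<Sum>k<N. \<Sum>n\<in>F. cmod (coord \<phi> (n - int k * m)))"
    by (rule sum.swap)
  also have "\<dots> \<le> (\<Sum>k<N. ?l)"
  proof (rule sum_mono)
    fix k
    have "(\<Sum>n\<in>F. cmod (coord \<phi> (n - int k * m))) = (\<Sum>j\<in>(\<lambda>n. n - int k * m) ` F. cmod (coord \<phi> j))"
      by (subst sum.reindex) (auto simp: inj_on_def)
    also have "\<dots> \<le> ?l" using F by (intro sum_le_l1_norm[OF \<phi>]) simp
    finally show "(\<Sum>n\<in>F. cmod (coord \<phi> (n - int k * m))) \<le> ?l" .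
  qed
  finally have tot: "(\<Sum>n\<in>F. ?s n) \<le> N * ?l" by simp
  have "(\<Sum>n\<in>F. (?v n)\<^sup>2) \<le> (\<Sum>n\<in>F. (?l / N) * (?s n / N))"
    unfolding power2_eq_square
    using v sup N by (intro sum_mono mult_mono order_trans[OF v] divide_right_mono) (auto simp: l1_norm_nonneg)
  also have "\<dots> = (?l / N) * ((\<Sum>n\<in>F. ?s n) / N)"
    by (simp add: sum_distrib_left[symmetric] sum_divide_distrib[symmetric])
  also have "\<dots> \<le> (?l / N) * (N * ?l / N)"
    using tot N by (intro mult_left_mono divide_right_mono) (auto simp: l1_norm_nonneg)
  also have "\<dots> = (?l / sqrt N)\<^sup>2"
    using N by (simp add: power2_eq_square power_divide)
  finally show "(\<Sum>n\<in>F. (?v n)\<^sup>2) \<le> (?l / sqrt N)\<^sup>2" .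
qed

text \<open>Telescoping writes the difference to the k-th translate as the image under
  \<open>1 - shift m\<close> of a sum of \<open>k\<close> translates, of norm at most
  \<open>k * norm \<phi>\<close>. Averaging over \<open>k < N\<close> keeps the bound.\<close>

lemma shift_mean_coboundary:
  assumes N: "0 < N"
  obtains w where "\<phi> - shift_mean m N \<phi> = app (1 - shift m) w" "norm w \<le> N * norm \<phi>"
proof -
  have "\<exists>w. \<phi> - app (shift (int k * m)) \<phi> = app (1 - shift m) w \<and> norm w \<le> k * norm \<phi>" for k
  proof (induction k)
    case 0
    show ?case by (rule exI[of _ 0]) simp
  next
    case (Suc k)
    then obtain w where w: "\<phi> - app (shift (int k * m)) \<phi> = app (1 - shift m) w" "norm w \<le> k * norm \<phi>"
      by blast
    have "shift (int (Suc k) * m) = shift m * shift (int k * m)"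
      by (simp add: shift_add distrib_right)
    then have "\<phi> - app (shift (int (Suc k) * m)) \<phi> = app (1 - shift m) (w + app (shift (int k * m)) \<phi>)"
      using w(1) by (simp add: algebra_simps)
    moreover have "norm (w + app (shift (int k * m)) \<phi>) \<le> Suc k * norm \<phi>"
      using norm_triangle_ineq[of w "app (shift (int k * m)) \<phi>"] w(2) by (simp add: algebra_simps)
    ultimately show ?case by blast
  qed
  then obtain w :: "nat \<Rightarrow> ell2" where w: "\<And>k. \<phi> - app (shift (int k * m)) \<phi> = app (1 - shift m) (w k)" "\<And>k. norm (w k) \<le> k * norm \<phi>"
    by metis
  show ?thesis
  proof (rule that[of "(1 / N) *\<^sub>R (\<Sum>k<N. w k)"])
    have "\<phi> - shift_mean m N \<phi> = (1 / N) *\<^sub>R (\<Sum>k<N. \<phi> - app (shift (int k * m)) \<phi>)"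
      using N by (simp add: shift_mean_def sum_subtractf scaleR_diff_right sum_constant_scaleR)
    also have "\<dots> = (1 / N) *\<^sub>R (\<Sum>k<N. app (1 - shift m) (w k))" by (simp only: w)
    also have "\<dots> = app (1 - shift m) ((1 / N) *\<^sub>R (\<Sum>k<N. w k))"
      using bounded_linear.linear[OF bounded_linear_app] by (metis app_simps(12) linear_sum)
    finally show "\<phi> - shift_mean m N \<phi> = app (1 - shift m) ((1 / N) *\<^sub>R (\<Sum>k<N. w k))" .
    have "norm (\<Sum>k<N. w k) \<le> (\<Sum>k<N. N * norm \<phi>)"
      by (rule order_trans[OF norm_sum]) (intro sum_mono order_trans[OF w(2)] mult_right_mono, auto)
    then show "norm ((1 / N) *\<^sub>R (\<Sum>k<N. w k)) \<le> N * norm \<phi>"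
      using N by (simp add: field_simps)
  qed
qed

context periodic_op
begin

text \<open>With S the unit shift, S^(-q) - S^q = S^(-q) (1 - S^(2q)). Hence coboundaries for the
  step \<open>2 * q\<close> lie in the range of \<open>D\<close>, which dictates the step of the
  means below.\<close>

lemma one_minus_shift: "1 - shift (2 * int q) = D * (- (1 / real q) *\<^sub>R (iop * shift (int q)))"
  using q_pos
  by (intro bop_eqI ell2_eqI) (simp add: D_def scaleR_conv_of_real[where 'a = complex] right_diff_distrib)

lemma norm_avg_A: "0 < t \<Longrightarrow> norm (avg J t A) \<le> 2 * L"
  using norm_avg[of t A] norm_A_le J_le by linarith

lemma L_nonneg: "0 \<le> L"
  using J_le norm_ge_zero order_trans by blast

text \<open>Inserting \<open>B\<close> between the averages at times \<open>r\<close> and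
  \<open>s\<close> compares M_r D with D M_s, up to a multiple of 1/s. Taking r = t and r = s
  eliminates D M_s, so no lower bound on \<open>B\<close> enters.\<close>

lemma avg_diff_on_D:
  assumes "0 < s" "s \<le> t"
  shows "norm ((avg J t A - avg J s A) * D) \<le> 32 * L * K ^ Suc q / s"
proof -
  let ?M = "\<lambda>t. avg J t A" and ?c = "4 * K ^ Suc q"
  obtain B where "norm B \<le> 2 * K ^ Suc q" and B: "\<And>t. 0 < t \<Longrightarrow> norm (D - B * ?M t) \<le> ?c / t"
      "\<And>t. 0 < t \<Longrightarrow> norm (D - ?M t * B) \<le> ?c / t"
    using mean_velocity by blast
  have *: "norm (?M r * D - D * ?M s) \<le> 2 * L * (2 * (?c / s))" if r: "s \<le> r" for r
  proof -
    have cr: "?c / r \<le> ?c / s" using r assms K1 by (intro divide_left_mono) auto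
    have "?M r * D - D * ?M s = ?M r * (D - B * ?M s) - (D - ?M r * B) * ?M s"
      by (simp add: algebra_simps)
    also have "norm \<dots> \<le> 2 * L * (?c / s) + ?c / s * (2 * L)"
      using assms r
      by (intro order_trans[OF norm_triangle_ineq4] add_mono norm_mult_mono norm_avg_A
          B(1) order_trans[OF B(2) cr]) auto
    finally show ?thesis by (simp add: algebra_simps)
  qed
  have "(?M t - ?M s) * D = (?M t * D - D * ?M s) - (?M s * D - D * ?M s)" by (simp add: algebra_simps)
  also have "norm \<dots> \<le> 2 * L * (2 * (?c / s)) + 2 * L * (2 * (?c / s))"
    using assms by (intro order_trans[OF norm_triangle_ineq4] add_mono *) auto
  finally show ?thesis by (simp add: algebra_simps)
qed

text \<open>The first term comes from the coboundary part of the vector, the second from the mean of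
  its translates. \<open>N\<close> stays free so that the two can be balanced against
  \<open>s\<close>.\<close>

lemma avg_diff_on_ell1:
  fixes N :: nat
  assumes \<phi>: "\<phi> \<in> ell1" and s: "0 < s" "s \<le> t" and N: "0 < N"
  shows "norm (app (avg J t A - avg J s A) \<phi>) \<le> 32 * L * K ^ Suc q / s * (N * norm \<phi>) + 4 * L * l1_norm \<phi> / sqrt N"
proof -
  let ?M = "avg J t A - avg J s A" and ?m = "2 * int q" and ?E = "- (1 / real q) *\<^sub>R (iop * shift (int q))"
  obtain w where w: "\<phi> - shift_mean ?m N \<phi> = app (1 - shift ?m) w" "norm w \<le> N * norm \<phi>"
    using shift_mean_coboundary[OF N] .
  have eq: "\<phi> = app (1 - shift ?m) w + shift_mean ?m N \<phi>" using w(1) by (simp add: algebra_simps)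
  have E: "norm (app ?E w) \<le> N * norm \<phi>"
  proof -
    have "norm (app ?E w) = norm w / q" by simp
    also have "\<dots> \<le> norm w" using q_pos by (simp add: divide_le_eq mult_le_cancel_left1)
    finally show ?thesis using w(2) by simp
  qed
  have "app ?M \<phi> = app (?M * D) (app ?E w) + app ?M (shift_mean ?m N \<phi>)"
    by (subst eq, unfold one_minus_shift) simp
  also have "norm \<dots> \<le> 32 * L * K ^ Suc q / s * (N * norm \<phi>) + 4 * L * (l1_norm \<phi> / sqrt N)"
  proof (intro order_trans[OF norm_triangle_ineq] add_mono)
    have "0 \<le> 32 * L * K ^ Suc q / s" using L_nonneg K1 s by simp
    then show "norm (app (?M * D) (app ?E w)) \<le> 32 * L * K ^ Suc q / s * (N * norm \<phi>)"
      by (intro order_trans[OF norm_app] mult_mono avg_diff_on_D s E) auto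
    have "norm ?M \<le> 2 * L + 2 * L"
      using s by (intro order_trans[OF norm_triangle_ineq4] add_mono norm_avg_A) auto
    then show "norm (app ?M (shift_mean ?m N \<phi>)) \<le> 4 * L * (l1_norm \<phi> / sqrt N)"
      using q_pos L_nonneg by (intro order_trans[OF norm_app] mult_mono norm_shift_mean_le \<phi> N) auto
  qed
  finally show ?thesis by simp
qed

text \<open>A vector annihilated by \<open>D\<close> is invariant under translation by
  \<open>2 * q\<close>; this is the quantitative form for one coordinate.\<close>

lemma coord_diff_le_D: "cmod (coord \<phi> m - coord \<phi> (m - 2 * int q)) \<le> norm (app D \<phi>)"
proof -
  let ?x = "app (shift (- int q) - shift (int q)) \<phi>"
  have "coord \<phi> m - coord \<phi> (m - 2 * int q) = coord ?x (m - int q)" by simp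
  then have "cmod (coord \<phi> m - coord \<phi> (m - 2 * int q)) \<le> norm ?x" by (simp only: coord_le_norm)
  also have "\<dots> \<le> q * norm ?x" using q_pos by (simp add: mult_le_cancel_right1)
  also have "\<dots> = norm (app D \<phi>)" by (simp only: D_def app_simps(6,7) norm_app_iop norm_scaleR abs_of_nat)
  finally show ?thesis .
qed

end

lemma trunc_in_ell1: "trunc N \<phi> \<in> ell1"
  unfolding ell1_def
proof (intro CollectI)
  have "(\<lambda>n. cmod (coord (trunc N \<phi>) n)) summable_on {-int N..int N}" by simp
  then show "(\<lambda>n. cmod (coord (trunc N \<phi>) n)) summable_on UNIV"
    by (rule summable_on_cong_neutral[THEN iffD1, rotated -1]) (auto simp: coord_trunc)
qed

lemma coord_small:
  assumes "0 < e"
  shows "\<exists>N. \<forall>k. int N < \<bar>k\<bar> \<longrightarrow> cmod (coord \<phi> k) < e"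
proof -
  obtain N where N: "norm (trunc N \<phi> - \<phi>) < e"
    using LIMSEQ_D[OF trunc_tendsto[of \<phi>] assms] by blast
  have "cmod (coord \<phi> k) < e" if "int N < \<bar>k\<bar>" for k
    using coord_le_norm[of "trunc N \<phi> - \<phi>" k] N that by (simp add: coord_trunc)
  then show ?thesis by blast
qed

text \<open>Density argument: truncations lie in \<open>ell1\<close>, and by the uniform bound the
  limits along them form a Cauchy sequence whose limit is the one sought.\<close>

lemma strong_limit_from_ell1:
  fixes T :: "real \<Rightarrow> bop"
  assumes bd: "\<And>t. 0 < t \<Longrightarrow> norm (T t) \<le> c"
    and lim: "\<And>\<phi>. \<phi> \<in> ell1 \<Longrightarrow> \<exists>y. ((\<lambda>t. app (T t) \<phi>) \<longlongrightarrow> y) at_top"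
  shows "\<exists>y. ((\<lambda>t. app (T t) \<phi>) \<longlongrightarrow> y) at_top"
proof -
  have c: "0 \<le> c" using bd[of 1] norm_ge_zero order_trans by (metis zero_less_one)
  have "\<forall>N. \<exists>y. ((\<lambda>t. app (T t) (trunc N \<phi>)) \<longlongrightarrow> y) at_top"
    by (intro allI lim trunc_in_ell1)
  from choice[OF this] obtain y where "\<forall>N. ((\<lambda>t. app (T t) (trunc N \<phi>)) \<longlongrightarrow> y N) at_top" ..
  then have y: "((\<lambda>t. app (T t) (trunc N \<phi>)) \<longlongrightarrow> y N) at_top" for N ..
  have yd: "norm (y N - y M) \<le> c * norm (trunc N \<phi> - trunc M \<phi>)" for N M
  proof (rule tendsto_upperbound)
    show "((\<lambda>t. norm (app (T t) (trunc N \<phi>) - app (T t) (trunc M \<phi>))) \<longlongrightarrow> norm (y N - y M)) at_top"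
      by (intro tendsto_intros y)
    show "\<forall>\<^sub>F t in at_top. norm (app (T t) (trunc N \<phi>) - app (T t) (trunc M \<phi>)) \<le> c * norm (trunc N \<phi> - trunc M \<phi>)"
      using eventually_gt_at_top[of 0]
      by eventually_elim (use norm_app_le[OF bd] in \<open>simp flip: app_simps(10)\<close>)
  qed simp
  have "Cauchy y"
  proof (rule metric_CauchyI)
    fix e :: real assume "0 < e"
    then have e: "0 < e / (c + 1)" using c by simp
    have "Cauchy (\<lambda>N. trunc N \<phi>)" by (rule LIMSEQ_imp_Cauchy[OF trunc_tendsto])
    from metric_CauchyD[OF this e] obtain M where
      M: "\<forall>m\<ge>M. \<forall>n\<ge>M. dist (trunc m \<phi>) (trunc n \<phi>) < e / (c + 1)" ..
    have "dist (y m) (y n) < e" if "m \<ge> M" "n \<ge> M" for m n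
    proof -
      have "dist (y m) (y n) \<le> (c + 1) * dist (trunc m \<phi>) (trunc n \<phi>)"
        using yd[of m n] norm_ge_zero[of "trunc m \<phi> - trunc n \<phi>"] unfolding dist_norm distrib_right by linarith
      also have "\<dots> < e" using M that c by (simp add: pos_less_divide_eq mult.commute)
      finally show ?thesis .
    qed
    then show "\<exists>M. \<forall>m\<ge>M. \<forall>n\<ge>M. dist (y m) (y n) < e" by blast
  qed
  then obtain z where z: "y \<longlonglongrightarrow> z" using Cauchy_convergent convergent_def by blast
  have "((\<lambda>t. app (T t) \<phi>) \<longlongrightarrow> z) at_top"
  proof (rule tendstoI)
    fix e :: real assume e: "0 < e"
    have "(\<lambda>N. c * norm (\<phi> - trunc N \<phi>) + norm (y N - z)) \<longlonglongrightarrow> c * norm (\<phi> - \<phi>) + norm (z - z)"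
      by (intro tendsto_intros trunc_tendsto z)
    then have "\<forall>\<^sub>F N in sequentially. c * norm (\<phi> - trunc N \<phi>) + norm (y N - z) < e / 2"
      using e by (intro order_tendstoD(2)[of _ "c * norm (\<phi> - \<phi>) + norm (z - z)"]) auto
    then obtain N where N: "c * norm (\<phi> - trunc N \<phi>) + norm (y N - z) < e / 2"
      by (auto simp: eventually_sequentially)
    have "\<forall>\<^sub>F t in at_top. dist (app (T t) (trunc N \<phi>)) (y N) < e / 2"
      using y e by (intro tendstoD) auto
    then show "\<forall>\<^sub>F t in at_top. dist (app (T t) \<phi>) z < e"
      using eventually_gt_at_top[of 0]
    proof eventually_elim
      case (elim t)
      have "app (T t) \<phi> - z = app (T t) (\<phi> - trunc N \<phi>) + (app (T t) (trunc N \<phi>) - y N) + (y N - z)"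
        by simp
      also have "norm \<dots> \<le> norm (app (T t) (\<phi> - trunc N \<phi>)) + norm (app (T t) (trunc N \<phi>) - y N) + norm (y N - z)"
        by (rule order_trans[OF norm_triangle_ineq add_right_mono[OF norm_triangle_ineq]])
      also have "norm (app (T t) (\<phi> - trunc N \<phi>)) \<le> c * norm (\<phi> - trunc N \<phi>)"
        by (rule norm_app_le[OF bd[OF elim(2)]])
      finally show ?case using N elim(1) by (simp add: dist_norm)
    qed
  qed
  then show ?thesis by blast
qed

section \<open>Convergence of mean velocities in the limit-periodic case\<close>

text \<open>Approximant \<open>n\<close> serves for times up to \<open>M ^ (4 * p (Suc n))\<close>;
  the exponent 5 in \<open>close\<close> leaves a gain \<open>M ^ p (Suc n)\<close> after
  multiplication by such a time. \<open>M\<close> is an integer so that a power of it can count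
  translates, and \<open>2 * K \<le> M\<close> makes \<open>K ^ p n / M ^ p n\<close> decay.\<close>

locale exp_approx = jacobi_op a b for a b +
  fixes p :: "nat \<Rightarrow> nat" and a' b' :: "nat \<Rightarrow> int \<Rightarrow> real" and \<alpha> L K C M :: real
  assumes J_le: "norm J \<le> L"
    and per: "\<And>n. periodic_op (a' n) (b' n) (p n) \<alpha> L K"
    and p_less: "\<And>n. p n < p (Suc n)"
    and M_nat: "M \<in> \<nat>" and M2: "2 \<le> M" and MK: "2 * K \<le> M" and C0: "0 \<le> C"
    and close: "\<And>n. norm (J - jac (a' n) (b' n)) \<le> C / M ^ (5 * p (Suc n))"
begin

abbreviation "J' n \<equiv> jac (a' n) (b' n)"
abbreviation "A' n \<equiv> cur (a' n)"

text \<open>Start of the window of times treated by approximant \<open>n\<close>. The exponent 4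
  pays for \<open>K ^ p n\<close>, for \<open>M ^ (2 * p n)\<close> translates and for a remaining
  gain of \<open>M ^ p n\<close>.\<close>

definition threshold :: "nat \<Rightarrow> real" where
  "threshold n = M ^ (4 * p n)"

definition mean_vel :: "real \<Rightarrow> bop" where
  "mean_vel t = avg J t A"

lemma per_jacobi: "jacobi_op (a' n) (b' n)"
  using per[of n] unfolding periodic_op_def by blast

lemma per_hamiltonian: "hamiltonian (J' n)"
proof -
  interpret P: jacobi_op "a' n" "b' n" by (rule per_jacobi)
  show ?thesis by unfold_locales
qed

lemma L0: "0 \<le> L"
  using J_le norm_ge_zero order_trans by blast

lemma p_ge: "n \<le> p n"
  by (induction n) (use p_less in \<open>auto intro: Suc_leI le_less_trans\<close>)

lemma threshold_ge1: "1 \<le> threshold n"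
  using M2 by (simp add: threshold_def)

lemma threshold_mono: "threshold n \<le> threshold (Suc n)"
  unfolding threshold_def using M2 p_less[of n] by (intro power_increasing) auto

lemma norm_mean_vel: "0 < t \<Longrightarrow> norm (mean_vel t) \<le> 2 * L"
  using norm_avg[of t A] norm_A_le J_le by (simp add: mean_vel_def)

text \<open>The error grows linearly in time, and \<open>close\<close> beats it up to the next
  threshold. The resulting \<open>M ^ p (Suc n)\<close> is relaxed to \<open>M ^ p n\<close> to
  match the other errors of the window.\<close>

lemma mean_vel_close:
  assumes t: "1 \<le> t" "t \<le> threshold (Suc n)"
  shows "norm (mean_vel t - avg (J' n) t (A' n)) \<le> (2 + 4 * L) * C / M ^ p n"
proof -
  interpret P: periodic_op "a' n" "b' n" "p n" \<alpha> L K by (rule per)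
  let ?d = "norm (J - J' n)"
  have nA: "norm (A' n) \<le> 2 * L" using P.norm_A_le P.J_le by linarith
  have "norm (mean_vel t - avg (J' n) t (A' n)) \<le> norm (A - A' n) + 2 * t * ?d * norm (A' n)"
    unfolding mean_vel_def using t by (intro norm_avg_diff per_hamiltonian) (auto intro: hamiltonian_axioms)
  also have "\<dots> \<le> 2 * ?d + 2 * t * ?d * (2 * L)"
    using t cur_diff_le[OF jacobi_op_axioms per_jacobi] nA by (intro add_mono mult_left_mono) auto
  \<comment> \<open>As \<open>1 \<le> t\<close>, the difference of the velocities is absorbed into
    the terms that grow with time.\<close>
  also have "\<dots> \<le> 2 * (t * ?d) + 2 * t * ?d * (2 * L)"
    using t by (simp add: mult_le_cancel_right1)
  also have "\<dots> = (2 + 4 * L) * (t * ?d)" by (simp add: algebra_simps)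
  also have "\<dots> \<le> (2 + 4 * L) * (threshold (Suc n) * (C / M ^ (5 * p (Suc n))))"
    using t L0 threshold_ge1[of "Suc n"] by (intro mult_left_mono mult_mono close) auto
  also have "threshold (Suc n) * (C / M ^ (5 * p (Suc n))) = C / M ^ p (Suc n)"
  proof -
    have "5 * p (Suc n) = 4 * p (Suc n) + p (Suc n)" by simp
    then have "(M::real) ^ (5 * p (Suc n)) = M ^ (4 * p (Suc n)) * M ^ p (Suc n)" by (simp only: power_add)
    then show ?thesis using M2 by (simp add: threshold_def)
  qed
  also have "(2 + 4 * L) * (C / M ^ p (Suc n)) \<le> (2 + 4 * L) * (C / M ^ p n)"
    using M2 L0 C0 p_less[of n] by (intro mult_left_mono divide_left_mono power_increasing) auto
  finally show ?thesis by simp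
qed

text \<open>The summands come from passing to the approximant at two times, from the range of
  \<open>D\<close>, and from the mean of translates.\<close>

definition window_const :: "ell2 \<Rightarrow> real" where
  "window_const \<phi> = (4 + 8 * L) * C * norm \<phi> + 32 * L * K * norm \<phi> + 4 * L * l1_norm \<phi>"

lemma K1: "1 \<le> K"
  using periodic_op.K1[OF per[of 0]] .

lemma window_const_nonneg: "0 \<le> window_const \<phi>"
  unfolding window_const_def using L0 C0 K1 l1_norm_nonneg by (intro add_nonneg_nonneg mult_nonneg_nonneg) auto

text \<open>Both times are compared with approximant \<open>n\<close>, and
  \<open>avg_diff_on_ell1\<close> is used with \<open>M ^ (2 * p n)\<close> translates: its square
  root gives the gain \<open>M ^ p n\<close>, and the threshold outweighs the number of translates
  together with \<open>K ^ p n\<close>.\<close>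

lemma window:
  assumes \<phi>: "\<phi> \<in> ell1" and s: "threshold n \<le> s" "s \<le> t" "t \<le> threshold (Suc n)"
  shows "norm (app (mean_vel t) \<phi> - app (mean_vel s) \<phi>) \<le> window_const \<phi> / M ^ p n"
proof -
  interpret P: periodic_op "a' n" "b' n" "p n" \<alpha> L K by (rule per)
  obtain m :: nat where m: "M = m" using M_nat by (auto elim: Nats_cases)
  then have m0: "0 < m" using M2 by simp
  let ?P = "\<lambda>t. avg (J' n) t (A' n)" and ?e = "(2 + 4 * L) * C / M ^ p n"
  have s1: "1 \<le> s" "0 < s" using s threshold_ge1[of n] by linarith+
  have N0: "0 < m ^ (2 * p n)" using m0 by simp
  have mM: "real (m ^ (2 * p n)) = M ^ (2 * p n)" by (simp add: m)
  have sq: "sqrt (M ^ (2 * p n)) = M ^ p n"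
    by (rule real_sqrt_unique) (use M2 in \<open>simp_all add: power_mult[symmetric] mult.commute\<close>)
  have per_le: "norm (app (?P t - ?P s) \<phi>) \<le> 32 * L * K ^ Suc (p n) / s * (M ^ (2 * p n) * norm \<phi>)
      + 4 * L * l1_norm \<phi> / M ^ p n"
    by (rule P.avg_diff_on_ell1[OF \<phi> s1(2) s(2) N0, unfolded mM sq])
  have "K ^ p n * M ^ (2 * p n) / s \<le> M ^ p n * M ^ (2 * p n) / threshold n"
    using s s1 threshold_ge1[of n] K1 MK by (intro frac_le mult_right_mono power_mono mult_nonneg_nonneg) auto
  also have "\<dots> = 1 / M ^ p n"
  proof -
    have "4 * p n = p n + 2 * p n + p n" by simp
    then have "threshold n = M ^ p n * M ^ (2 * p n) * M ^ p n" unfolding threshold_def by (simp only: power_add)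
    then show ?thesis using M2 by simp
  qed
  finally have "(32 * L * K * norm \<phi>) * (K ^ p n * M ^ (2 * p n) / s) \<le> (32 * L * K * norm \<phi>) * (1 / M ^ p n)"
    using L0 K1 by (intro mult_left_mono) auto
  then have first: "32 * L * K ^ Suc (p n) / s * (M ^ (2 * p n) * norm \<phi>) \<le> 32 * L * K * norm \<phi> / M ^ p n"
    by (simp add: mult_ac)
  have "app (mean_vel t) \<phi> - app (mean_vel s) \<phi> = app (mean_vel t - ?P t) \<phi> - app (mean_vel s - ?P s) \<phi> + app (?P t - ?P s) \<phi>"
    by simp
  then have "norm (app (mean_vel t) \<phi> - app (mean_vel s) \<phi>) =
      norm (app (mean_vel t - ?P t) \<phi> - app (mean_vel s - ?P s) \<phi> + app (?P t - ?P s) \<phi>)"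
    by (rule arg_cong)
  also have "\<dots> \<le> (?e * norm \<phi> + ?e * norm \<phi>) + norm (app (?P t - ?P s) \<phi>)"
  proof (rule order_trans[OF norm_triangle_ineq add_right_mono])
    have "norm (app (mean_vel r - ?P r) \<phi>) \<le> ?e * norm \<phi>" if "s \<le> r" "r \<le> t" for r
      using s s1 that by (intro norm_app_le mean_vel_close) auto
    then show "norm (app (mean_vel t - ?P t) \<phi> - app (mean_vel s - ?P s) \<phi>) \<le> ?e * norm \<phi> + ?e * norm \<phi>"
      using s by (intro order_trans[OF norm_triangle_ineq4 add_mono]) auto
  qed
  also have "\<dots> \<le> ?e * norm \<phi> + ?e * norm \<phi> + (32 * L * K * norm \<phi> / M ^ p n + 4 * L * l1_norm \<phi> / M ^ p n)"
    by (rule add_left_mono[OF order_trans[OF per_le add_right_mono[OF first]]])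
  also have "\<dots> = window_const \<phi> / M ^ p n"
  proof -
    have "window_const \<phi> = (2 + 4 * L) * C * norm \<phi> + (2 + 4 * L) * C * norm \<phi> + (32 * L * K * norm \<phi> + 4 * L * l1_norm \<phi>)"
      by (simp add: window_const_def algebra_simps)
    then show ?thesis by (simp only: add_divide_distrib times_divide_eq_left)
  qed
  finally show ?thesis .
qed

text \<open>The periods increase strictly and \<open>2 \<le> M\<close>, so the window errors at
  least halve at each threshold; the geometric sum gives the factor 2. The induction is on the
  number \<open>d\<close> of windows.\<close>

lemma tail_aux:
  assumes \<phi>: "\<phi> \<in> ell1" and "threshold n \<le> t" "t \<le> threshold (n + d)"
  shows "norm (app (mean_vel t) \<phi> - app (mean_vel (threshold n)) \<phi>) \<le> 2 * window_const \<phi> / M ^ p n"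
  using assms(2,3)
proof (induction d arbitrary: n)
  case 0
  then have "t = threshold n" by simp
  then show ?case using window_const_nonneg[of \<phi>] M2 by simp
next
  case (Suc d)
  have half: "window_const \<phi> / M ^ p n \<le> 2 * window_const \<phi> / M ^ p n"
    using window_const_nonneg[of \<phi>] M2 by (intro divide_right_mono) auto
  show ?case
  proof (cases "t \<le> threshold (Suc n)")
    case True
    then show ?thesis using window[OF \<phi>, of n "threshold n" t] Suc.prems half by simp
  next
    case False
    have "norm (app (mean_vel t) \<phi> - app (mean_vel (threshold (Suc n))) \<phi>) \<le> 2 * window_const \<phi> / M ^ p (Suc n)"
      using False Suc.prems by (intro Suc.IH) auto
    also have "\<dots> \<le> window_const \<phi> / M ^ p n"
    proof -
      have "2 * M ^ p n \<le> M ^ Suc (p n)" using M2 by simp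
      also have "\<dots> \<le> M ^ p (Suc n)" using M2 p_less[of n] by (intro power_increasing) auto
      finally have "2 * window_const \<phi> / M ^ p (Suc n) \<le> 2 * window_const \<phi> / (2 * M ^ p n)"
        using M2 window_const_nonneg by (intro divide_left_mono) auto
      then show ?thesis by simp
    qed
    finally have 1: "norm (app (mean_vel t) \<phi> - app (mean_vel (threshold (Suc n))) \<phi>) \<le> window_const \<phi> / M ^ p n" .
    have "norm (app (mean_vel (threshold (Suc n))) \<phi> - app (mean_vel (threshold n)) \<phi>) \<le> window_const \<phi> / M ^ p n"
      using threshold_mono[of n] by (intro window \<phi>) auto
    from norm_diff_triangle_le[OF 1 this] show ?thesis by simp
  qed
qed

lemma M_pow_tendsto: "(\<lambda>n. c / M ^ p n) \<longlonglongrightarrow> 0"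
proof (rule Lim_null_comparison)
  show "\<forall>\<^sub>F n in sequentially. norm (c / M ^ p n) \<le> \<bar>c\<bar> * (1 / 2) ^ n"
  proof (rule always_eventually, rule allI)
    fix n
    have "(2::real) ^ n \<le> 2 ^ p n" using p_ge by (intro power_increasing) auto
    also have "\<dots> \<le> M ^ p n" using M2 by (intro power_mono) auto
    finally have "\<bar>c\<bar> / M ^ p n \<le> \<bar>c\<bar> / 2 ^ n" using M2 by (intro divide_left_mono) auto
    moreover have "norm (c / M ^ p n) = \<bar>c\<bar> / M ^ p n" using M2 by simp
    moreover have "\<bar>c\<bar> * (1 / 2) ^ n = \<bar>c\<bar> / 2 ^ n" by (simp only: power_one_over times_divide_eq_right mult_1_right)
    ultimately show "norm (c / M ^ p n) \<le> \<bar>c\<bar> * (1 / 2) ^ n" by (simp only:)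
  qed
  show "(\<lambda>n. \<bar>c\<bar> * (1 / 2) ^ n) \<longlonglongrightarrow> 0"
    by (intro tendsto_mult_right_zero LIMSEQ_power_zero) simp
qed

lemma tail:
  assumes \<phi>: "\<phi> \<in> ell1" and "threshold n \<le> t"
  shows "norm (app (mean_vel t) \<phi> - app (mean_vel (threshold n)) \<phi>) \<le> 2 * window_const \<phi> / M ^ p n"
proof -
  obtain d where d: "t < M ^ d" using real_arch_pow[of "M" t] M2 by auto
  have "M ^ d \<le> threshold (n + d)"
    unfolding threshold_def using M2 p_ge[of "n + d"] by (intro power_increasing) auto
  then show ?thesis using d assms by (intro tail_aux[where d = d]) auto
qed

text \<open>The rate at the thresholds is recorded with the limit because the kernel argument
  depends on it.\<close>

lemma limit_ell1:
  assumes \<phi>: "\<phi> \<in> ell1"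
  shows "\<exists>y. ((\<lambda>t. app (mean_vel t) \<phi>) \<longlongrightarrow> y) at_top \<and> (\<forall>n. norm (y - app (mean_vel (threshold n)) \<phi>) \<le> 2 * window_const \<phi> / M ^ p n)"
proof -
  let ?G = "\<lambda>n. app (mean_vel (threshold n)) \<phi>"
  have mono: "threshold n \<le> threshold m" if "n \<le> m" for n m using that threshold_mono by (rule lift_Suc_mono_le[rotated])
  have "Cauchy ?G"
  proof (rule metric_CauchyI)
    fix e :: real assume "0 < e"
    then obtain n where n: "2 * window_const \<phi> / M ^ p n < e / 2"
      using order_tendstoD(2)[OF M_pow_tendsto[of "2 * window_const \<phi>"], of "e / 2"] by (auto simp: eventually_sequentially)
    have "dist (?G k) (?G m) < e" if "k \<ge> n" "m \<ge> n" for k m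
      using dist_triangle_half_l[of "?G k" "?G n" e "?G m"] tail[OF \<phi> mono[OF that(1)]] tail[OF \<phi> mono[OF that(2)]] n
      by (simp add: dist_norm)
    then show "\<exists>M. \<forall>m\<ge>M. \<forall>n\<ge>M. dist (?G m) (?G n) < e" by blast
  qed
  then obtain y where y: "?G \<longlonglongrightarrow> y" using Cauchy_convergent convergent_def by blast
  have b: "norm (y - ?G n) \<le> 2 * window_const \<phi> / M ^ p n" for n
  proof (rule tendsto_upperbound)
    show "(\<lambda>m. norm (?G m - ?G n)) \<longlonglongrightarrow> norm (y - ?G n)" by (intro tendsto_intros y)
    show "\<forall>\<^sub>F m in sequentially. norm (?G m - ?G n) \<le> 2 * window_const \<phi> / M ^ p n"
      using eventually_ge_at_top[of n] by eventually_elim (intro tail \<phi> mono)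
  qed simp
  have "((\<lambda>t. app (mean_vel t) \<phi>) \<longlongrightarrow> y) at_top"
  proof (rule tendstoI)
    fix e :: real assume "0 < e"
    then obtain n where n: "2 * window_const \<phi> / M ^ p n < e / 2"
      using order_tendstoD(2)[OF M_pow_tendsto[of "2 * window_const \<phi>"], of "e / 2"] by (auto simp: eventually_sequentially)
    show "\<forall>\<^sub>F t in at_top. dist (app (mean_vel t) \<phi>) y < e"
      using eventually_ge_at_top[of "threshold n"]
    proof eventually_elim
      case (elim t)
      show ?case
        using dist_triangle_half_l[of "app (mean_vel t) \<phi>" "?G n" e y] tail[OF \<phi> elim] b[of n] n
        by (simp add: dist_norm norm_minus_commute)
    qed
  qed
  with b show ?thesis by blast
qed

text \<open>For a zero limit the rate bounds the mean velocity at the thresholds themselves.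
  Applying \<open>B\<close> loses only a multiple of \<open>K ^ p n\<close>, so the images under the
  operators \<open>D\<close> tend to 0. The vector then nearly agrees with its translate by
  \<open>2 * p n\<close>, whose value at a fixed site tends to 0.\<close>

lemma limit_nonzero:
  assumes \<phi>: "\<phi> \<in> ell1" and lim: "((\<lambda>t. app (mean_vel t) \<phi>) \<longlongrightarrow> 0) at_top"
  shows "\<phi> = 0"
proof -
  from limit_ell1[OF \<phi>] obtain y where
    y: "((\<lambda>t. app (mean_vel t) \<phi>) \<longlongrightarrow> y) at_top \<and> (\<forall>n. norm (y - app (mean_vel (threshold n)) \<phi>) \<le> 2 * window_const \<phi> / M ^ p n)" ..
  have "y = 0" by (rule tendsto_unique[OF trivial_limit_at_top_linorder conjunct1[OF y] lim])
  then have small: "norm (app (mean_vel (threshold n)) \<phi>) \<le> 2 * window_const \<phi> / M ^ p n" for n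
    using conjunct2[OF y] by simp
  \<comment> \<open>First the error of \<open>mean_velocity\<close> at the threshold, then
    \<open>norm B\<close> times the bound on the periodic average; the factors \<open>K\<close> come
    from the exponent \<open>Suc (p n)\<close>.\<close>
  define c where "c = 4 * K * norm \<phi> + 2 * K * (2 * window_const \<phi> + (2 + 4 * L) * C * norm \<phi>)"
  have D: "norm (app (periodic_op.D (p n)) \<phi>) \<le> c * (1 / 2) ^ n" for n
  proof -
    interpret P: periodic_op "a' n" "b' n" "p n" \<alpha> L K by (rule per)
    let ?P = "avg (J' n) (threshold n) (A' n)" and ?m = "M ^ p n"
    have m: "1 \<le> ?m" using M2 by simp
    have t0: "0 < threshold n" using threshold_ge1[of n] by simp
    from P.mean_velocity obtain B where B: "norm B \<le> 2 * K ^ Suc (p n) \<and>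
        (\<forall>t>0. norm (P.D - B * avg (J' n) t (A' n)) \<le> 4 * K ^ Suc (p n) / t \<and>
          norm (P.D - avg (J' n) t (A' n) * B) \<le> 4 * K ^ Suc (p n) / t)" ..
    then have B: "norm B \<le> 2 * K ^ Suc (p n)" "norm (P.D - B * ?P) \<le> 4 * K ^ Suc (p n) / threshold n"
      using t0 by blast+
    have "norm (app ?P \<phi>) \<le> norm (app (mean_vel (threshold n)) \<phi>) + norm (app (mean_vel (threshold n) - ?P) \<phi>)"
      using norm_triangle_ineq4[of "app (mean_vel (threshold n)) \<phi>" "app (mean_vel (threshold n) - ?P) \<phi>"] by simp
    also have "\<dots> \<le> 2 * window_const \<phi> / ?m + (2 + 4 * L) * C / ?m * norm \<phi>"
      using threshold_ge1[of n] threshold_mono[of n] by (intro add_mono small norm_app_le mean_vel_close) auto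
    also have "\<dots> = (2 * window_const \<phi> + (2 + 4 * L) * C * norm \<phi>) / ?m" by (simp add: add_divide_distrib)
    finally have P: "norm (app ?P \<phi>) \<le> (2 * window_const \<phi> + (2 + 4 * L) * C * norm \<phi>) / ?m" .
    have P0: "0 \<le> (2 * window_const \<phi> + (2 + 4 * L) * C * norm \<phi>) / ?m"
      using P norm_ge_zero order_trans by blast
    have "app P.D \<phi> = app (P.D - B * ?P) \<phi> + app B (app ?P \<phi>)" by simp
    also have "norm \<dots> \<le> 4 * K ^ Suc (p n) / threshold n * norm \<phi> +
        2 * K ^ Suc (p n) * ((2 * window_const \<phi> + (2 + 4 * L) * C * norm \<phi>) / ?m)"
      using K1 by (intro order_trans[OF norm_triangle_ineq] add_mono norm_app_le B order_trans[OF norm_app] mult_mono P P0) auto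
    also have "\<dots> \<le> 4 * K ^ Suc (p n) / ?m * norm \<phi> +
        2 * K ^ Suc (p n) * ((2 * window_const \<phi> + (2 + 4 * L) * C * norm \<phi>) / ?m)"
      using m K1 M2 unfolding threshold_def
      by (intro add_right_mono mult_right_mono divide_left_mono power_increasing) auto
    also have "\<dots> = c * (K ^ p n / ?m)" unfolding c_def by (simp add: algebra_simps add_divide_distrib)
    also have "\<dots> \<le> c * (1 / 2) ^ n"
    proof (rule mult_left_mono)
      have "K ^ p n / ?m = (K / M) ^ p n" by (simp add: power_divide)
      also have "\<dots> \<le> (1 / 2) ^ p n" using K1 MK M2 by (intro power_mono) (auto simp: field_simps)
      also have "\<dots> \<le> (1 / 2) ^ n" using p_ge by (intro power_decreasing) auto
      finally show "K ^ p n / ?m \<le> (1 / 2) ^ n" .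
      show "0 \<le> c" unfolding c_def using K1 L0 C0 window_const_nonneg
        by (intro add_nonneg_nonneg mult_nonneg_nonneg) auto
    qed
    finally show ?thesis .
  qed
  show ?thesis
  proof (rule ell2_eqI)
    fix m
    have "cmod (coord \<phi> m) \<le> e" if "0 < e" for e
    proof -
      from that have e2: "0 < e / 2" by simp
      obtain N where N: "\<forall>k. int N < \<bar>k\<bar> \<longrightarrow> cmod (coord \<phi> k) < e / 2"
        using coord_small[OF e2, of \<phi>] ..
      have "(\<lambda>n. c * (1 / 2) ^ n) \<longlonglongrightarrow> 0"
        by (intro tendsto_mult_right_zero LIMSEQ_power_zero) simp
      from order_tendstoD(2)[OF this e2, unfolded eventually_sequentially]
      obtain n0 where n0: "\<forall>n\<ge>n0. c * (1 / 2) ^ n < e / 2" ..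
      \<comment> \<open>Beyond \<open>n0\<close> the vector is close to its translate, and
        \<open>p n\<close> exceeding N + |m| moves the translated site out of the window of
        \<open>N\<close>.\<close>
      define n where "n = max n0 (N + nat \<bar>m\<bar> + 1)"
      interpret P: periodic_op "a' n" "b' n" "p n" \<alpha> L K by (rule per)
      have "n0 \<le> n" unfolding n_def by simp
      then have n_small: "c * (1 / 2) ^ n < e / 2" using n0 by blast
      have "N + nat \<bar>m\<bar> + 1 \<le> p n" using p_ge[of n] unfolding n_def by linarith
      then have "cmod (coord \<phi> (m - 2 * int (p n))) < e / 2" by (intro N[rule_format]) linarith
      moreover have "cmod (coord \<phi> m - coord \<phi> (m - 2 * int (p n))) < e / 2"
        using P.coord_diff_le_D[of \<phi> m] D[of n] n_small by linarith
      ultimately show ?thesis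
        using norm_triangle_sub[of "coord \<phi> m" "coord \<phi> (m - 2 * int (p n))"] by linarith
    qed
    then have "cmod (coord \<phi> m) \<le> 0" by (rule field_le_epsilon[of _ 0, simplified])
    then show "coord \<phi> m = coord 0 m" by simp
  qed
qed

end

section \<open>Evolution of the position operator\<close>

lemma norm_le_coordI:
  assumes "\<And>n. cmod (coord x n) \<le> cmod (coord y n)"
  shows "norm x \<le> norm y"
proof (rule ell2_norm_le)
  fix F :: "int set" assume "finite F"
  have "(\<Sum>n\<in>F. (cmod (coord x n))\<^sup>2) \<le> (\<Sum>n\<in>F. (cmod (coord y n))\<^sup>2)"
    by (intro sum_mono power_mono assms) simp
  then show "(\<Sum>n\<in>F. (cmod (coord x n))\<^sup>2) \<le> (norm y)\<^sup>2"
    using sum_coord_le_norm[OF \<open>finite F\<close>, of y] by linarith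
qed simp

lemma app_evo_cancel [simp]:
  "app (evo J t) (app (evo J (- t)) x) = x" "app (evo J (- t)) (app (evo J t) x) = x"
  by (metis app_simps(2,6) evo_minus)+

lemma dom_XI:
  assumes "\<And>n. coord z n = of_int n * coord \<phi> n"
  shows "\<phi> \<in> dom_X" "position_op \<phi> = z"
proof -
  show \<phi>: "\<phi> \<in> dom_X"
    using summable_coord[of z] by (simp add: dom_X_def assms)
  show "position_op \<phi> = z"
    by (rule ell2_eqI) (simp add: coord_position_op[OF \<phi>] assms)
qed

section \<open>Bounded truncations of the position operator\<close>

context jacobi_op
begin

text \<open>i[J, g(X)] sees only increments of g, so cutoffs of X with slope at most 1 have
  commutators bounded independently of the cutoff.\<close>

lemma commutator_diag:
  assumes g: "bounded (range g)" and d: "bounded (range (\<lambda>n. a n * (g (n + 1) - g n)))"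
  shows "iop * J * diag g - diag g * (iop * J) = cur (\<lambda>n. a n * (g (n + 1) - g n))"
  by (intro bop_eqI ell2_eqI) (simp add: coord_J coord_diag[OF g] coord_diag[OF d] cur_def, simp add: algebra_simps)

definition clip :: "nat \<Rightarrow> int \<Rightarrow> real" where
  "clip N n = of_int (max (- int N) (min (int N) n))"

lemma clip_abs_le: "\<bar>clip N n\<bar> \<le> N"
proof -
  have "\<bar>max (- int N) (min (int N) n)\<bar> \<le> int N" by linarith
  then have "real_of_int \<bar>max (- int N) (min (int N) n)\<bar> \<le> real_of_int (int N)"
    by (simp only: of_int_le_iff)
  then show ?thesis by (simp only: clip_def of_int_abs of_int_of_nat_eq)
qed

lemma clip_bounded: "bounded (range (clip N))"
  using clip_abs_le by (auto simp: bounded_iff)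

lemma clip_eq: "\<bar>n\<bar> \<le> int N \<Longrightarrow> clip N n = of_int n"
  unfolding clip_def by simp

lemma clip_step: "\<bar>clip N (n + 1) - clip N n\<bar> \<le> 1"
proof -
  have "\<bar>max (- int N) (min (int N) (n + 1)) - max (- int N) (min (int N) n)\<bar> \<le> 1" by linarith
  then have "real_of_int \<bar>max (- int N) (min (int N) (n + 1)) - max (- int N) (min (int N) n)\<bar> \<le> real_of_int 1"
    by (simp only: of_int_le_iff)
  then show ?thesis by (simp only: clip_def of_int_abs of_int_diff of_int_1)
qed

definition A_clip :: "nat \<Rightarrow> bop" where
  "A_clip N = cur (\<lambda>n. a n * (clip N (n + 1) - clip N n))"

lemma A_clip_coeff: "\<bar>a n * (clip N (n + 1) - clip N n)\<bar> \<le> norm J"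
  using mult_mono[OF abs_a_le[of n] clip_step[of N n]] by (simp add: abs_mult)

lemma A_clip_bounded: "bounded (range (\<lambda>n. a n * (clip N (n + 1) - clip N n)))"
  using A_clip_coeff by (auto simp: bounded_iff)

lemma A_clip_eq: "A_clip N = iop * J * diag (clip N) - diag (clip N) * (iop * J)"
  unfolding A_clip_def by (rule commutator_diag[OF clip_bounded A_clip_bounded, symmetric])

lemma norm_A_clip: "norm (A_clip N) \<le> 2 * norm J"
  unfolding A_clip_def by (rule norm_cur_le[OF A_clip_coeff])

lemma A_clip_trunc:
  assumes "K + 2 \<le> N"
  shows "app (A_clip N) (trunc K x) = app A (trunc K x)"
proof (rule ell2_eqI)
  fix m
  show "coord (app (A_clip N) (trunc K x)) m = coord (app A (trunc K x)) m"
  proof (cases "\<bar>m\<bar> \<le> int K + 1")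
    case True
    \<comment> \<open>The velocity reaches one site beyond the support and reads the cutoff one site
      further, hence the margin 2.\<close>
    have "clip N (m + 1) = of_int (m + 1)" "clip N m = of_int m" "clip N (m - 1) = of_int (m - 1)"
      using True assms by (intro clip_eq; linarith)+
    then show ?thesis
      by (simp add: A_clip_def cur_def coord_diag[OF A_clip_bounded] coord_diag[OF a_bounded])
  next
    case False
    then have "coord (trunc K x) (m + 1) = 0" "coord (trunc K x) (m - 1) = 0"
      by (auto simp: coord_trunc)
    then show ?thesis
      by (simp add: A_clip_def cur_def coord_diag[OF A_clip_bounded] coord_diag[OF a_bounded])
  qed
qed

lemma A_clip_tendsto: "(\<lambda>N. app (A_clip N) x) \<longlonglongrightarrow> app A x"
proof (rule LIMSEQ_I)
  fix e :: real assume e: "0 < e"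
  let ?c = "4 * norm J + 1"
  have c: "0 < ?c" by (simp add: add_nonneg_pos)
  then have "0 < e / ?c" using e by simp
  from LIMSEQ_D[OF trunc_tendsto[of x] this] obtain K where K: "\<forall>n\<ge>K. norm (trunc n x - x) < e / ?c" ..
  have "norm (app (A_clip N) x - app A x) < e" if N: "N \<ge> K + 2" for N
  proof -
    have "app (A_clip N) x - app A x = app (A_clip N - A) (x - trunc K x)"
      using A_clip_trunc[OF N, of x] by simp
    then have "norm (app (A_clip N) x - app A x) \<le> norm (A_clip N - A) * norm (x - trunc K x)"
      by (metis norm_app)
    also have "norm (A_clip N - A) \<le> 2 * norm J + 2 * norm J"
      using norm_triangle_ineq4[of "A_clip N" A] norm_A_clip[of N] norm_A_le by linarith
    then have "norm (A_clip N - A) * norm (x - trunc K x) \<le> ?c * norm (x - trunc K x)"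
      by (intro mult_right_mono) auto
    also have "\<dots> < e"
      using K c by (simp add: norm_minus_commute pos_less_divide_eq mult.commute)
    finally show ?thesis .
  qed
  then show "\<exists>N0. \<forall>N\<ge>N0. norm (app (A_clip N) x - app A x) < e" by blast
qed

text \<open>The error vanishes inside the window and is dominated outside by the tail of
  \<open>position_op \<phi>\<close>.\<close>

lemma clip_tendsto:
  assumes \<phi>: "\<phi> \<in> dom_X"
  shows "(\<lambda>N. app (diag (clip N)) \<phi>) \<longlonglongrightarrow> position_op \<phi>"
proof -
  let ?y = "position_op \<phi>"
  have le: "norm (app (diag (clip N)) \<phi> - ?y) \<le> norm (trunc N ?y - ?y)" for N
  proof (rule norm_le_coordI)
    fix n
    show "cmod (coord (app (diag (clip N)) \<phi> - ?y) n) \<le> cmod (coord (trunc N ?y - ?y) n)"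
    proof (cases "\<bar>n\<bar> \<le> int N")
      case True
      then show ?thesis by (simp add: coord_diag[OF clip_bounded] coord_position_op[OF \<phi>] clip_eq)
    next
      case False
      have "\<bar>clip N n - of_int n\<bar> \<le> \<bar>real_of_int n\<bar>"
        unfolding clip_def of_int_diff[symmetric] of_int_abs[symmetric] of_int_le_iff using False by auto
      moreover have "coord (app (diag (clip N)) \<phi> - ?y) n = of_real (clip N n - of_int n) * coord \<phi> n"
        by (simp add: coord_diag[OF clip_bounded] coord_position_op[OF \<phi>] algebra_simps)
      moreover have "cmod (coord (trunc N ?y - ?y) n) = \<bar>real_of_int n\<bar> * cmod (coord \<phi> n)"
        using False by (simp add: coord_trunc coord_position_op[OF \<phi>] norm_mult)
      ultimately show ?thesis by (simp only: norm_mult norm_of_real mult_right_mono norm_ge_zero)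
    qed
  qed
  have lim: "(\<lambda>N. norm (trunc N ?y - ?y)) \<longlonglongrightarrow> 0"
    using trunc_tendsto[of ?y] by (simp add: LIM_zero_iff tendsto_norm_zero_iff)
  have "(\<lambda>N. app (diag (clip N)) \<phi> - ?y) \<longlonglongrightarrow> 0"
    by (rule Lim_null_comparison[OF always_eventually[OF allI[OF le]] lim])
  then show ?thesis by (simp add: LIM_zero_iff)
qed

text \<open>Apply the fundamental theorem of calculus to the bounded truncations of the position operator and
  pass to the limit coordinatewise.\<close>

lemma position_evolution:
  assumes \<phi>: "\<phi> \<in> dom_X" and t: "0 < t"
  shows "app (evo J (- t)) \<phi> \<in> dom_X"
    and "position_op (app (evo J (- t)) \<phi>) = app (evo J (- t)) (position_op \<phi> + t *\<^sub>R app (avg J t A) \<phi>)"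
proof -
  let ?U = "evo J (- t)" and ?I = "integral {0..t} (\<lambda>s. heis J s A)"
  have I: "t *\<^sub>R app (avg J t A) \<phi> = app ?I \<phi>" using t by (simp add: avg_def)
  have "coord (app ?U (position_op \<phi> + t *\<^sub>R app (avg J t A) \<phi>)) m = of_int m * coord (app ?U \<phi>) m" for m
  proof -
    \<comment> \<open>\<open>dom_XI\<close> decides membership in the domain and the value there
      coordinatewise, so one coordinate is studied as a bounded functional of the operator.\<close>
    define l where "l T = coord (app ?U (app T \<phi>)) m" for T
    have l: "bounded_linear l"
      unfolding l_def
      by (rule bounded_linear_compose[OF bounded_linear_coord
            bounded_linear_compose[OF bounded_linear_app bounded_linear_app_left]])
    have int: "l (integral {0..t} (\<lambda>s. heis J s T)) = integral {0..t} (\<lambda>s. l (heis J s T))" for T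
      using integral_linear[OF heis_integrable[of J T 0 t] l] by (simp add: o_def)
    have lint: "(\<lambda>s. l (heis J s T)) integrable_on {0..t}" for T
      using integrable_linear[OF heis_integrable[of J T 0 t] l] by (simp add: o_def)
    have eqN: "integral {0..t} (\<lambda>s. l (heis J s (A_clip N)))
        = of_real (clip N m) * coord (app ?U \<phi>) m - coord (app ?U (app (diag (clip N)) \<phi>)) m" for N
    proof -
      have "integral {0..t} (\<lambda>s. heis J s (A_clip N)) = heis J t (diag (clip N)) - diag (clip N)"
        unfolding A_clip_eq using t by (intro integral_unique heis_has_integral) simp
      then have "integral {0..t} (\<lambda>s. l (heis J s (A_clip N))) = l (heis J t (diag (clip N)) - diag (clip N))"
        using int[of "A_clip N"] by simp
      also have "\<dots> = coord (app (?U * evo J t) (app (diag (clip N)) (app ?U \<phi>))) m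
          - coord (app ?U (app (diag (clip N)) \<phi>)) m"
        unfolding l_def heis_def by simp
      finally show ?thesis by (simp only: evo_minus app_simps(2) coord_diag[OF clip_bounded])
    qed
    \<comment> \<open>Strong convergence of \<open>A_clip\<close> gives pointwise convergence of the
      integrands, and the norm bound uniform in \<open>N\<close> provides a constant
      majorant.\<close>
    have "(\<lambda>N. integral {0..t} (\<lambda>s. l (heis J s (A_clip N)))) \<longlonglongrightarrow> integral {0..t} (\<lambda>s. l (heis J s A))"
    proof (rule dominated_convergence(2)[OF lint])
      show "(\<lambda>s. 2 * norm J * norm \<phi>) integrable_on {0..t}" by (rule integrable_const_ivl)
      fix N s
      have "norm (l (heis J s (A_clip N))) \<le> norm (app (heis J s (A_clip N)) \<phi>)"
        unfolding l_def using coord_le_norm[of "app ?U (app (heis J s (A_clip N)) \<phi>)" m] by simp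
      also have "\<dots> \<le> 2 * norm J * norm \<phi>"
        by (intro norm_app_le order_trans[OF norm_heis norm_A_clip])
      finally show "norm (l (heis J s (A_clip N))) \<le> 2 * norm J * norm \<phi>" .
    next
      fix s
      have "(\<lambda>N. coord (app (?U * evo J s) (app (A_clip N) (app (evo J (- s)) \<phi>))) m)
          \<longlonglongrightarrow> coord (app (?U * evo J s) (app A (app (evo J (- s)) \<phi>))) m"
        by (rule bounded_linear.tendsto[OF bounded_linear_coord
              bounded_linear.tendsto[OF bounded_linear_app A_clip_tendsto]])
      then show "(\<lambda>N. l (heis J s (A_clip N))) \<longlonglongrightarrow> l (heis J s A)"
        unfolding l_def heis_def by simp
    qed
    then have 1: "(\<lambda>N. of_real (clip N m) * coord (app ?U \<phi>) m - coord (app ?U (app (diag (clip N)) \<phi>)) m)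
        \<longlonglongrightarrow> l ?I"
      unfolding eqN int[of A] .
    have "\<forall>\<^sub>F N in sequentially. complex_of_real (clip N m) = of_int m"
      using eventually_ge_at_top[of "nat \<bar>m\<bar>"] by eventually_elim (simp add: clip_eq)
    then have "(\<lambda>N. complex_of_real (clip N m)) \<longlonglongrightarrow> of_int m" by (rule tendsto_eventually)
    then have 2: "(\<lambda>N. of_real (clip N m) * coord (app ?U \<phi>) m - coord (app ?U (app (diag (clip N)) \<phi>)) m)
        \<longlonglongrightarrow> of_int m * coord (app ?U \<phi>) m - coord (app ?U (position_op \<phi>)) m"
      by (intro tendsto_intros bounded_linear.tendsto[OF bounded_linear_coord]
          bounded_linear.tendsto[OF bounded_linear_app] clip_tendsto \<phi>)
    from LIMSEQ_unique[OF 1 2] show ?thesis unfolding I l_def by simp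
  qed
  from dom_XI[OF this] show "app ?U \<phi> \<in> dom_X"
    "position_op (app ?U \<phi>) = app ?U (position_op \<phi> + t *\<^sub>R app (avg J t A) \<phi>)" .
qed

end

section \<open>From the exponential class to approximants with common constants\<close>

lemma jacobi_with_jac:
  assumes "jacobi_with a b J"
  shows "jacobi_op a b" "Bop J = jac a b" "\<exists>\<alpha>>0. \<forall>n. \<alpha> \<le> a n"
proof -
  have bd: "bounded (range a)" "bounded (range b)" and inf: "0 < (INF n. a n)"
    using assms by (auto simp: jacobi_with_def)
  show j: "jacobi_op a b" using bd by unfold_locales
  then interpret jacobi_op a b .
  show "Bop J = jac a b"
    by (intro bop_eqI ell2_eqI) (use assms in \<open>simp add: coord_J app_Bop jacobi_with_def\<close>)
  have "bdd_below (range a)" using bd(1) by (rule bounded_imp_bdd_below)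
  then have "(INF n. a n) \<le> a n" for n by (rule cINF_lower) simp
  then show "\<exists>\<alpha>>0. \<forall>n. \<alpha> \<le> a n" using inf by blast
qed

lemma norm_diff_Bop: "norm (Bop S - Bop T) = norm (S - T)"
  by (simp add: norm_bop.rep_eq minus_bop.rep_eq Bop_inverse)

text \<open>The constants are fixed from \<open>J\<close> first; membership for all rates then
  allows the rate \<open>5 * ln M\<close>, which depends on them. Discarding finitely many
  approximants makes the others share these constants.\<close>

lemma exp_class_approx:
  assumes J: "jacobi_with a b J" and "exp_class_infinity J"
  shows "\<exists>p a' b' \<alpha> L K C M. exp_approx a b p a' b' \<alpha> L K C M"
proof -
  interpret j: jacobi_op a b by (rule jacobi_with_jac[OF J])
  obtain \<alpha>0 where \<alpha>0: "0 < \<alpha>0" "\<And>n. \<alpha>0 \<le> a n" using jacobi_with_jac(3)[OF J] by blast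
  \<comment> \<open>Halving the lower bound, and raising the norm bound by 1 below, leaves room for
    operators close to \<open>J\<close>.\<close>
  define \<alpha> where "\<alpha> = \<alpha>0 / 2"
  define L where "L = norm J + 1"
  define K where "K = max 1 ((1 + 5 * L) / \<alpha>)"
  define M where "M = real (nat \<lceil>2 * K\<rceil>)"
  have K: "1 \<le> K" "(1 + 5 * L) / \<alpha> \<le> K" by (simp_all add: K_def)
  have MK: "2 * K \<le> M" unfolding M_def by linarith
  then have M2: "2 \<le> M" using K by linarith
  have M_nat: "M \<in> \<nat>" unfolding M_def by simp
  have "0 < 5 * ln M" using M2 by simp
  then have "exp_class (5 * ln M) J" using assms(2) by (simp add: exp_class_infinity_def)
  then obtain q :: "nat \<Rightarrow> nat" and P where per: "\<And>n. periodic_jacobi (q n) (P n)"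
    and lim: "(\<lambda>n. exp (5 * ln M * q (Suc n)) * norm (J - P n)) \<longlonglongrightarrow> 0"
    and div: "\<And>n. q n dvd q (Suc n)" "\<And>n. q n \<noteq> q (Suc n)"
    unfolding exp_class_def by blast
  have ex: "exp (5 * ln M * k) = M ^ (5 * k)" for k :: nat
  proof -
    have "exp (5 * ln M * k) = exp (ln M) ^ (5 * k)" by (simp add: exp_of_nat_mult[symmetric] mult_ac)
    then show ?thesis using M2 by simp
  qed
  have "\<forall>n. \<exists>a b. jacobi_with a b (P n) \<and> (\<forall>m. a (m + int (q n)) = a m \<and> b (m + int (q n)) = b m)"
    using per unfolding periodic_jacobi_def by blast
  then obtain a0 b0 where ab: "\<And>n. jacobi_with (a0 n) (b0 n) (P n)"
    "\<And>n m. a0 n (m + int (q n)) = a0 n m" "\<And>n m. b0 n (m + int (q n)) = b0 n m" by metis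
  have q_pos: "0 < q n" for n using per unfolding periodic_jacobi_def by blast
  have q_less: "q n < q (Suc n)" for n
    using dvd_imp_le[OF div(1) q_pos] div(2)[of n] by (simp add: le_neq_implies_less)
  \<comment> \<open>An error below 1 gives the norm bound and \<open>C = 1\<close>; an error below
    \<open>\<alpha>\<close> keeps the coefficients above half of \<open>\<alpha>0\<close>.\<close>
  have "0 < min 1 \<alpha>" using \<alpha>0 by (simp add: \<alpha>_def)
  from order_tendstoD(2)[OF lim this, unfolded eventually_sequentially] obtain n0 where
    n0: "\<forall>n\<ge>n0. exp (5 * ln M * q (Suc n)) * norm (J - P n) < min 1 \<alpha>" ..
  define p where "p n = q (n0 + n)" for n
  define a' where "a' n = a0 (n0 + n)" for n
  define b' where "b' n = b0 (n0 + n)" for n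
  have jac: "jacobi_op (a' n) (b' n)" "Bop (P (n0 + n)) = jac (a' n) (b' n)" for n
    using jacobi_with_jac[OF ab(1)[of "n0 + n"]] by (simp_all add: a'_def b'_def)
  have cl: "norm (j.J - jac (a' n) (b' n)) = norm (J - P (n0 + n))" for n
    by (simp add: jac(2)[symmetric] jacobi_with_jac(2)[OF J, symmetric] norm_diff_Bop)
  have n1: "M ^ (5 * p (Suc n)) * norm (J - P (n0 + n)) < min 1 \<alpha>" for n
    using n0[rule_format, of "n0 + n"] by (simp add: p_def ex)
  have M1: "1 \<le> M ^ (5 * p (Suc n))" for n using M2 by simp
  have close1: "norm (J - P (n0 + n)) < min 1 \<alpha>" for n
    using n1[of n] mult_right_mono[OF M1[of n] norm_ge_zero[of "J - P (n0 + n)"]] by linarith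
  have "exp_approx a b p a' b' \<alpha> L K 1 M"
  proof (rule exp_approx.intro[OF j.jacobi_op_axioms exp_approx_axioms.intro])
    show "norm j.J \<le> L"
      by (simp add: jacobi_with_jac(2)[OF J, symmetric] norm_Bop L_def)
    show "p n < p (Suc n)" for n unfolding p_def using q_less[of "n0 + n"] by simp
    show "norm (j.J - jac (a' n) (b' n)) \<le> 1 / M ^ (5 * p (Suc n))" for n
      using n1[of n] M1[of n] unfolding cl by (simp add: pos_le_divide_eq mult.commute)
    fix n
    interpret j': jacobi_op "a' n" "b' n" by (rule jac)
    show "periodic_op (a' n) (b' n) (p n) \<alpha> L K"
    proof (unfold_locales)
      show "0 < p n" by (simp add: p_def q_pos)
      show "a' n (m + int (p n)) = a' n m" "b' n (m + int (p n)) = b' n m" for m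
        by (simp_all add: a'_def b'_def p_def ab)
      show "0 < \<alpha>" using \<alpha>0 by (simp add: \<alpha>_def)
      show "\<alpha> \<le> a' n m" for m
        using coeff_diff_le[OF j.jacobi_op_axioms jac(1), of m n] close1[of n] \<alpha>0(2)[of m] unfolding cl \<alpha>_def
        by (simp add: abs_le_iff)
      have "norm (P (n0 + n)) \<le> norm J + norm (J - P (n0 + n))"
        using norm_triangle_ineq4[of J "J - P (n0 + n)"] by simp
      then show "norm j'.J \<le> L"
        using close1[of n] by (simp add: jac(2)[symmetric] norm_Bop L_def)
    qed (use K in auto)
  qed (use M_nat M2 MK in auto)
  then show ?thesis by blast
qed

section \<open>Weighted norms\<close>

text \<open>Discrete derivative of a power. Arguments at least 1 ensure that a unit step at most
  doubles the value, which the induction uses.\<close>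

lemma power_step_diff_le:
  "\<exists>c\<ge>0. \<forall>x y::real. 1 \<le> x \<longrightarrow> 1 \<le> y \<longrightarrow> \<bar>y - x\<bar> \<le> 1 \<longrightarrow> \<bar>y ^ Suc k - x ^ Suc k\<bar> \<le> c * x ^ k"
proof (induction k)
  case 0
  show ?case by (rule exI[of _ 1]) simp
next
  case (Suc k)
  then obtain c where c: "0 \<le> c" and le: "\<And>x y::real. 1 \<le> x \<Longrightarrow> 1 \<le> y \<Longrightarrow> \<bar>y - x\<bar> \<le> 1 \<Longrightarrow> \<bar>y ^ Suc k - x ^ Suc k\<bar> \<le> c * x ^ k"
    by blast
  have "\<bar>y ^ Suc (Suc k) - x ^ Suc (Suc k)\<bar> \<le> (2 * c + 1) * x ^ Suc k" if xy: "1 \<le> x" "1 \<le> y" "\<bar>y - x\<bar> \<le> 1" for x y :: real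
  proof -
    have "y ^ Suc (Suc k) - x ^ Suc (Suc k) = y * (y ^ Suc k - x ^ Suc k) + (y - x) * x ^ Suc k"
      by (simp add: algebra_simps)
    then have "\<bar>y ^ Suc (Suc k) - x ^ Suc (Suc k)\<bar> \<le> \<bar>y * (y ^ Suc k - x ^ Suc k)\<bar> + \<bar>(y - x) * x ^ Suc k\<bar>"
      by (simp only: abs_triangle_ineq)
    also have "\<dots> = y * \<bar>y ^ Suc k - x ^ Suc k\<bar> + \<bar>y - x\<bar> * x ^ Suc k"
      using xy by (simp only: abs_mult) (simp add: abs_of_pos)
    also have "\<dots> \<le> (2 * x) * (c * x ^ k) + 1 * x ^ Suc k"
      using xy le[OF xy] c by (intro add_mono mult_mono) (auto intro: mult_nonneg_nonneg)
    finally show ?thesis by (simp add: algebra_simps)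
  qed
  then show ?case using c by (intro exI[of _ "2 * c + 1"]) auto
qed

text \<open>Bounded version of (1 + |X|)^k. With the cutoff inside the power, increments of degree k
  + 1 are controlled by the weight of degree k, uniformly in \<open>N\<close>.\<close>

definition wt :: "nat \<Rightarrow> nat \<Rightarrow> int \<Rightarrow> real" where
  "wt k N n = (1 + of_int (min \<bar>n\<bar> (int N))) ^ k"

lemma wt_nonneg: "0 \<le> wt k N n"
  by (simp add: wt_def)

lemma wt_le: "wt k N n \<le> (1 + real_of_int \<bar>n\<bar>) ^ k"
  unfolding wt_def by (intro power_mono) auto

lemma wt_eq: "\<bar>n\<bar> \<le> int N \<Longrightarrow> wt k N n = (1 + real_of_int \<bar>n\<bar>) ^ k"
  by (simp add: wt_def min_def)

lemma wt_bounded: "bounded (range (wt k N))"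
proof -
  have "wt k N n \<le> (1 + real N) ^ k" for n
  proof -
    have "real_of_int (min \<bar>n\<bar> (int N)) \<le> real_of_int (int N)" by (simp only: of_int_le_iff min.cobounded2)
    then show ?thesis unfolding wt_def by (intro power_mono) auto
  qed
  then show ?thesis using wt_nonneg by (intro boundedI[where B = "(1 + real N) ^ k"]) auto
qed

lemma wt_step:
  assumes le: "\<And>x y::real. 1 \<le> x \<Longrightarrow> 1 \<le> y \<Longrightarrow> \<bar>y - x\<bar> \<le> 1 \<Longrightarrow> \<bar>y ^ Suc k - x ^ Suc k\<bar> \<le> c * x ^ k"
    and "\<bar>m - n\<bar> \<le> 1"
  shows "\<bar>wt (Suc k) N m - wt (Suc k) N n\<bar> \<le> c * wt k N n"
  unfolding wt_def
proof (rule le)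
  have "abs (min (abs m) (int N) - min (abs n) (int N)) \<le> 1" using assms(2) by linarith
  then have "real_of_int (abs (min (abs m) (int N) - min (abs n) (int N))) \<le> real_of_int 1"
    by (simp only: of_int_le_iff)
  then show "abs (1 + real_of_int (min (abs m) (int N)) - (1 + real_of_int (min (abs n) (int N)))) \<le> 1"
    by (simp only: of_int_abs of_int_diff add_diff_cancel_left of_int_1)
qed auto

context jacobi_op
begin

lemma norm_commutator_wt:
  assumes le: "\<And>x y::real. 1 \<le> x \<Longrightarrow> 1 \<le> y \<Longrightarrow> \<bar>y - x\<bar> \<le> 1 \<Longrightarrow> \<bar>y ^ Suc k - x ^ Suc k\<bar> \<le> c * x ^ k"
    and c: "0 \<le> c"
  shows "norm (app (iop * J * diag (wt (Suc k) N) - diag (wt (Suc k) N) * (iop * J)) x)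
    \<le> 2 * (norm J * c) * norm (app (diag (wt k N)) x)"
proof -
  let ?g = "wt (Suc k) N" and ?z = "app (diag (wt k N)) x" and ?r = "norm J * c"
  let ?d = "\<lambda>n. a n * (?g (n + 1) - ?g n)"
  have d0: "\<bar>?d n\<bar> \<le> ?r * wt k N n" for n
    using mult_mono[OF abs_a_le[of n] wt_step[OF le, of "n + 1" n N]] c by (simp add: abs_mult mult.assoc)
  \<comment> \<open>The increment is also estimated by the weight at the other end of the bond,
    since the two shifts in \<open>cur\<close> read the vector at different ends.\<close>
  have d1: "\<bar>?d n\<bar> \<le> ?r * wt k N (n + 1)" for n
    using mult_mono[OF abs_a_le[of n] wt_step[OF le, of n "n + 1" N]] c
    by (simp add: abs_mult mult.assoc abs_minus_commute)
  obtain B where B: "\<And>n. \<bar>wt k N n\<bar> \<le> B" using wt_bounded[of k N] by (auto simp: bounded_iff)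
  have "\<bar>?d n\<bar> \<le> ?r * B" for n
    using d0[of n] mult_left_mono[OF B[of n], of ?r] c wt_nonneg[of k N n] by simp
  then have bd: "bounded (range ?d)" by (intro boundedI[where B = "?r * B"]) auto
  have "norm (app (diag ?d) (app (shift (- 1)) x)) \<le> norm (?r *\<^sub>R app (shift (- 1)) ?z)"
  proof (rule norm_le_coordI)
    fix n
    show "cmod (coord (app (diag ?d) (app (shift (- 1)) x)) n) \<le> cmod (coord (?r *\<^sub>R app (shift (- 1)) ?z) n)"
      using mult_right_mono[OF d1[of n] norm_ge_zero[of "coord x (n + 1)"]] c wt_nonneg[of k N "n + 1"]
      by (simp add: coord_diag[OF bd] coord_diag[OF wt_bounded] norm_mult abs_mult mult.assoc del: of_real_diff)
  qed
  then have 1: "norm (app (diag ?d) (app (shift (- 1)) x)) \<le> ?r * norm ?z"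
    using c by simp
  have "norm (app (diag ?d) x) \<le> norm (?r *\<^sub>R ?z)"
  proof (rule norm_le_coordI)
    fix n
    show "cmod (coord (app (diag ?d) x) n) \<le> cmod (coord (?r *\<^sub>R ?z) n)"
      using mult_right_mono[OF d0[of n] norm_ge_zero[of "coord x n"]] c wt_nonneg[of k N n]
      by (simp add: coord_diag[OF bd] coord_diag[OF wt_bounded] norm_mult abs_mult mult.assoc del: of_real_diff)
  qed
  then have 2: "norm (app (diag ?d) x) \<le> ?r * norm ?z" using c by simp
  have "norm (app (cur ?d) x) = norm (app (diag ?d) (app (shift (- 1)) x) - app (shift 1) (app (diag ?d) x))"
    unfolding cur_def app_simps(6) norm_app_iop by simp
  also have "\<dots> \<le> ?r * norm ?z + ?r * norm ?z"
    using 1 2 by (intro order_trans[OF norm_triangle_ineq4] add_mono) simp_all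
  finally show ?thesis unfolding commutator_diag[OF wt_bounded bd] by (simp add: mult_ac)
qed

text \<open>Induction on the degree: the commutator lowers it by one, and integration in time adds
  one power of \<open>1 + t\<close>. The constants do not depend on the cutoff
  \<open>N\<close>.\<close>

lemma weighted_evolution:
  assumes fin: "\<And>k. \<exists>S. \<forall>N. norm (app (diag (wt k N)) \<phi>) \<le> S"
  shows "\<exists>C\<ge>0. \<forall>N. \<forall>t\<ge>0. norm (app (diag (wt k N)) (app (evo J (- t)) \<phi>)) \<le> C * (1 + t) ^ k"
proof (induction k)
  case 0
  have "diag (wt 0 N) = 1" for N
    by (intro bop_eqI ell2_eqI) (simp add: coord_diag[OF wt_bounded] wt_def)
  then show ?case by (intro exI[of _ "norm \<phi>"]) simp
next
  case (Suc k)
  then obtain C where C: "0 \<le> C" "\<And>N t. 0 \<le> t \<Longrightarrow> norm (app (diag (wt k N)) (app (evo J (- t)) \<phi>)) \<le> C * (1 + t) ^ k"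
    by blast
  obtain S where S: "\<And>N. norm (app (diag (wt (Suc k) N)) \<phi>) \<le> S" using fin by blast
  have S0: "0 \<le> S" using S[of 0] norm_ge_zero order_trans by blast
  obtain c where c: "0 \<le> c" and le: "\<And>x y::real. 1 \<le> x \<Longrightarrow> 1 \<le> y \<Longrightarrow> \<bar>y - x\<bar> \<le> 1 \<Longrightarrow> \<bar>y ^ Suc k - x ^ Suc k\<bar> \<le> c * x ^ k"
    using power_step_diff_le[of k] by blast
  let ?r = "2 * (norm J * c)"
  have "norm (app (diag (wt (Suc k) N)) (app (evo J (- t)) \<phi>)) \<le> (S + ?r * C) * (1 + t) ^ Suc k" if t: "0 \<le> t" for N t
  proof -
    let ?G = "diag (wt (Suc k) N)"
    let ?W = "iop * J * ?G - ?G * (iop * J)"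
    let ?I = "integral {0..t} (\<lambda>s. heis J s ?W)"
    have I: "?I = heis J t ?G - ?G" by (rule integral_unique[OF heis_has_integral[OF t]])
    have "norm (app ?I \<phi>) \<le> ?r * (C * (1 + t) ^ k) * (t - 0)"
    proof -
      have "app ?I \<phi> = integral {0..t} (\<lambda>s. app (heis J s ?W) \<phi>)"
        using integral_linear[OF heis_integrable[of J ?W 0 t] bounded_linear_app_left[of \<phi>]] by (simp only: o_def)
      also have "norm \<dots> \<le> ?r * (C * (1 + t) ^ k) * (t - 0)"
      proof (rule integral_bound[OF t])
        show "continuous_on {0..t} (\<lambda>s. app (heis J s ?W) \<phi>)"
          by (rule bounded_linear.continuous_on[OF bounded_linear_app_left continuous_on_heis])
        fix s assume s: "s \<in> {0..t}"
        have "norm (app (heis J s ?W) \<phi>) = norm (app ?W (app (evo J (- s)) \<phi>))"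
          unfolding heis_def app_simps(6) norm_app_evo ..
        also have "\<dots> \<le> ?r * norm (app (diag (wt k N)) (app (evo J (- s)) \<phi>))"
          by (rule norm_commutator_wt[OF le c])
        also have "\<dots> \<le> ?r * (C * (1 + t) ^ k)"
        proof (rule mult_left_mono)
          have "C * (1 + s) ^ k \<le> C * (1 + t) ^ k" using s C(1) by (intro mult_left_mono power_mono) auto
          then show "norm (app (diag (wt k N)) (app (evo J (- s)) \<phi>)) \<le> C * (1 + t) ^ k"
            using C(2)[of s N] s by auto
        qed (use c in simp)
        finally show "norm (app (heis J s ?W) \<phi>) \<le> ?r * (C * (1 + t) ^ k)" .
      qed
      finally show ?thesis .
    qed
    note I_le = this
    have eq: "norm (app ?G (app (evo J (- t)) \<phi>)) = norm (app ?G \<phi> + app ?I \<phi>)"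
    proof -
      have "app ?G \<phi> + app ?I \<phi> = app (evo J t) (app ?G (app (evo J (- t)) \<phi>))"
        unfolding I by (simp add: heis_def)
      then show ?thesis by simp
    qed
    have "norm (app ?G (app (evo J (- t)) \<phi>)) \<le> S + ?r * (C * (1 + t) ^ k) * t"
      unfolding eq by (rule order_trans[OF norm_triangle_ineq add_mono[OF S I_le[unfolded diff_zero]]])
    also have "\<dots> \<le> S * (1 + t) ^ Suc k + ?r * (C * (1 + t) ^ k) * (1 + t)"
    proof (rule add_mono)
      have "S * 1 \<le> S * (1 + t) ^ Suc k" using S0 t by (intro mult_left_mono one_le_power) auto
      then show "S \<le> S * (1 + t) ^ Suc k" by simp
      show "?r * (C * (1 + t) ^ k) * t \<le> ?r * (C * (1 + t) ^ k) * (1 + t)"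
        using c C(1) t by (intro mult_left_mono mult_nonneg_nonneg) auto
    qed
    also have "\<dots> = (S + ?r * C) * (1 + t) ^ Suc k" by (simp add: algebra_simps)
    finally show ?thesis .
  qed
  moreover have "0 \<le> S + ?r * C" using S0 c C(1) by simp
  ultimately show ?case by blast
qed

text \<open>For finitely many sites the cutoff can be placed beyond all of them, where the weight is
  exact.\<close>

lemma weighted_sum_le:
  assumes fin: "\<And>k. \<exists>S. \<forall>N. norm (app (diag (wt k N)) \<phi>) \<le> S"
  shows "\<exists>C\<ge>0. \<forall>t\<ge>0. \<forall>F. finite F \<longrightarrow>
    (\<Sum>n\<in>F. (1 + real_of_int \<bar>n\<bar>) ^ (2 * k) * (cmod (coord (app (evo J (- t)) \<phi>) n))\<^sup>2) \<le> C * (1 + t) ^ (2 * k)"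
proof -
  obtain C where C: "0 \<le> C" "\<And>N t. 0 \<le> t \<Longrightarrow> norm (app (diag (wt k N)) (app (evo J (- t)) \<phi>)) \<le> C * (1 + t) ^ k"
    using weighted_evolution[OF fin, of k] by blast
  have "(\<Sum>n\<in>F. (1 + real_of_int \<bar>n\<bar>) ^ (2 * k) * (cmod (coord (app (evo J (- t)) \<phi>) n))\<^sup>2) \<le> C\<^sup>2 * (1 + t) ^ (2 * k)"
    if t: "0 \<le> t" and F: "finite F" for t F
  proof -
    let ?y = "app (evo J (- t)) \<phi>"
    define N where "N = nat (Max (abs ` F))"
    have N: "\<bar>n\<bar> \<le> int N" if "n \<in> F" for n
    proof -
      have "\<bar>n\<bar> \<le> Max (abs ` F)" using that F by (intro Max_ge) auto
      then show ?thesis unfolding N_def by linarith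
    qed
    have "(\<Sum>n\<in>F. (1 + real_of_int \<bar>n\<bar>) ^ (2 * k) * (cmod (coord ?y n))\<^sup>2)
        = (\<Sum>n\<in>F. (cmod (coord (app (diag (wt k N)) ?y) n))\<^sup>2)"
    proof (rule sum.cong[OF refl])
      fix n assume "n \<in> F"
      then show "(1 + real_of_int \<bar>n\<bar>) ^ (2 * k) * (cmod (coord ?y n))\<^sup>2 = (cmod (coord (app (diag (wt k N)) ?y) n))\<^sup>2"
        by (simp only: coord_diag[OF wt_bounded] norm_mult norm_of_real abs_of_nonneg[OF wt_nonneg]
            wt_eq[OF N] power_mult_distrib power_even_eq power2_abs)
    qed
    also have "\<dots> \<le> (norm (app (diag (wt k N)) ?y))\<^sup>2" by (rule sum_coord_le_norm[OF F])
    also have "\<dots> \<le> (C * (1 + t) ^ k)\<^sup>2" by (rule power_mono[OF C(2)[OF t] norm_ge_zero])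
    finally show ?thesis by (simp add: power_mult_distrib power_even_eq)
  qed
  then show ?thesis by (intro exI[of _ "C\<^sup>2"]) simp
qed

end

lemma schwartz_weighted:
  assumes \<phi>: "\<phi> \<in> schwartz"
  shows "(\<lambda>n. (1 + real_of_int \<bar>n\<bar>) ^ k * cmod (coord \<phi> n)) summable_on UNIV"
proof -
  \<comment> \<open>\<open>Suc k\<close> makes the exponent positive, as \<open>schwartz\<close>
    demands, also for \<open>k = 0\<close>. The site 0, where \<open>?f\<close> vanishes, is removed
    for the comparison and restored at the end.\<close>
  let ?f = "\<lambda>n. \<bar>real_of_int n\<bar> powr real (Suc k) * cmod (coord \<phi> n)"
  have "?f summable_on UNIV" using \<phi> unfolding schwartz_def by (simp del: of_nat_Suc)
  then have "?f summable_on (UNIV - {0})" by (rule summable_on_subset_banach) auto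
  then have "(\<lambda>n. 2 ^ k * ?f n) summable_on (UNIV - {0})" by (rule summable_on_cmult_right)
  then have "(\<lambda>n. (1 + real_of_int \<bar>n\<bar>) ^ k * cmod (coord \<phi> n)) summable_on (UNIV - {0})"
  proof (rule summable_on_comparison_test)
    fix n :: int assume "n \<in> UNIV - {0}"
    then have n: "1 \<le> real_of_int \<bar>n\<bar>" by auto
    have "(1 + real_of_int \<bar>n\<bar>) ^ k \<le> (2 * real_of_int \<bar>n\<bar>) ^ k" using n by (intro power_mono) auto
    also have "\<dots> = 2 ^ k * real_of_int \<bar>n\<bar> ^ k" by (rule power_mult_distrib)
    also have "\<dots> \<le> 2 ^ k * real_of_int \<bar>n\<bar> ^ Suc k" using n by (intro mult_left_mono power_increasing) auto
    also have "real_of_int \<bar>n\<bar> ^ Suc k = \<bar>real_of_int n\<bar> powr real (Suc k)"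
      using n by (subst powr_realpow) auto
    finally show "(1 + real_of_int \<bar>n\<bar>) ^ k * cmod (coord \<phi> n) \<le> 2 ^ k * ?f n"
      using mult_right_mono[OF _ norm_ge_zero] by (metis mult.assoc)
  qed simp
  then have "(\<lambda>n. (1 + real_of_int \<bar>n\<bar>) ^ k * cmod (coord \<phi> n)) summable_on insert 0 (UNIV - {0})"
    by (simp only: summable_on_insert_iff)
  then show ?thesis by (simp add: insert_UNIV)
qed

lemma schwartz_finite_sum:
  assumes \<phi>: "\<phi> \<in> schwartz"
  shows "\<exists>S\<ge>0. \<forall>F. finite F \<longrightarrow> (\<Sum>n\<in>F. ((1 + real_of_int \<bar>n\<bar>) ^ k * cmod (coord \<phi> n))\<^sup>2) \<le> S\<^sup>2"
proof -
  let ?w = "\<lambda>n. (1 + real_of_int \<bar>n\<bar>) ^ k * cmod (coord \<phi> n)"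
  let ?S = "\<Sum>\<^sub>\<infinity>n. ?w n"
  have "(\<Sum>n\<in>F. (?w n)\<^sup>2) \<le> ?S\<^sup>2" if F: "finite F" for F
  proof -
    have "L2_set ?w F \<le> sum ?w F" by (rule L2_set_le_sum) simp
    also have "\<dots> \<le> ?S" using F schwartz_weighted[OF \<phi>, of k] by (intro finite_sum_le_infsum) auto
    finally have "(L2_set ?w F)\<^sup>2 \<le> ?S\<^sup>2" by (intro power_mono) (auto simp: L2_set_nonneg)
    then show ?thesis by (simp add: L2_set_def sum_nonneg)
  qed
  moreover have "0 \<le> ?S" by (rule infsum_nonneg) simp
  ultimately show ?thesis by blast
qed

lemma schwartz_subset_ell1: "\<phi> \<in> schwartz \<Longrightarrow> \<phi> \<in> ell1"
  using schwartz_weighted[of \<phi> 0] by (simp add: ell1_def)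

lemma schwartz_subset_dom_X:
  assumes "\<phi> \<in> schwartz"
  shows "\<phi> \<in> dom_X"
proof -
  obtain S where S: "\<And>F. finite F \<Longrightarrow> (\<Sum>n\<in>F. ((1 + real_of_int \<bar>n\<bar>) ^ 1 * cmod (coord \<phi> n))\<^sup>2) \<le> S\<^sup>2"
    using schwartz_finite_sum[OF assms, of 1] by blast
  have "(\<Sum>n\<in>F. (cmod (of_int n * coord \<phi> n))\<^sup>2) \<le> S\<^sup>2" if F: "finite F" for F
  proof -
    have "(\<Sum>n\<in>F. (cmod (of_int n * coord \<phi> n))\<^sup>2) \<le> (\<Sum>n\<in>F. ((1 + real_of_int \<bar>n\<bar>) ^ 1 * cmod (coord \<phi> n))\<^sup>2)"
      by (intro sum_mono power_mono) (auto simp: norm_mult intro!: mult_right_mono)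
    then show ?thesis using S[OF F] by linarith
  qed
  then show ?thesis
    unfolding dom_X_def by (auto intro!: nonneg_bdd_above_summable_on bdd_aboveI[where M = "S\<^sup>2"])
qed

lemma schwartz_wt_bound:
  assumes "\<phi> \<in> schwartz"
  shows "\<exists>S. \<forall>N. norm (app (diag (wt k N)) \<phi>) \<le> S"
proof -
  obtain S where S0: "0 \<le> S" and S: "\<And>F. finite F \<Longrightarrow> (\<Sum>n\<in>F. ((1 + real_of_int \<bar>n\<bar>) ^ k * cmod (coord \<phi> n))\<^sup>2) \<le> S\<^sup>2"
    using schwartz_finite_sum[OF assms, of k] by blast
  have "norm (app (diag (wt k N)) \<phi>) \<le> S" for N
  proof (rule ell2_norm_le[OF S0])
    fix F :: "int set" assume F: "finite F"
    have "(\<Sum>n\<in>F. (cmod (coord (app (diag (wt k N)) \<phi>) n))\<^sup>2) \<le> (\<Sum>n\<in>F. ((1 + real_of_int \<bar>n\<bar>) ^ k * cmod (coord \<phi> n))\<^sup>2)"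
      using wt_nonneg wt_le
      by (intro sum_mono power_mono) (auto simp: coord_diag[OF wt_bounded] norm_mult intro!: mult_right_mono)
    then show "(\<Sum>n\<in>F. (cmod (coord (app (diag (wt k N)) \<phi>) n))\<^sup>2) \<le> S\<^sup>2" using S[OF F] by linarith
  qed
  then show ?thesis by blast
qed

section \<open>Moments\<close>

context jacobi_op
begin

abbreviation dens :: "real \<Rightarrow> ell2 \<Rightarrow> real \<Rightarrow> int \<Rightarrow> real" where
  "dens p \<phi> t n \<equiv> (\<bar>real_of_int n\<bar> powr p + 1) * (cmod (coord (app (evo J (- t)) \<phi>) n))\<^sup>2"

text \<open>For |n| up to t the weight |n|^p is at most t^p; beyond, it is at most t^(p - 2k)
  |n|^(2k) when p is at most 2k, and the even moment grows at most like t^(2k). Summability is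
  recorded because a divergent sum would have value 0.\<close>

lemma moment_upper:
  assumes \<phi>: "\<phi> \<in> schwartz" and p: "0 < p"
  shows "\<exists>C>0. \<forall>t\<ge>1. dens p \<phi> t summable_on UNIV \<and> (\<Sum>\<^sub>\<infinity>n. dens p \<phi> t n) \<le> C * t powr p"
proof -
  define k where "k = nat \<lceil>p\<rceil>"
  have pk: "p \<le> 2 * real k" using p unfolding k_def by linarith
  obtain C where C: "0 \<le> C" and sumC: "\<And>t F. 0 \<le> t \<Longrightarrow> finite F \<Longrightarrow>
      (\<Sum>n\<in>F. (1 + real_of_int \<bar>n\<bar>) ^ (2 * k) * (cmod (coord (app (evo J (- t)) \<phi>) n))\<^sup>2) \<le> C * (1 + t) ^ (2 * k)"
    using weighted_sum_le[OF schwartz_wt_bound[OF \<phi>], of k] by blast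
  define C' where "C' = 2 * (norm \<phi>)\<^sup>2 + C * 2 ^ (2 * k) + 1"
  have C': "0 < C'" unfolding C'_def using C by (intro add_nonneg_pos add_nonneg_nonneg) auto
  have fin: "(\<Sum>n\<in>F. dens p \<phi> t n) \<le> C' * t powr p" if t: "1 \<le> t" and F: "finite F" for t F
  proof -
    let ?u = "\<lambda>n. (cmod (coord (app (evo J (- t)) \<phi>) n))\<^sup>2" and ?r = "t powr (p - 2 * k)"
    have pt: "\<bar>real_of_int n\<bar> powr p + 1 \<le> 2 * t powr p + ?r * (1 + real_of_int \<bar>n\<bar>) ^ (2 * k)" for n
    proof -
      let ?x = "\<bar>real_of_int n\<bar>"
      have one: "1 \<le> t powr p" using t p by (intro ge_one_powr_ge_zero) auto
      have nn: "0 \<le> ?r * (1 + real_of_int \<bar>n\<bar>) ^ (2 * k)" by simp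
      have "?x powr p \<le> t powr p + ?r * (1 + real_of_int \<bar>n\<bar>) ^ (2 * k)"
      proof (cases "?x \<le> t")
        case True
        then have "?x powr p \<le> t powr p" using p by (intro powr_mono2) auto
        then show ?thesis using nn by linarith
      next
        case False
        then have x: "t < ?x" "0 < ?x" using t by auto
        have "?x powr p = ?x powr (p - 2 * k) * ?x ^ (2 * k)"
          using x by (simp add: powr_realpow[symmetric] powr_add[symmetric])
        also have "\<dots> \<le> ?r * (1 + real_of_int \<bar>n\<bar>) ^ (2 * k)"
          using x t pk by (intro mult_mono powr_mono2' power_mono) auto
        finally show ?thesis using one by linarith
      qed
      then show ?thesis using one by linarith
    qed
    have "(\<Sum>n\<in>F. dens p \<phi> t n) \<le> (\<Sum>n\<in>F. (2 * t powr p + ?r * (1 + real_of_int \<bar>n\<bar>) ^ (2 * k)) * ?u n)"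
      by (intro sum_mono mult_right_mono pt) simp
    also have "\<dots> = 2 * t powr p * (\<Sum>n\<in>F. ?u n) + ?r * (\<Sum>n\<in>F. (1 + real_of_int \<bar>n\<bar>) ^ (2 * k) * ?u n)"
      by (simp only: distrib_right sum.distrib sum_distrib_left mult.assoc)
    also have "\<dots> \<le> 2 * t powr p * (norm \<phi>)\<^sup>2 + ?r * (C * (2 * t) ^ (2 * k))"
    proof (intro add_mono mult_left_mono)
      show "(\<Sum>n\<in>F. ?u n) \<le> (norm \<phi>)\<^sup>2"
        using sum_coord_le_norm[OF F, of "app (evo J (- t)) \<phi>"] by simp
      have "C * (1 + t) ^ (2 * k) \<le> C * (2 * t) ^ (2 * k)"
        using t C by (intro mult_left_mono power_mono) auto
      then show "(\<Sum>n\<in>F. (1 + real_of_int \<bar>n\<bar>) ^ (2 * k) * ?u n) \<le> C * (2 * t) ^ (2 * k)"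
        using sumC[OF _ F, of t] t by linarith
    qed auto
    also have "?r * (C * (2 * t) ^ (2 * k)) = C * 2 ^ (2 * k) * t powr p"
    proof -
      have "?r * t ^ (2 * k) = t powr p"
        using t by (simp add: powr_realpow[symmetric] powr_add[symmetric])
      moreover have "?r * (C * (2 * t) ^ (2 * k)) = C * 2 ^ (2 * k) * (?r * t ^ (2 * k))"
        by (simp only: power_mult_distrib mult_ac)
      ultimately show ?thesis by simp
    qed
    also have "2 * t powr p * (norm \<phi>)\<^sup>2 + C * 2 ^ (2 * k) * t powr p \<le> C' * t powr p"
    proof -
      have "C' * t powr p = 2 * t powr p * (norm \<phi>)\<^sup>2 + C * 2 ^ (2 * k) * t powr p + t powr p"
        by (simp add: C'_def algebra_simps)
      then show ?thesis using powr_ge_zero[of t p] by linarith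
    qed
    finally show ?thesis .
  qed
  have "dens p \<phi> t summable_on UNIV \<and> (\<Sum>\<^sub>\<infinity>n. dens p \<phi> t n) \<le> C' * t powr p" if t: "1 \<le> t" for t
  proof
    show s: "dens p \<phi> t summable_on UNIV"
      using fin[OF t] by (auto intro!: nonneg_bdd_above_summable_on bdd_aboveI[where M = "C' * t powr p"])
    show "(\<Sum>\<^sub>\<infinity>n. dens p \<phi> t n) \<le> C' * t powr p"
      by (rule infsum_le_finite_sums[OF s fin[OF t]])
  qed
  then show ?thesis using C' by blast
qed

text \<open>The bulk of the second moment comes from \<open>|n|\<close> comparable to \<open>t\<close>, where all the moments
  are comparable.\<close>

lemma moment_lower:
  assumes \<phi>: "\<phi> \<in> schwartz" and p: "0 < p" and c: "0 < c"
    and lower: "\<forall>\<^sub>F t in at_top. c * t \<le> norm (position_op (app (evo J (- t)) \<phi>))"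
  shows "\<exists>c'>0. \<forall>\<^sub>F t in at_top. c' * t powr p \<le> (\<Sum>\<^sub>\<infinity>n. dens p \<phi> t n)"
proof -
  obtain C where C: "0 \<le> C" and sumC: "\<And>t F. 0 \<le> t \<Longrightarrow> finite F \<Longrightarrow>
      (\<Sum>n\<in>F. (1 + real_of_int \<bar>n\<bar>) ^ 4 * (cmod (coord (app (evo J (- t)) \<phi>) n))\<^sup>2) \<le> C * (1 + t) ^ 4"
    using weighted_sum_le[OF schwartz_wt_bound[OF \<phi>], of 2] by auto
  have summ: "dens p \<phi> t summable_on UNIV" if "1 \<le> t" for t
    using that moment_upper[OF \<phi> p] by blast
  \<comment> \<open>Sites with |n| up to \<kappa> t and, by the fourth moment, sites beyond B t
    contribute at most a quarter of c^2 t^2 each, so half of it remains in between. There |n|^(2 -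
    p) is at most m t^(2 - p), by the upper end if p is at most 2 and by the lower end otherwise;
    \<open>m\<close> adds both constants.\<close>
  define \<kappa> where "\<kappa> = c / (2 * (norm \<phi> + 1))"
  define B where "B = 8 * sqrt (C + 1) / c"
  define m where "m = \<kappa> powr (2 - p) + B powr (2 - p)"
  have \<kappa>: "0 < \<kappa>" unfolding \<kappa>_def using c by (simp add: add_nonneg_pos)
  have B: "0 < B" unfolding B_def using c C by simp
  have m: "0 < m" unfolding m_def using \<kappa> B by (simp add: add_pos_pos)
  have \<kappa>2: "\<kappa>\<^sup>2 * (norm \<phi>)\<^sup>2 \<le> c\<^sup>2 / 4"
  proof -
    have "norm \<phi> + 1 \<noteq> 0" using norm_ge_zero[of \<phi>] by linarith
    then have "\<kappa> * (norm \<phi> + 1) = c / 2" unfolding \<kappa>_def by (simp add: field_simps)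
    moreover have "\<kappa> * norm \<phi> \<le> \<kappa> * (norm \<phi> + 1)" using \<kappa> by simp
    ultimately have "\<kappa> * norm \<phi> \<le> c / 2" by simp
    then have "(\<kappa> * norm \<phi>)\<^sup>2 \<le> (c / 2)\<^sup>2" using \<kappa> by (intro power_mono) auto
    then show ?thesis by (simp add: power_mult_distrib power_divide)
  qed
  have B2: "16 * C / B\<^sup>2 \<le> c\<^sup>2 / 4"
  proof -
    have Bsq: "B\<^sup>2 = 64 * (C + 1) / c\<^sup>2" unfolding B_def using C by (simp add: power_divide power_mult_distrib)
    have "16 * C / B\<^sup>2 = C / (C + 1) * (c\<^sup>2 / 4)" unfolding Bsq using C c by (simp add: field_simps)
    also have "\<dots> \<le> 1 * (c\<^sup>2 / 4)" using C by (intro mult_right_mono) (auto simp: divide_le_eq)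
    finally show ?thesis by simp
  qed
  have "\<forall>\<^sub>F t in at_top. c\<^sup>2 / (2 * m) * t powr p \<le> (\<Sum>\<^sub>\<infinity>n. dens p \<phi> t n)"
    using lower eventually_ge_at_top[of 1]
  proof eventually_elim
    case (elim t)
    then have t: "1 \<le> t" by simp
    let ?y = "app (evo J (- t)) \<phi>" and ?M = "\<Sum>\<^sub>\<infinity>n. dens p \<phi> t n"
    let ?u = "\<lambda>n. (cmod (coord ?y n))\<^sup>2"
    have X: "?y \<in> dom_X" using position_evolution(1)[OF schwartz_subset_dom_X[OF \<phi>], of t] t by simp
    have pt: "(real_of_int n)\<^sup>2 \<le> \<kappa>\<^sup>2 * t\<^sup>2 + (1 + real_of_int \<bar>n\<bar>) ^ 4 / (B * t)\<^sup>2 + m * t powr (2 - p) * \<bar>real_of_int n\<bar> powr p" for n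
    proof -
      let ?x = "\<bar>real_of_int n\<bar>"
      have nn: "0 \<le> \<kappa>\<^sup>2 * t\<^sup>2" "0 \<le> (1 + real_of_int \<bar>n\<bar>) ^ 4 / (B * t)\<^sup>2" "0 \<le> m * t powr (2 - p) * ?x powr p"
        using m by simp_all
      consider "?x \<le> \<kappa> * t" | "B * t \<le> ?x" | "\<kappa> * t < ?x" "?x < B * t" by linarith
      then show ?thesis
      proof cases
        case 1
        then have "?x\<^sup>2 \<le> (\<kappa> * t)\<^sup>2" by (intro power_mono) auto
        then show ?thesis using nn unfolding power2_abs power_mult_distrib[of \<kappa>] by linarith
      next
        case 2
        have "0 < B * t" using B t by simp
        have "?x\<^sup>2 * (B * t)\<^sup>2 \<le> ?x\<^sup>2 * ?x\<^sup>2" using 2 B t by (intro mult_left_mono power_mono) auto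
        also have "\<dots> = ?x ^ 4" by (simp add: power_add[symmetric] del: power2_abs)
        also have "\<dots> \<le> (1 + real_of_int \<bar>n\<bar>) ^ 4" by (intro power_mono) auto
        finally have "?x\<^sup>2 \<le> (1 + real_of_int \<bar>n\<bar>) ^ 4 / (B * t)\<^sup>2" using \<open>0 < B * t\<close> by (simp only: pos_le_divide_eq zero_less_power)
        then show ?thesis using nn unfolding power2_abs by linarith
      next
        case 3
        have kt: "0 < \<kappa> * t" using \<kappa> t by simp
        then have x: "0 < ?x" using 3 by linarith
        have "?x powr (2 - p) \<le> m * t powr (2 - p)"
        proof (cases "0 \<le> 2 - p")
          case True
          then have "?x powr (2 - p) \<le> (B * t) powr (2 - p)" using 3 by (intro powr_mono2) auto
          also have "\<dots> = B powr (2 - p) * t powr (2 - p)" using B t by (simp add: powr_mult)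
          also have "\<dots> \<le> m * t powr (2 - p)" unfolding m_def by (intro mult_right_mono) auto
          finally show ?thesis .
        next
          case False
          then have "?x powr (2 - p) \<le> (\<kappa> * t) powr (2 - p)" using 3 kt by (intro powr_mono2') auto
          also have "\<dots> = \<kappa> powr (2 - p) * t powr (2 - p)" using \<kappa> t by (simp add: powr_mult)
          also have "\<dots> \<le> m * t powr (2 - p)" unfolding m_def by (intro mult_right_mono) auto
          finally show ?thesis .
        qed
        then have "?x powr (2 - p) * ?x powr p \<le> m * t powr (2 - p) * ?x powr p" by (intro mult_right_mono) auto
        moreover have "?x powr (2 - p) * ?x powr p = ?x\<^sup>2"
          using x by (simp add: powr_add[symmetric] del: power2_abs)
        ultimately show ?thesis using nn unfolding power2_abs by linarith
      qed
    qed
    have M: "(\<Sum>n\<in>F. \<bar>real_of_int n\<bar> powr p * ?u n) \<le> ?M" if "finite F" for F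
    proof -
      have "(\<Sum>n\<in>F. \<bar>real_of_int n\<bar> powr p * ?u n) \<le> (\<Sum>n\<in>F. dens p \<phi> t n)"
        by (intro sum_mono mult_right_mono) auto
      also have "\<dots> \<le> ?M" using that by (intro finite_sum_le_infsum summ t) auto
      finally show ?thesis .
    qed
    have "(norm (position_op ?y))\<^sup>2 \<le> \<kappa>\<^sup>2 * t\<^sup>2 * (norm \<phi>)\<^sup>2 + C * (2 * t) ^ 4 / (B * t)\<^sup>2 + m * t powr (2 - p) * ?M"
      unfolding norm_ell2_sq[of "position_op ?y"]
    proof (rule infsum_le_finite_sums[OF summable_coord])
      fix F :: "int set" assume F: "finite F"
      have "(\<Sum>n\<in>F. (cmod (coord (position_op ?y) n))\<^sup>2) = (\<Sum>n\<in>F. (real_of_int n)\<^sup>2 * ?u n)"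
        by (simp add: coord_position_op[OF X] norm_mult power_mult_distrib)
      also have "\<dots> \<le> (\<Sum>n\<in>F. (\<kappa>\<^sup>2 * t\<^sup>2 + (1 + real_of_int \<bar>n\<bar>) ^ 4 / (B * t)\<^sup>2 + m * t powr (2 - p) * \<bar>real_of_int n\<bar> powr p) * ?u n)"
        by (intro sum_mono mult_right_mono pt) simp
      also have "\<dots> = \<kappa>\<^sup>2 * t\<^sup>2 * (\<Sum>n\<in>F. ?u n) + (\<Sum>n\<in>F. (1 + real_of_int \<bar>n\<bar>) ^ 4 * ?u n) / (B * t)\<^sup>2
          + m * t powr (2 - p) * (\<Sum>n\<in>F. \<bar>real_of_int n\<bar> powr p * ?u n)"
        by (simp only: distrib_right sum.distrib sum_distrib_left sum_divide_distrib mult.assoc times_divide_eq_left)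
      also have "\<dots> \<le> \<kappa>\<^sup>2 * t\<^sup>2 * (norm \<phi>)\<^sup>2 + C * (2 * t) ^ 4 / (B * t)\<^sup>2 + m * t powr (2 - p) * ?M"
      proof (intro add_mono mult_left_mono divide_right_mono)
        show "(\<Sum>n\<in>F. ?u n) \<le> (norm \<phi>)\<^sup>2"
          using sum_coord_le_norm[OF F, of ?y] by simp
        have "C * (1 + t) ^ 4 \<le> C * (2 * t) ^ 4"
          using t C by (intro mult_left_mono power_mono) auto
        then show "(\<Sum>n\<in>F. (1 + real_of_int \<bar>n\<bar>) ^ 4 * ?u n) \<le> C * (2 * t) ^ 4"
          using sumC[OF _ F, of t] t by linarith
        show "(\<Sum>n\<in>F. \<bar>real_of_int n\<bar> powr p * ?u n) \<le> ?M" by (rule M[OF F])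
      qed (use m in auto)
      finally show "(\<Sum>n\<in>F. (cmod (coord (position_op ?y) n))\<^sup>2) \<le>
        \<kappa>\<^sup>2 * t\<^sup>2 * (norm \<phi>)\<^sup>2 + C * (2 * t) ^ 4 / (B * t)\<^sup>2 + m * t powr (2 - p) * ?M" .
    qed
    moreover have "(c * t)\<^sup>2 \<le> (norm (position_op ?y))\<^sup>2" using elim c by (intro power_mono) auto
    moreover have "\<kappa>\<^sup>2 * t\<^sup>2 * (norm \<phi>)\<^sup>2 \<le> c\<^sup>2 / 4 * t\<^sup>2"
      using mult_right_mono[OF \<kappa>2, of "t\<^sup>2"] by (simp add: mult_ac)
    moreover have "C * (2 * t) ^ 4 / (B * t)\<^sup>2 \<le> c\<^sup>2 / 4 * t\<^sup>2"
    proof -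
      have t4: "(2 * t) ^ 4 = 16 * (t\<^sup>2 * t\<^sup>2)" by (simp add: power_mult_distrib power_add[symmetric])
      have cancel: "C * (16 * (s * s)) / (b * s) = 16 * C / b * s" if "s \<noteq> 0" "b \<noteq> 0" for s b :: real
        using that by (simp add: field_simps)
      have "C * (2 * t) ^ 4 / (B * t)\<^sup>2 = 16 * C / B\<^sup>2 * t\<^sup>2"
        unfolding t4 power_mult_distrib[of B] using t B by (intro cancel) auto
      then show ?thesis using mult_right_mono[OF B2, of "t\<^sup>2"] by simp
    qed
    moreover have "(c * t)\<^sup>2 = c\<^sup>2 / 4 * t\<^sup>2 + c\<^sup>2 / 4 * t\<^sup>2 + c\<^sup>2 / 2 * t\<^sup>2" by (simp add: power_mult_distrib)
    ultimately have "c\<^sup>2 / 2 * t\<^sup>2 \<le> m * t powr (2 - p) * ?M" by linarith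
    moreover have "t\<^sup>2 = t powr (2 - p) * t powr p" using t by (simp add: powr_add[symmetric])
    ultimately have "t powr (2 - p) * (c\<^sup>2 / 2 * t powr p) \<le> t powr (2 - p) * (m * ?M)"
      by (simp add: mult_ac)
    then have "c\<^sup>2 / 2 * t powr p \<le> m * ?M" using t by (simp add: mult_le_cancel_left_pos)
    then show ?case using m by (simp add: field_simps)
  qed
  moreover have "0 < c\<^sup>2 / (2 * m)" using c m by simp
  ultimately show ?thesis by blast
qed

end

section \<open>The limit operator and the transport exponents\<close>

lemma log_ratio_tendsto_1:
  fixes f :: "real \<Rightarrow> real"
  assumes p: "0 < p" and c: "0 < c1" "0 < c2"
    and lo: "\<forall>\<^sub>F t in at_top. c1 * t powr p \<le> f t" and hi: "\<forall>\<^sub>F t in at_top. f t \<le> c2 * t powr p"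
  shows "((\<lambda>t. ln (f t) / (p * ln t)) \<longlongrightarrow> 1) at_top"
proof (rule tendsto_sandwich)
  have at: "filterlim (\<lambda>t::real. p * ln t) at_top at_top"
    by (rule filterlim_tendsto_pos_mult_at_top[OF tendsto_const p ln_at_top])
  have "((\<lambda>t. 1 + ln c' / (p * ln t)) \<longlongrightarrow> 1 + 0) at_top" for c'
    by (intro tendsto_add tendsto_const tendsto_divide_0[OF tendsto_const] filterlim_at_top_imp_at_infinity at)
  then show "((\<lambda>t. 1 + ln c1 / (p * ln t)) \<longlongrightarrow> 1) at_top" "((\<lambda>t. 1 + ln c2 / (p * ln t)) \<longlongrightarrow> 1) at_top"
    by simp_all
  have eq: "1 + ln c' / (p * ln t) = ln (c' * t powr p) / (p * ln t)" if "1 < t" "0 < c'" for c' t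
  proof -
    have "ln (c' * t powr p) = ln c' + p * ln t" using that by (simp add: ln_mult ln_powr)
    moreover have "p * ln t \<noteq> 0" using p that by simp
    ultimately show ?thesis by (simp add: add_divide_distrib)
  qed
  show "\<forall>\<^sub>F t in at_top. 1 + ln c1 / (p * ln t) \<le> ln (f t) / (p * ln t)"
    using lo eventually_gt_at_top[of 1]
  proof eventually_elim
    case (elim t)
    have "0 < c1 * t powr p" using c elim by simp
    then show ?case unfolding eq[OF elim(2) c(1)] using elim p
      by (intro divide_right_mono ln_mono) auto
  qed
  show "\<forall>\<^sub>F t in at_top. ln (f t) / (p * ln t) \<le> 1 + ln c2 / (p * ln t)"
    using lo hi eventually_gt_at_top[of 1]
  proof eventually_elim
    case (elim t)
    have "0 < c1 * t powr p" using c elim by simp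
    then have "0 < f t" using elim by linarith
    then show ?case unfolding eq[OF elim(3) c(2)] using elim p
      by (intro divide_right_mono ln_mono) auto
  qed
qed

lemma scaleC_eq_app: "c *\<^sub>C x = app (Re c *\<^sub>R 1 + Im c *\<^sub>R iop) x"
proof (rule ell2_eqI)
  fix n
  show "coord (c *\<^sub>C x) n = coord (app (Re c *\<^sub>R 1 + Im c *\<^sub>R iop) x) n"
    using complex_eq[of c] by (simp add: scaleR_conv_of_real[where 'a = complex]) (metis distrib_right mult.assoc mult.commute)
qed

text \<open>The limit is defined everywhere, so its symmetry settles the graph of the adjoint:
  testing against basis vectors recovers each coordinate of the image.\<close>

lemma strong_limit_self_adjoint:
  assumes lim: "\<And>\<phi>. ((\<lambda>t::real. app (T t) \<phi>) \<longlongrightarrow> Q \<phi>) at_top"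
    and lin: "\<And>t. clinear_op (T t)" and sym: "\<And>t. symm (T t)"
  shows "self_adjoint_on UNIV Q"
proof -
  have add: "Q (\<phi> + \<psi>) = Q \<phi> + Q \<psi>" for \<phi> \<psi>
  proof (rule tendsto_unique[OF trivial_limit_at_top_linorder lim])
    show "((\<lambda>t. app (T t) (\<phi> + \<psi>)) \<longlongrightarrow> Q \<phi> + Q \<psi>) at_top"
      unfolding app_simps by (intro tendsto_add lim)
  qed
  have scale: "Q (c *\<^sub>C \<phi>) = c *\<^sub>C Q \<phi>" for c \<phi>
  proof (rule tendsto_unique[OF trivial_limit_at_top_linorder lim])
    show "((\<lambda>t. app (T t) (c *\<^sub>C \<phi>)) \<longlongrightarrow> c *\<^sub>C Q \<phi>) at_top"
      unfolding app_scaleC[OF lin] unfolding scaleC_eq_app[of c]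
      by (rule bounded_linear.tendsto[OF bounded_linear_app lim])
  qed
  have inn: "inner (Q \<phi>) \<psi> = inner \<phi> (Q \<psi>)" for \<phi> \<psi>
  proof (rule tendsto_unique[OF trivial_limit_at_top_linorder])
    show "((\<lambda>t. inner (app (T t) \<phi>) \<psi>) \<longlongrightarrow> inner (Q \<phi>) \<psi>) at_top"
      by (intro tendsto_inner lim tendsto_const)
    show "((\<lambda>t. inner (app (T t) \<phi>) \<psi>) \<longlongrightarrow> inner \<phi> (Q \<psi>)) at_top"
      unfolding symmD[OF sym] by (intro tendsto_inner lim tendsto_const)
  qed
  have cin: "cinner (Q \<phi>) \<psi> = cinner \<phi> (Q \<psi>)" for \<phi> \<psi>
    unfolding cinner_eq_inner inn app_iop scale ..
  have "(Q \<psi> = \<omega>) \<longleftrightarrow> (\<forall>\<phi>. cinner (Q \<phi>) \<psi> = cinner \<phi> \<omega>)" for \<psi> \<omega>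
  proof
    assume *: "\<forall>\<phi>. cinner (Q \<phi>) \<psi> = cinner \<phi> \<omega>"
    show "Q \<psi> = \<omega>"
    proof (rule ell2_eqI)
      fix n
      show "coord (Q \<psi>) n = coord \<omega> n" using *[rule_format, of "delta n"] by (simp add: cin)
    qed
  qed (simp add: cin)
  then show ?thesis by (simp add: self_adjoint_on_def add scale)
qed

context exp_approx
begin

lemma mean_vel_strong_limit: "\<exists>y. ((\<lambda>t. app (mean_vel t) \<phi>) \<longlongrightarrow> y) at_top"
proof (rule strong_limit_from_ell1[OF norm_mean_vel])
  fix \<psi> assume "\<psi> \<in> ell1"
  from limit_ell1[OF this] obtain y where
    "((\<lambda>t. app (mean_vel t) \<psi>) \<longlongrightarrow> y) at_top \<and> (\<forall>n. norm (y - app (mean_vel (threshold n)) \<psi>) \<le> 2 * window_const \<psi> / M ^ p n)" ..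
  then show "\<exists>y. ((\<lambda>t. app (mean_vel t) \<psi>) \<longlongrightarrow> y) at_top" by (intro exI) (rule conjunct1)
qed

definition Q :: "ell2 \<Rightarrow> ell2" where
  "Q \<phi> = (SOME y. ((\<lambda>t. app (mean_vel t) \<phi>) \<longlongrightarrow> y) at_top)"

lemma mean_vel_tendsto_Q: "((\<lambda>t. app (mean_vel t) \<phi>) \<longlongrightarrow> Q \<phi>) at_top"
  unfolding Q_def by (rule someI_ex[OF mean_vel_strong_limit])

lemma Q_self_adjoint: "self_adjoint_on UNIV Q"
proof (rule strong_limit_self_adjoint[OF mean_vel_tendsto_Q])
  show "clinear_op (mean_vel t)" for t
    unfolding mean_vel_def by (rule clinear_op_avg[OF clinear_A clinear_J])
  show "symm (mean_vel t)" for t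
    unfolding mean_vel_def by (rule symm_avg[OF symm_A])
qed

lemma Q_kernel:
  assumes "\<phi> \<in> ell1" "Q \<phi> = 0"
  shows "\<phi> = 0"
  using limit_nonzero[OF assms(1)] mean_vel_tendsto_Q[of \<phi>] assms(2) by simp

lemma Q_0: "Q 0 = 0"
  by (rule tendsto_unique[OF trivial_limit_at_top_linorder mean_vel_tendsto_Q]) simp

lemma position_limit:
  assumes "\<phi> \<in> dom_X"
  shows "((\<lambda>t. (1 / t) *\<^sub>R position_op \<phi> + app (mean_vel t) \<phi>) \<longlongrightarrow> Q \<phi>) at_top"
proof -
  have "((\<lambda>t. 1 / t) \<longlongrightarrow> (0::real)) at_top"
    by (intro tendsto_divide_0[OF tendsto_const] filterlim_at_top_imp_at_infinity filterlim_ident)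
  then have "((\<lambda>t. (1 / t) *\<^sub>R position_op \<phi> + app (mean_vel t) \<phi>) \<longlongrightarrow> 0 *\<^sub>R position_op \<phi> + Q \<phi>) at_top"
    by (intro tendsto_intros mean_vel_tendsto_Q)
  then show ?thesis by simp
qed

text \<open>The unitary factors of \<open>position_evolution\<close> cancel; what separates the
  scaled position from the mean velocity is X/t, which vanishes in the limit on
  \<open>dom_X\<close>.\<close>

lemma position_scaled:
  assumes "\<phi> \<in> dom_X" "0 < t"
  shows "(1 / t) *\<^sub>R app (evo J t) (position_op (app (evo J (- t)) \<phi>)) = (1 / t) *\<^sub>R position_op \<phi> + app (mean_vel t) \<phi>"
  using assms by (simp add: position_evolution mean_vel_def scaleR_add_right)

lemma position_growth:
  assumes "\<phi> \<in> dom_X" "Q \<phi> \<noteq> 0"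
  shows "\<forall>\<^sub>F t in at_top. norm (Q \<phi>) / 2 * t \<le> norm (position_op (app (evo J (- t)) \<phi>))"
proof -
  have "norm (Q \<phi>) / 2 < norm (Q \<phi>)" using assms(2) by simp
  from order_tendstoD(1)[OF tendsto_norm[OF position_limit[OF assms(1)]] this]
  show ?thesis
    using eventually_gt_at_top[of 0]
  proof eventually_elim
    case (elim t)
    have "norm (Q \<phi>) / 2 < norm ((1 / t) *\<^sub>R app (evo J t) (position_op (app (evo J (- t)) \<phi>)))"
      unfolding position_scaled[OF assms(1) elim(2)] by (rule elim(1))
    also have "\<dots> = norm (position_op (app (evo J (- t)) \<phi>)) / t" using elim by simp
    finally show ?case using elim by (simp add: pos_less_divide_eq)
  qed
qed

text \<open>Triviality of the kernel on \<open>ell1\<close> turns a nonzero Schwartz vector into one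
  with linear growth of position, which \<open>moment_lower\<close> transfers to all
  moments.\<close>

lemma moment_exponent:
  assumes \<phi>: "\<phi> \<in> schwartz" "\<phi> \<noteq> 0" and e: "0 < e"
  shows "((\<lambda>t. ln (\<Sum>\<^sub>\<infinity>n. dens e \<phi> t n) / (e * ln t)) \<longlongrightarrow> 1) at_top"
proof -
  have Q: "Q \<phi> \<noteq> 0" using Q_kernel[OF schwartz_subset_ell1[OF \<phi>(1)]] \<phi>(2) by blast
  then have "0 < norm (Q \<phi>) / 2" by simp
  from moment_lower[OF \<phi>(1) e this position_growth[OF schwartz_subset_dom_X[OF \<phi>(1)] Q]]
  obtain c where c: "0 < c" "\<forall>\<^sub>F t in at_top. c * t powr e \<le> (\<Sum>\<^sub>\<infinity>n. dens e \<phi> t n)" by blast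
  obtain C where C: "0 < C" "\<And>t. 1 \<le> t \<Longrightarrow> (\<Sum>\<^sub>\<infinity>n. dens e \<phi> t n) \<le> C * t powr e"
    using moment_upper[OF \<phi>(1) e] by blast
  have "\<forall>\<^sub>F t in at_top. (\<Sum>\<^sub>\<infinity>n. dens e \<phi> t n) \<le> C * t powr e"
    using eventually_ge_at_top[of 1] by eventually_elim (rule C(2))
  then show ?thesis by (rule log_ratio_tendsto_1[OF e c(1) C(1) c(2)])
qed

end

theorem corollary1p2:
  fixes J :: "ell2 \<Rightarrow>\<^sub>L ell2"
  assumes "jacobi_matrix J" and "exp_class_infinity J"
  shows "(\<exists>Q :: ell2 \<Rightarrow> ell2. self_adjoint_on UNIV Q \<and>
            (\<forall>\<phi>\<in>dom_X. ((\<lambda>t::real. norm ((1 / t) *\<^sub>R position_at J t \<phi> - Q \<phi>)) \<longlongrightarrow> 0) at_top) \<and>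
            {\<phi>. Q \<phi> = 0} \<inter> ell1 = {0}) \<and>
         (\<forall>\<phi>\<in>schwartz. \<phi> \<noteq> 0 \<longrightarrow>
            (\<forall>p::real. p > 0 \<longrightarrow> beta_plus J \<phi> p = 1 \<and> beta_minus J \<phi> p = 1))"
proof -
  obtain a b where J: "jacobi_with a b J" using assms(1) unfolding jacobi_matrix_def by blast
  obtain r a' b' \<alpha> L K C M where "exp_approx a b r a' b' \<alpha> L K C M"
    using exp_class_approx[OF J assms(2)] by blast
  then interpret E: exp_approx a b r a' b' \<alpha> L K C M .
  note jac = jacobi_with_jac(2)[OF J]
  have cl: "clinear_op (Bop J)" unfolding jac by (rule E.clinear_J)
  have ex: "exp_op (\<i> * complex_of_real t) J x = app (evo E.J t) x"
    "exp_op (- \<i> * complex_of_real t) J x = app (evo E.J (- t)) x" for t x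
    using exp_op_eq_evo[OF cl, of t x] exp_op_eq_evo[OF cl, of "- t" x] unfolding jac by simp_all
  have pos: "((\<lambda>t. norm ((1 / t) *\<^sub>R position_at J t \<phi> - E.Q \<phi>)) \<longlongrightarrow> 0) at_top" if \<phi>: "\<phi> \<in> dom_X" for \<phi>
  proof -
    have "\<forall>\<^sub>F t in at_top. (1 / t) *\<^sub>R position_op \<phi> + app (E.mean_vel t) \<phi> = (1 / t) *\<^sub>R position_at J t \<phi>"
      using eventually_gt_at_top[of 0]
      by eventually_elim (simp only: position_at_def ex E.position_scaled[OF \<phi>])
    from Lim_transform_eventually[OF E.position_limit[OF \<phi>] this]
    show ?thesis by (rule tendsto_norm_zero[OF LIM_zero])
  qed
  have ker: "{\<phi>. E.Q \<phi> = 0} \<inter> ell1 = {0}"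
    using E.Q_kernel E.Q_0 by (auto simp: ell1_def)
  have beta: "beta_plus J \<phi> p = 1 \<and> beta_minus J \<phi> p = 1" if \<phi>: "\<phi> \<in> schwartz" "\<phi> \<noteq> 0" and p: "0 < p" for \<phi> p
  proof -
    have "moment J p \<phi> t = (\<Sum>\<^sub>\<infinity>n. E.dens p \<phi> t n)" for t
      unfolding moment_def ex by simp
    then have "((\<lambda>t. ereal (ln (moment J p \<phi> t) / (p * ln t))) \<longlongrightarrow> ereal 1) at_top"
      using E.moment_exponent[OF \<phi> p] by (simp only: tendsto_ereal)
    then show ?thesis
      unfolding beta_plus_def beta_minus_def
      by (simp add: lim_imp_Limsup lim_imp_Liminf one_ereal_def)
  qed
  show ?thesis
    using E.Q_self_adjoint pos ker beta by blast
qed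

end
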